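(* Let $\mathcal{A}$ be an abelian category with a generator, small direct sums and exact small products. Then the class of local inverse sequences in $\mathcal{A}$ is the least class of inverse sequences in $\mathcal{A}$ containing the zero inverse sequence and closed with respect to small limits (in the category of inverse sequences) and null-extensions.
   Context: A generator of $\mathcal{A}$ is an object $G$ such that the functor $\mathcal{A}(G,-)$ is faithful. An inverse sequence $S$ in $\mathcal{A}$ consists of objects $S_i$ and morphisms $f_i:S_{i+1}\to S_i$, $i\in\omega=\{0,1,2,\dots\}$, i.e. it is a functor $\omega^{\mathrm{op}}\to\mathcal{A}$. Inverse sequences form an abelian category $\mathcal{A}^{\omega^{\mathrm{op}}}$, in which kernels, cokernels and limits are computed componentwise. The objects $\lim S$ and $\lim^1 S$ (the limit and its first right derived functor) are the kernel and the cokernel of $1-F:\prod_i S_i\to\prod_i S_i$, where $\mathrm{pr}_jF=f_j\,\mathrm{pr}_{j+1}$. $S$ is called local if $\lim S=\lim^1 S=0$. An inverse sequence $N$ is called null if all its maps $N_{i+1}\to N_i$ are zero. If there is a short exact sequence of inverse sequences $N\rightarrowtail S'\twoheadrightarrow S$ with $N$ null, then $S'$ is called a null-extension of $S$. A class is closed with respect to null-extensions if, whenever $S$ is in the class and $S'$ is a null-extension of $S$, $S'$ is in the class. *)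

theory Defs
  imports "HOL-Algebra.Group"
begin

section \<open>Universes\<close>

text \<open>
  Smallness refers to a fixed uncountable strongly inaccessible cardinal \<open>\<kappa>\<close>
  (equivalently, to a Grothendieck universe containing the natural numbers): a set is small if
  it has fewer than \<open>\<kappa>\<close> elements. Since \<open>\<kappa>\<close> is a well-order of a subset of some type
  \<open>'u\<close>, every small set is in bijection with a set of elements of \<open>'u\<close>; hence index sets and
  index categories of small products and limits may be taken inside \<open>'u\<close>.
\<close>

context
  includes cardinal_syntax
begin

definition inaccessible :: "'u rel \<Rightarrow> bool" where
  "inaccessible \<kappa> \<longleftrightarrow>
     Card_order \<kappa> \<and> natLeq <o \<kappa> \<and> regularCard \<kappa> \<and>
     (\<forall>X :: 'u set. |X| <o \<kappa> \<longrightarrow> |Pow X| <o \<kappa>)"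

definition small :: "'u rel \<Rightarrow> 'a set \<Rightarrow> bool" where
  "small \<kappa> X \<longleftrightarrow> |X| <o \<kappa>"

end


section \<open>Categories\<close>

record ('o, 'm) category =
  Obj :: "'o set"
  Arr :: "'m set"
  Dom :: "'m \<Rightarrow> 'o"
  Cod :: "'m \<Rightarrow> 'o"
  Ident :: "'o \<Rightarrow> 'm"
  Comp :: "'m \<Rightarrow> 'm \<Rightarrow> 'm"  (infixr \<open>\<cdot>\<index>\<close> 70)  \<comment> \<open>\<open>g \<cdot> f\<close> is \<open>f\<close> followed by \<open>g\<close>\<close>

definition Hom :: "('o, 'm, 'z) category_scheme \<Rightarrow> 'o \<Rightarrow> 'o \<Rightarrow> 'm set" where
  "Hom C X Y = {f \<in> Arr C. Dom C f = X \<and> Cod C f = Y}"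

definition is_category :: "('o, 'm, 'z) category_scheme \<Rightarrow> bool" where
  "is_category C \<longleftrightarrow>
     (\<forall>f \<in> Arr C. Dom C f \<in> Obj C \<and> Cod C f \<in> Obj C) \<and>
     (\<forall>X \<in> Obj C. Ident C X \<in> Hom C X X) \<and>
     (\<forall>X Y Z f g. f \<in> Hom C X Y \<and> g \<in> Hom C Y Z \<longrightarrow> g \<cdot>\<^bsub>C\<^esub> f \<in> Hom C X Z) \<and>
     (\<forall>X Y f. f \<in> Hom C X Y \<longrightarrow> f \<cdot>\<^bsub>C\<^esub> Ident C X = f \<and> Ident C Y \<cdot>\<^bsub>C\<^esub> f = f) \<and>
     (\<forall>W X Y Z f g h. f \<in> Hom C W X \<and> g \<in> Hom C X Y \<and> h \<in> Hom C Y Z \<longrightarrow>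
        (h \<cdot>\<^bsub>C\<^esub> g) \<cdot>\<^bsub>C\<^esub> f = h \<cdot>\<^bsub>C\<^esub> (g \<cdot>\<^bsub>C\<^esub> f))"

definition locally_small :: "'u rel \<Rightarrow> ('o, 'm, 'z) category_scheme \<Rightarrow> bool" where
  "locally_small \<kappa> C \<longleftrightarrow> (\<forall>X \<in> Obj C. \<forall>Y \<in> Obj C. small \<kappa> (Hom C X Y))"

definition is_mono :: "('o, 'm, 'z) category_scheme \<Rightarrow> 'm \<Rightarrow> bool" where
  "is_mono C f \<longleftrightarrow> f \<in> Arr C \<and>
     (\<forall>W. \<forall>g \<in> Hom C W (Dom C f). \<forall>h \<in> Hom C W (Dom C f). f \<cdot>\<^bsub>C\<^esub> g = f \<cdot>\<^bsub>C\<^esub> h \<longrightarrow> g = h)"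

definition is_epi :: "('o, 'm, 'z) category_scheme \<Rightarrow> 'm \<Rightarrow> bool" where
  "is_epi C f \<longleftrightarrow> f \<in> Arr C \<and>
     (\<forall>Z. \<forall>g \<in> Hom C (Cod C f) Z. \<forall>h \<in> Hom C (Cod C f) Z. g \<cdot>\<^bsub>C\<^esub> f = h \<cdot>\<^bsub>C\<^esub> f \<longrightarrow> g = h)"

definition zero_object :: "('o, 'm, 'z) category_scheme \<Rightarrow> 'o \<Rightarrow> bool" where
  "zero_object C Z \<longleftrightarrow> Z \<in> Obj C \<and>
     (\<forall>X \<in> Obj C. (\<exists>!f. f \<in> Hom C X Z) \<and> (\<exists>!f. f \<in> Hom C Z X))"

definition is_product ::
    "('o, 'm, 'z) category_scheme \<Rightarrow> 'i set \<Rightarrow> ('i \<Rightarrow> 'o) \<Rightarrow> 'o \<Rightarrow> ('i \<Rightarrow> 'm) \<Rightarrow> bool" where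
  "is_product C I X P p \<longleftrightarrow>
     P \<in> Obj C \<and> (\<forall>i \<in> I. p i \<in> Hom C P (X i)) \<and>
     (\<forall>W \<in> Obj C. \<forall>f. (\<forall>i \<in> I. f i \<in> Hom C W (X i)) \<longrightarrow>
        (\<exists>!h. h \<in> Hom C W P \<and> (\<forall>i \<in> I. p i \<cdot>\<^bsub>C\<^esub> h = f i)))"

definition is_coproduct ::
    "('o, 'm, 'z) category_scheme \<Rightarrow> 'i set \<Rightarrow> ('i \<Rightarrow> 'o) \<Rightarrow> 'o \<Rightarrow> ('i \<Rightarrow> 'm) \<Rightarrow> bool" where
  "is_coproduct C I X Q q \<longleftrightarrow>
     Q \<in> Obj C \<and> (\<forall>i \<in> I. q i \<in> Hom C (X i) Q) \<and>
     (\<forall>W \<in> Obj C. \<forall>f. (\<forall>i \<in> I. f i \<in> Hom C (X i) W) \<longrightarrow>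
        (\<exists>!h. h \<in> Hom C Q W \<and> (\<forall>i \<in> I. h \<cdot>\<^bsub>C\<^esub> q i = f i)))"

definition has_small_products :: "'u rel \<Rightarrow> ('o, 'm, 'z) category_scheme \<Rightarrow> bool" where
  "has_small_products \<kappa> C \<longleftrightarrow>
     (\<forall>(I :: 'u set) X. small \<kappa> I \<and> X ` I \<subseteq> Obj C \<longrightarrow> (\<exists>P p. is_product C I X P p))"

definition has_small_coproducts :: "'u rel \<Rightarrow> ('o, 'm, 'z) category_scheme \<Rightarrow> bool" where
  "has_small_coproducts \<kappa> C \<longleftrightarrow>
     (\<forall>(I :: 'u set) X. small \<kappa> I \<and> X ` I \<subseteq> Obj C \<longrightarrow> (\<exists>Q q. is_coproduct C I X Q q))"

text \<open>The functor represented by \<open>G\<close> is faithful.\<close>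

definition generator :: "('o, 'm, 'z) category_scheme \<Rightarrow> 'o \<Rightarrow> bool" where
  "generator C G \<longleftrightarrow> G \<in> Obj C \<and>
     (\<forall>X \<in> Obj C. \<forall>Y \<in> Obj C. inj_on (\<lambda>f. \<lambda>h \<in> Hom C G X. f \<cdot>\<^bsub>C\<^esub> h) (Hom C X Y))"


section \<open>Limits of functors\<close>

definition is_functor ::
    "('i, 'a, 'y) category_scheme \<Rightarrow> ('o, 'm, 'z) category_scheme \<Rightarrow> ('i \<Rightarrow> 'o) \<Rightarrow> ('a \<Rightarrow> 'm) \<Rightarrow> bool"
  where
  "is_functor J C D D' \<longleftrightarrow>
     (\<forall>j \<in> Obj J. D j \<in> Obj C) \<and>
     (\<forall>a \<in> Arr J. D' a \<in> Hom C (D (Dom J a)) (D (Cod J a))) \<and>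
     (\<forall>j \<in> Obj J. D' (Ident J j) = Ident C (D j)) \<and>
     (\<forall>a \<in> Arr J. \<forall>b \<in> Arr J. Dom J b = Cod J a \<longrightarrow> D' (b \<cdot>\<^bsub>J\<^esub> a) = D' b \<cdot>\<^bsub>C\<^esub> D' a)"

definition is_cone ::
    "('i, 'a, 'y) category_scheme \<Rightarrow> ('o, 'm, 'z) category_scheme \<Rightarrow> ('i \<Rightarrow> 'o) \<Rightarrow> ('a \<Rightarrow> 'm) \<Rightarrow>
      'o \<Rightarrow> ('i \<Rightarrow> 'm) \<Rightarrow> bool" where
  "is_cone J C D D' L p \<longleftrightarrow>
     L \<in> Obj C \<and> (\<forall>j \<in> Obj J. p j \<in> Hom C L (D j)) \<and>
     (\<forall>a \<in> Arr J. D' a \<cdot>\<^bsub>C\<^esub> p (Dom J a) = p (Cod J a))"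

definition is_limit ::
    "('i, 'a, 'y) category_scheme \<Rightarrow> ('o, 'm, 'z) category_scheme \<Rightarrow> ('i \<Rightarrow> 'o) \<Rightarrow> ('a \<Rightarrow> 'm) \<Rightarrow>
      'o \<Rightarrow> ('i \<Rightarrow> 'm) \<Rightarrow> bool" where
  "is_limit J C D D' L p \<longleftrightarrow>
     is_cone J C D D' L p \<and>
     (\<forall>W q. is_cone J C D D' W q \<longrightarrow>
        (\<exists>!h. h \<in> Hom C W L \<and> (\<forall>j \<in> Obj J. p j \<cdot>\<^bsub>C\<^esub> h = q j)))"

definition closed_under_small_limits ::
    "'u rel \<Rightarrow> ('o, 'm, 'z) category_scheme \<Rightarrow> 'o set \<Rightarrow> bool" where
  "closed_under_small_limits \<kappa> C K \<longleftrightarrow>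
     (\<forall>(J :: ('u, 'u) category) D D' L p.
        is_category J \<and> small \<kappa> (Obj J) \<and> small \<kappa> (Arr J) \<and>
        is_functor J C D D' \<and> D ` Obj J \<subseteq> K \<and> is_limit J C D D' L p \<longrightarrow> L \<in> K)"


section \<open>Abelian categories\<close>

record ('o, 'm) preadditive_category = "('o, 'm) category" +
  Add :: "'m \<Rightarrow> 'm \<Rightarrow> 'm"
  Zero :: "'o \<Rightarrow> 'o \<Rightarrow> 'm"

definition hom_group :: "('o, 'm, 'z) preadditive_category_scheme \<Rightarrow> 'o \<Rightarrow> 'o \<Rightarrow> 'm monoid" where
  "hom_group C X Y = \<lparr>carrier = Hom C X Y, mult = Add C, one = Zero C X Y\<rparr>"

definition Minus :: "('o, 'm, 'z) preadditive_category_scheme \<Rightarrow> 'm \<Rightarrow> 'm \<Rightarrow> 'm" where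
  "Minus C f g = Add C f (inv\<^bsub>hom_group C (Dom C g) (Cod C g)\<^esub> g)"

definition is_preadditive :: "('o, 'm, 'z) preadditive_category_scheme \<Rightarrow> bool" where
  "is_preadditive C \<longleftrightarrow>
     is_category C \<and>
     (\<forall>X \<in> Obj C. \<forall>Y \<in> Obj C. comm_group (hom_group C X Y)) \<and>
     (\<forall>X Y Z f f' g g'. f \<in> Hom C X Y \<and> f' \<in> Hom C X Y \<and> g \<in> Hom C Y Z \<and> g' \<in> Hom C Y Z \<longrightarrow>
        g \<cdot>\<^bsub>C\<^esub> Add C f f' = Add C (g \<cdot>\<^bsub>C\<^esub> f) (g \<cdot>\<^bsub>C\<^esub> f') \<and>
        Add C g g' \<cdot>\<^bsub>C\<^esub> f = Add C (g \<cdot>\<^bsub>C\<^esub> f) (g' \<cdot>\<^bsub>C\<^esub> f))"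

definition is_kernel :: "('o, 'm, 'z) preadditive_category_scheme \<Rightarrow> 'm \<Rightarrow> 'm \<Rightarrow> bool" where
  "is_kernel C f k \<longleftrightarrow>
     f \<in> Arr C \<and> k \<in> Arr C \<and> Cod C k = Dom C f \<and> f \<cdot>\<^bsub>C\<^esub> k = Zero C (Dom C k) (Cod C f) \<and>
     (\<forall>W. \<forall>h \<in> Hom C W (Dom C f). f \<cdot>\<^bsub>C\<^esub> h = Zero C W (Cod C f) \<longrightarrow>
        (\<exists>!u. u \<in> Hom C W (Dom C k) \<and> k \<cdot>\<^bsub>C\<^esub> u = h))"

definition is_cokernel :: "('o, 'm, 'z) preadditive_category_scheme \<Rightarrow> 'm \<Rightarrow> 'm \<Rightarrow> bool" where
  "is_cokernel C f c \<longleftrightarrow>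
     f \<in> Arr C \<and> c \<in> Arr C \<and> Dom C c = Cod C f \<and> c \<cdot>\<^bsub>C\<^esub> f = Zero C (Dom C f) (Cod C c) \<and>
     (\<forall>W. \<forall>h \<in> Hom C (Cod C f) W. h \<cdot>\<^bsub>C\<^esub> f = Zero C (Dom C f) W \<longrightarrow>
        (\<exists>!u. u \<in> Hom C (Cod C c) W \<and> u \<cdot>\<^bsub>C\<^esub> c = h))"

definition is_abelian :: "('o, 'm, 'z) preadditive_category_scheme \<Rightarrow> bool" where
  "is_abelian C \<longleftrightarrow>
     is_preadditive C \<and>
     (\<exists>Z. zero_object C Z) \<and>
     (\<forall>X \<in> Obj C. \<forall>Y \<in> Obj C. \<exists>P p. is_product C (UNIV :: bool set) (\<lambda>b. if b then X else Y) P p) \<and>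
     (\<forall>f \<in> Arr C. \<exists>k. is_kernel C f k) \<and>
     (\<forall>f \<in> Arr C. \<exists>c. is_cokernel C f c) \<and>
     (\<forall>m. is_mono C m \<longrightarrow> (\<exists>f. is_kernel C f m)) \<and>
     (\<forall>e. is_epi C e \<longrightarrow> (\<exists>f. is_cokernel C f e))"

definition short_exact :: "('o, 'm, 'z) preadditive_category_scheme \<Rightarrow> 'm \<Rightarrow> 'm \<Rightarrow> bool" where
  "short_exact C f g \<longleftrightarrow> is_kernel C g f \<and> is_cokernel C f g"

text \<open>
  Exactness of the functors \<open>\<Prod>\<^bsub>i\<in>I\<^esub>\<close> for small \<open>I\<close>: the product of a small family of short exact
  sequences \<open>X i \<rightarrow> Y i \<rightarrow> Z i\<close>, given by \<open>f i\<close> and \<open>g i\<close>, is a short exact sequence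
  \<open>P \<rightarrow> Q \<rightarrow> R\<close>, given by the induced morphisms \<open>u\<close> and \<open>v\<close>.
\<close>

definition exact_small_products :: "'u rel \<Rightarrow> ('o, 'm, 'z) preadditive_category_scheme \<Rightarrow> bool" where
  "exact_small_products \<kappa> C \<longleftrightarrow>
     (\<forall>(I :: 'u set) f g P p Q q R r u v.
        small \<kappa> I \<and> (\<forall>i \<in> I. short_exact C (f i) (g i)) \<and>
        is_product C I (\<lambda>i. Dom C (f i)) P p \<and>
        is_product C I (\<lambda>i. Cod C (f i)) Q q \<and>
        is_product C I (\<lambda>i. Cod C (g i)) R r \<and>
        u \<in> Hom C P Q \<and> (\<forall>i \<in> I. q i \<cdot>\<^bsub>C\<^esub> u = f i \<cdot>\<^bsub>C\<^esub> p i) \<and>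
        v \<in> Hom C Q R \<and> (\<forall>i \<in> I. r i \<cdot>\<^bsub>C\<^esub> v = g i \<cdot>\<^bsub>C\<^esub> q i) \<longrightarrow>
        short_exact C u v)"


section \<open>Inverse sequences\<close>

record ('o, 'm) inverse_sequence =
  ob :: "nat \<Rightarrow> 'o"
  bond :: "nat \<Rightarrow> 'm"

definition is_inverse_sequence ::
    "('o, 'm, 'z) category_scheme \<Rightarrow> ('o, 'm) inverse_sequence \<Rightarrow> bool" where
  "is_inverse_sequence C S \<longleftrightarrow>
     (\<forall>i. ob S i \<in> Obj C \<and> bond S i \<in> Hom C (ob S (Suc i)) (ob S i))"

text \<open>A morphism is recorded together with its domain and its codomain.\<close>

type_synonym ('o, 'm) seq_morphism =
  "('o, 'm) inverse_sequence \<times> (nat \<Rightarrow> 'm) \<times> ('o, 'm) inverse_sequence"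

definition seq_category ::
    "('o, 'm) preadditive_category \<Rightarrow>
      (('o, 'm) inverse_sequence, ('o, 'm) seq_morphism) preadditive_category" where
  "seq_category C =
     \<lparr>Obj = {S. is_inverse_sequence C S},
      Arr = {(S, \<phi>, T). is_inverse_sequence C S \<and> is_inverse_sequence C T \<and>
               (\<forall>i. \<phi> i \<in> Hom C (ob S i) (ob T i)) \<and>
               (\<forall>i. \<phi> i \<cdot>\<^bsub>C\<^esub> bond S i = bond T i \<cdot>\<^bsub>C\<^esub> \<phi> (Suc i))},
      Dom = (\<lambda>(S, \<phi>, T). S),
      Cod = (\<lambda>(S, \<phi>, T). T),
      Ident = (\<lambda>S. (S, \<lambda>i. Ident C (ob S i), S)),
      Comp = (\<lambda>(S', \<psi>, T) (S, \<phi>, T'). (S, \<lambda>i. \<psi> i \<cdot>\<^bsub>C\<^esub> \<phi> i, T)),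
      Add = (\<lambda>(S, \<phi>, T) (S', \<psi>, T'). (S, \<lambda>i. Add C (\<phi> i) (\<psi> i), T)),
      Zero = (\<lambda>S T. (S, \<lambda>i. Zero C (ob S i) (ob T i), T))\<rparr>"

text \<open>\<open>F : \<Prod>\<^sub>i S\<^sub>i \<rightarrow> \<Prod>\<^sub>i S\<^sub>i\<close> with \<open>pr\<^sub>j F = f\<^sub>j pr\<^bsub>j+1\<^esub>\<close>\<close>

definition is_shift ::
    "('o, 'm) preadditive_category \<Rightarrow> ('o, 'm) inverse_sequence \<Rightarrow> 'o \<Rightarrow> (nat \<Rightarrow> 'm) \<Rightarrow> 'm \<Rightarrow> bool" where
  "is_shift C S P pr F \<longleftrightarrow>
     is_product C UNIV (ob S) P pr \<and> F \<in> Hom C P P \<and>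
     (\<forall>j. pr j \<cdot>\<^bsub>C\<^esub> F = bond S j \<cdot>\<^bsub>C\<^esub> pr (Suc j))"

definition is_lim ::
    "('o, 'm) preadditive_category \<Rightarrow> ('o, 'm) inverse_sequence \<Rightarrow> 'o \<Rightarrow> bool" where
  "is_lim C S L \<longleftrightarrow>
     (\<exists>P pr F k. is_shift C S P pr F \<and> is_kernel C (Minus C (Ident C P) F) k \<and> Dom C k = L)"

definition is_lim1 ::
    "('o, 'm) preadditive_category \<Rightarrow> ('o, 'm) inverse_sequence \<Rightarrow> 'o \<Rightarrow> bool" where
  "is_lim1 C S L \<longleftrightarrow>
     (\<exists>P pr F c. is_shift C S P pr F \<and> is_cokernel C (Minus C (Ident C P) F) c \<and> Cod C c = L)"

definition local_sequences ::
    "('o, 'm) preadditive_category \<Rightarrow> ('o, 'm) inverse_sequence set" where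
  "local_sequences C =
     {S. is_inverse_sequence C S \<and> (\<exists>Z. zero_object C Z \<and> is_lim C S Z \<and> is_lim1 C S Z)}"

definition null_sequence ::
    "('o, 'm) preadditive_category \<Rightarrow> ('o, 'm) inverse_sequence \<Rightarrow> bool" where
  "null_sequence C N \<longleftrightarrow>
     is_inverse_sequence C N \<and> (\<forall>i. bond N i = Zero C (ob N (Suc i)) (ob N i))"

definition null_extension ::
    "('o, 'm) preadditive_category \<Rightarrow>
      ('o, 'm) inverse_sequence \<Rightarrow> ('o, 'm) inverse_sequence \<Rightarrow> bool" where
  "null_extension C S' S \<longleftrightarrow>
     (\<exists>N a b. null_sequence C N \<and>
        a \<in> Hom (seq_category C) N S' \<and> b \<in> Hom (seq_category C) S' S \<and>
        short_exact (seq_category C) a b)"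

definition closed_under_null_extensions ::
    "('o, 'm) preadditive_category \<Rightarrow> ('o, 'm) inverse_sequence set \<Rightarrow> bool" where
  "closed_under_null_extensions C K \<longleftrightarrow>
     (\<forall>S S'. S \<in> K \<and> null_extension C S' S \<longrightarrow> S' \<in> K)"

text \<open>
  The zero inverse sequence is determined up to isomorphism only; every choice of it is required
  to belong to the class. (Each of them is a limit of the empty diagram.)
\<close>

definition closed_class ::
    "'u rel \<Rightarrow> ('o, 'm) preadditive_category \<Rightarrow> ('o, 'm) inverse_sequence set \<Rightarrow> bool" where
  "closed_class \<kappa> C K \<longleftrightarrow>
     K \<subseteq> Obj (seq_category C) \<and>
     (\<forall>Z. zero_object (seq_category C) Z \<longrightarrow> Z \<in> K) \<and>
     closed_under_small_limits \<kappa> (seq_category C) K \<and>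
     closed_under_null_extensions C K"

end

theory Submission
  imports Defs
begin

text \<open>
  A sequence \<open>S\<close> is local iff \<open>y\<^sub>i - f\<^sub>i y\<^bsub>i+1\<^esub> = x\<^sub>i\<close> has exactly one solution \<open>y\<close> for every family of
  generalized elements \<open>x\<^sub>i : W \<rightarrow> S\<^sub>i\<close>; in this form locality passes to limits and null-extensions.
  Conversely, let \<open>K\<close> be a closed class and \<open>S\<close> a local sequence. Replacing \<open>K\<close> by its intersection
  with the local sequences, it is enough to embed every local \<open>S\<close> into some \<open>T \<in> K\<close>: then \<open>T / S\<close>
  is local too, so it embeds into a member of \<open>K\<close>, and \<open>S\<close> is the kernel of a morphism in \<open>K\<close>. For
  the embedding, take \<open>S \<rightarrow> T\<close> with \<open>T \<in> K\<close> whose kernel \<open>M\<close> is as small as possible. The map lifts to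
  a null-extension of \<open>T\<close> whose kernel lies in the images of \<open>M\<^bsub>i+1\<^esub> \<rightarrow> M\<^sub>i\<close>, so these are epimorphisms. Since
  \<open>lim M = 0\<close>, a theorem of Roos (in a category with a generator, coproducts and exact products,
  a tower of epimorphisms has an epic limit projection) gives \<open>M = 0\<close>. It holds because every object
  receives an epimorphism that factors through all other epimorphisms onto that object.
\<close>

section \<open>Small sets\<close>

text \<open>The category has no elements, so a preimage under an epimorphism exists only after the
  source \<open>W\<close> is replaced by an epimorphic cover. For finitely many choices this is
  harmless, but here preimages are chosen in every degree of a sequence, and the limit of an
  infinite tower of successive covers need not be epic over \<open>W\<close>. Liftable epimorphisms
  remove this obstacle, since one cover serves all later choices. They are used for the vanishing of
  a tower of epimorphisms and also for the locality of a quotient of local sequences. A second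
  obstacle is that a limit of sequences is given only by its universal property among sequences,
  whereas solvability is tested on single objects \<open>W\<close>. An auxiliary sequence built from
  \<open>W\<close> and the limit turns solutions into morphisms of sequences. The generator has a
  further use besides the theorem of Roos: its maps into \<open>S\<close> form a small set of tests,
  and this is why a least kernel exists.\<close>

context
  includes cardinal_syntax
  fixes \<kappa> :: "'u rel"
  assumes inaccessible: "inaccessible \<kappa>"
begin

lemma small_subset: "small \<kappa> B \<Longrightarrow> A \<subseteq> B \<Longrightarrow> small \<kappa> A"
  unfolding small_def using card_of_mono1 ordLeq_ordLess_trans by blast

lemma small_image: "small \<kappa> A \<Longrightarrow> small \<kappa> (f ` A)"
  unfolding small_def using card_of_image ordLeq_ordLess_trans by blast

lemma small_nat: "small \<kappa> (UNIV :: nat set)"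
  using inaccessible card_of_nat ordIso_ordLess_trans
  unfolding small_def inaccessible_def by blast

lemma inaccessible_simps: "Card_order \<kappa>" "natLeq <o \<kappa>" "regularCard \<kappa>"
  using inaccessible unfolding inaccessible_def by blast+

lemma card_of_Field_inaccessible: "\<kappa> =o |Field \<kappa>|"
  by (rule ordIso_symmetric[OF card_of_Field_ordIso[OF inaccessible_simps(1)]])

lemma small_finite:
  assumes "finite A"
  shows "small \<kappa> A"
proof -
  have "|A| <o natLeq"
    using assms by (simp add: finite_iff_ordLess_natLeq)
  then show ?thesis
    unfolding small_def by (rule ordLess_transitive[OF _ inaccessible_simps(2)])
qed

lemma Cinfinite_inaccessible: "Cinfinite \<kappa>"
proof -
  have "natLeq \<le>o |Field \<kappa>|"
    by (rule ordLeq_ordIso_trans[OF ordLess_imp_ordLeq[OF inaccessible_simps(2)]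
          card_of_Field_inaccessible])
  then show ?thesis
    using inaccessible_simps(1) infinite_iff_natLeq_ordLeq unfolding cinfinite_def by blast
qed

lemma infinite_universe: "infinite (UNIV :: 'u set)"
  using Cinfinite_inaccessible finite_subset[of "Field \<kappa>" UNIV] unfolding cinfinite_def by auto

text \<open>Regularity of \<open>\<kappa>\<close> bounds the union of the fibres. The case needed
  later is a countable sum of hom-sets.\<close>

lemma small_Sigma:
  assumes "small \<kappa> I" "\<And>i. i \<in> I \<Longrightarrow> small \<kappa> (A i)"
  shows "small \<kappa> (Sigma I A)"
proof -
  have "|\<Union>i\<in>I. Pair i ` A i| <o \<kappa>"
  proof (rule card_of_UNION_ordLess_infinite_Field_regularCard)
    show "|I| <o \<kappa>"
      using assms(1) unfolding small_def .
    show "\<forall>i\<in>I. |Pair i ` A i| <o \<kappa>"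
      using small_image[OF assms(2)] unfolding small_def by blast
  qed (fact Cinfinite_inaccessible inaccessible_simps)+
  moreover have "Sigma I A = (\<Union>i\<in>I. Pair i ` A i)"
    by auto
  ultimately show ?thesis
    unfolding small_def by simp
qed

text \<open>Products, coproducts and limits are assumed only for index sets inside
  \<open>'u\<close>, while the families that occur are indexed by morphisms, sets of morphisms or
  natural numbers. An injection into \<open>'u\<close> with small image carries such an index set
  over.\<close>

lemma small_embedding:
  assumes "small \<kappa> A"
  obtains \<phi> :: "'a \<Rightarrow> 'u" where "inj_on \<phi> A" "small \<kappa> (\<phi> ` A)"
proof -
  have "|A| \<le>o |Field \<kappa>|"
    using assms unfolding small_def
    by (rule ordLess_imp_ordLeq[OF ordLess_ordIso_trans[OF _ card_of_Field_inaccessible]])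
  then obtain \<phi> :: "'a \<Rightarrow> 'u" where "inj_on \<phi> A"
    unfolding card_of_ordLeq[symmetric] by blast
  then show thesis
    using that small_image[OF assms] by blast
qed

text \<open>Inaccessibility speaks of subsets of \<open>'u\<close> only, so the power set is taken
  of a copy of \<open>A\<close> there and carried back.\<close>

lemma small_Pow:
  assumes "small \<kappa> A"
  shows "small \<kappa> (Pow A)"
proof -
  obtain \<phi> :: "'a \<Rightarrow> 'u" where \<phi>: "inj_on \<phi> A" "small \<kappa> (\<phi> ` A)"
    using small_embedding[OF assms] .
  then have "small \<kappa> (Pow (\<phi> ` A))"
    using inaccessible unfolding small_def inaccessible_def by blast
  then have "small \<kappa> ((`) (inv_into A \<phi>) ` Pow (\<phi> ` A))"
    by (rule small_image)
  moreover have "Pow A \<subseteq> (`) (inv_into A \<phi>) ` Pow (\<phi> ` A)"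
  proof
    fix B assume "B \<in> Pow A"
    then have "B = inv_into A \<phi> ` (\<phi> ` B)" "\<phi> ` B \<in> Pow (\<phi> ` A)"
      using \<phi>(1) by (auto simp: inv_into_image_cancel)
    then show "B \<in> (`) (inv_into A \<phi>) ` Pow (\<phi> ` A)"
      by blast
  qed
  ultimately show ?thesis
    by (rule small_subset)
qed

end


section \<open>Preadditive categories\<close>

locale preadditive =
  fixes C :: "('o, 'm) preadditive_category" (structure)
  assumes preadditive: "is_preadditive C"
begin

abbreviation add (infixl \<open>\<oplus>\<close> 65) where "f \<oplus> g \<equiv> Add C f g"

lemma category: "is_category C"
  using preadditive unfolding is_preadditive_def by blast

text \<open>As a simp rule this reduces typing conditions to equations on \<open>Dom\<close> and
  \<open>Cod\<close>; the two \<open>Obj\<close> conjuncts make membership of the endpoints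
  available at the same time.\<close>

lemma hom_iff [simp]:
  "f \<in> Hom C X Y \<longleftrightarrow> f \<in> Arr C \<and> Dom C f = X \<and> Cod C f = Y \<and> X \<in> Obj C \<and> Y \<in> Obj C"
  using category unfolding is_category_def Hom_def by auto

lemma Ident_Hom: "X \<in> Obj C \<Longrightarrow> Ident C X \<in> Hom C X X"
  using category unfolding is_category_def by blast

lemma Ident_simps [simp]:
  assumes "X \<in> Obj C"
  shows "Ident C X \<in> Arr C" "Dom C (Ident C X) = X" "Cod C (Ident C X) = X"
  using Ident_Hom[OF assms] by auto

lemma Arr_obj:
  assumes "f \<in> Arr C"
  shows "Dom C f \<in> Obj C" "Cod C f \<in> Obj C"
  using category assms unfolding is_category_def by blast+

lemma Comp_Hom: "f \<in> Hom C X Y \<Longrightarrow> g \<in> Hom C Y Z \<Longrightarrow> g \<cdot> f \<in> Hom C X Z"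
  using category unfolding is_category_def by blast

lemma Comp_simps [simp]:
  assumes "f \<in> Arr C" "g \<in> Arr C" "Cod C f = Dom C g"
  shows "g \<cdot> f \<in> Arr C" "Dom C (g \<cdot> f) = Dom C f" "Cod C (g \<cdot> f) = Cod C g"
  using Comp_Hom[of f "Dom C f" "Cod C f" g "Cod C g"] assms Arr_obj by auto

lemma Comp_Ident [simp]:
  assumes "f \<in> Arr C"
  shows "Dom C f = X \<Longrightarrow> f \<cdot> Ident C X = f" "Cod C f = Y \<Longrightarrow> Ident C Y \<cdot> f = f"
  using category assms unfolding is_category_def Hom_def by blast+

lemma Comp_assoc [simp]:
  assumes "f \<in> Arr C" "g \<in> Arr C" "h \<in> Arr C" "Cod C f = Dom C g" "Cod C g = Dom C h"
  shows "(h \<cdot> g) \<cdot> f = h \<cdot> (g \<cdot> f)"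
  using category assms unfolding is_category_def Hom_def by blast

text \<open>Composites are normalized to the right, which hides a known composite
  \<open>g \<cdot> f\<close> inside \<open>g \<cdot> (f \<cdot> x)\<close>; this form applies the
  equation there.\<close>

lemma Comp_reassoc:
  assumes "g \<cdot> f = h" "f \<in> Arr C" "g \<in> Arr C" "x \<in> Arr C" "Cod C x = Dom C f" "Cod C f = Dom C g"
  shows "g \<cdot> (f \<cdot> x) = h \<cdot> x"
  using Comp_assoc[of x f g] assms by simp

lemma comm_group_Hom: "X \<in> Obj C \<Longrightarrow> Y \<in> Obj C \<Longrightarrow> comm_group (hom_group C X Y)"
  using preadditive unfolding is_preadditive_def by blast

lemma Zero_simps [simp]:
  assumes "X \<in> Obj C" "Y \<in> Obj C"
  shows "Zero C X Y \<in> Arr C" "Dom C (Zero C X Y) = X" "Cod C (Zero C X Y) = Y"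
proof -
  interpret comm_group "hom_group C X Y"
    by (rule comm_group_Hom[OF assms])
  have "Zero C X Y \<in> Hom C X Y"
    using one_closed by (simp add: hom_group_def)
  then show "Zero C X Y \<in> Arr C" "Dom C (Zero C X Y) = X" "Cod C (Zero C X Y) = Y"
    by auto
qed

lemma Add_simps [simp]:
  assumes "f \<in> Arr C" "g \<in> Arr C" "Dom C f = Dom C g" "Cod C f = Cod C g"
  shows "f \<oplus> g \<in> Arr C" "Dom C (f \<oplus> g) = Dom C g" "Cod C (f \<oplus> g) = Cod C g"
proof -
  interpret comm_group "hom_group C (Dom C g) (Cod C g)"
    using comm_group_Hom Arr_obj assms by blast
  have "f \<oplus> g \<in> Hom C (Dom C g) (Cod C g)"
    using m_closed[of f g] assms Arr_obj by (simp add: hom_group_def)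
  then show "f \<oplus> g \<in> Arr C" "Dom C (f \<oplus> g) = Dom C g" "Cod C (f \<oplus> g) = Cod C g"
    by auto
qed

lemma Add_assoc [simp]:
  assumes "f \<in> Arr C" "g \<in> Arr C" "h \<in> Arr C" "Dom C f = Dom C g" "Cod C f = Cod C g"
    "Dom C g = Dom C h" "Cod C g = Cod C h"
  shows "f \<oplus> g \<oplus> h = f \<oplus> (g \<oplus> h)"
proof -
  interpret comm_group "hom_group C (Dom C g) (Cod C g)"
    using comm_group_Hom Arr_obj assms by blast
  show ?thesis
    using m_assoc[of f g h] assms Arr_obj by (simp add: hom_group_def)
qed

lemma Add_commute:
  assumes "f \<in> Arr C" "g \<in> Arr C" "Dom C f = Dom C g" "Cod C f = Cod C g"
  shows "f \<oplus> g = g \<oplus> f"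
proof -
  interpret comm_group "hom_group C (Dom C g) (Cod C g)"
    using comm_group_Hom Arr_obj assms by blast
  show ?thesis
    using m_comm[of f g] assms Arr_obj by (simp add: hom_group_def)
qed

lemma Add_left_commute:
  assumes "f \<in> Arr C" "g \<in> Arr C" "h \<in> Arr C" "Dom C f = Dom C g" "Cod C f = Cod C g"
    "Dom C g = Dom C h" "Cod C g = Cod C h"
  shows "f \<oplus> (g \<oplus> h) = g \<oplus> (f \<oplus> h)"
  using assms Add_assoc[of f g h] Add_assoc[of g f h] Add_commute[of f g] by simp

lemma Add_Zero [simp]:
  assumes "f \<in> Arr C" "Dom C f = X" "Cod C f = Y"
  shows "f \<oplus> Zero C X Y = f" "Zero C X Y \<oplus> f = f"
proof -
  interpret comm_group "hom_group C (Dom C f) (Cod C f)"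
    using comm_group_Hom Arr_obj assms by blast
  show "f \<oplus> Zero C X Y = f" "Zero C X Y \<oplus> f = f"
    using r_one[of f] l_one[of f] assms Arr_obj by (auto simp add: hom_group_def)
qed

lemma Add_cancel:
  assumes "f \<in> Hom C X Y" "g \<in> Hom C X Y" "h \<in> Hom C X Y" "f \<oplus> g = f \<oplus> h"
  shows "g = h"
proof -
  interpret comm_group "hom_group C X Y"
    using comm_group_Hom assms by simp
  show ?thesis
    using right_cancel[of f g h] m_comm[of f g] m_comm[of f h] assms by (simp add: hom_group_def)
qed

lemma negative:
  assumes "f \<in> Hom C X Y"
  obtains g where "g \<in> Hom C X Y" "f \<oplus> g = Zero C X Y"
proof -
  interpret comm_group "hom_group C X Y"
    using comm_group_Hom assms by simp
  show thesis
    using that[of "inv\<^bsub>hom_group C X Y\<^esub> f"] r_inv[of f] inv_closed[of f] assms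
    by (simp add: hom_group_def)
qed

text \<open>Later proofs know subtraction only through these two facts, so that the inverse in
  \<open>hom_group\<close> never has to be handled again.\<close>

lemma Minus_Hom:
  assumes "f \<in> Hom C X Y" "g \<in> Hom C X Y"
  shows "Minus C f g \<in> Hom C X Y" "Minus C f g \<oplus> g = f"
proof -
  interpret comm_group "hom_group C X Y"
    using comm_group_Hom assms by simp
  have g: "inv\<^bsub>hom_group C X Y\<^esub> g \<in> Hom C X Y"
    "inv\<^bsub>hom_group C X Y\<^esub> g \<oplus> g = Zero C X Y"
    using inv_closed[of g] l_inv[of g] assms by (simp_all add: hom_group_def)
  show "Minus C f g \<in> Hom C X Y" "Minus C f g \<oplus> g = f"
    using assms g by (simp_all add: Minus_def)
qed

lemma Comp_Add [simp]:
  assumes "f \<in> Arr C" "f' \<in> Arr C" "g \<in> Arr C" "Dom C f = Dom C f'" "Cod C f = Cod C f'"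
  shows "Cod C f' = Dom C g \<Longrightarrow> g \<cdot> (f \<oplus> f') = g \<cdot> f \<oplus> g \<cdot> f'"
    and "Cod C g = Dom C f' \<Longrightarrow> (f \<oplus> f') \<cdot> g = f \<cdot> g \<oplus> f' \<cdot> g"
proof -
  have distrib: "\<forall>X Y Z f f' g g'. f \<in> Hom C X Y \<and> f' \<in> Hom C X Y \<and> g \<in> Hom C Y Z \<and> g' \<in> Hom C Y Z \<longrightarrow>
        g \<cdot> (f \<oplus> f') = (g \<cdot> f) \<oplus> (g \<cdot> f') \<and> (g \<oplus> g') \<cdot> f = (g \<cdot> f) \<oplus> (g' \<cdot> f)"
    using preadditive unfolding is_preadditive_def by blast
  show "Cod C f' = Dom C g \<Longrightarrow> g \<cdot> (f \<oplus> f') = g \<cdot> f \<oplus> g \<cdot> f'"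
    using distrib[rule_format, of f "Dom C f" "Cod C f" f' g "Cod C g" g] assms Arr_obj by simp
  show "Cod C g = Dom C f' \<Longrightarrow> (f \<oplus> f') \<cdot> g = f \<cdot> g \<oplus> f' \<cdot> g"
    using distrib[rule_format, of g "Dom C g" "Cod C g" g f "Cod C f" f'] assms Arr_obj by simp
qed

lemma idem_Zero:
  assumes "f \<in> Hom C X Y" "f \<oplus> f = f"
  shows "f = Zero C X Y"
  using Add_cancel[of f X Y f "Zero C X Y"] assms by simp

lemma Comp_Zero [simp]:
  assumes "g \<in> Arr C" "X \<in> Obj C"
  shows "Dom C g = Y \<Longrightarrow> g \<cdot> Zero C X Y = Zero C X (Cod C g)"
    and "Cod C g = Y \<Longrightarrow> Zero C Y X \<cdot> g = Zero C (Dom C g) X"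
proof -
  assume Y: "Dom C g = Y"
  have "g \<cdot> Zero C X Y \<oplus> g \<cdot> Zero C X Y = g \<cdot> (Zero C X Y \<oplus> Zero C X Y)"
    using assms Y Arr_obj[of g] by (simp del: Add_Zero)
  also have "\<dots> = g \<cdot> Zero C X Y"
    using assms Y Arr_obj[of g] by simp
  finally show "g \<cdot> Zero C X Y = Zero C X (Cod C g)"
    using assms Y Arr_obj[of g] by (intro idem_Zero) simp_all
next
  assume Y: "Cod C g = Y"
  have "Zero C Y X \<cdot> g \<oplus> Zero C Y X \<cdot> g = (Zero C Y X \<oplus> Zero C Y X) \<cdot> g"
    using assms Y Arr_obj[of g] by (simp del: Add_Zero)
  also have "\<dots> = Zero C Y X \<cdot> g"
    using assms Y Arr_obj[of g] by simp
  finally show "Zero C Y X \<cdot> g = Zero C (Dom C g) X"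
    using assms Y Arr_obj[of g] by (intro idem_Zero) simp_all
qed

lemma mono_cancel:
  assumes "is_mono C f" "f \<in> Hom C X Y" "g \<in> Hom C W X" "h \<in> Hom C W X" "f \<cdot> g = f \<cdot> h"
  shows "g = h"
  using assms unfolding is_mono_def by (metis hom_iff)

lemma epi_cancel:
  assumes "is_epi C f" "f \<in> Hom C X Y" "g \<in> Hom C Y Z" "h \<in> Hom C Y Z" "g \<cdot> f = h \<cdot> f"
  shows "g = h"
  using assms unfolding is_epi_def by (metis hom_iff)

text \<open>Two maps with equal composites differ by a map that \<open>f\<close> kills.\<close>

lemma monoI:
  assumes f: "f \<in> Hom C X Y"
    and zero: "\<And>W g. g \<in> Hom C W X \<Longrightarrow> f \<cdot> g = Zero C W Y \<Longrightarrow> g = Zero C W X"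
  shows "is_mono C f"
  unfolding is_mono_def
proof (intro conjI allI ballI impI)
  fix W g h
  assume g: "g \<in> Hom C W (Dom C f)" and h: "h \<in> Hom C W (Dom C f)" and eq: "f \<cdot> g = f \<cdot> h"
  \<comment> \<open>\<open>k\<close> is the negative of \<open>h\<close>, so
    \<open>g \<oplus> k\<close> is the difference of \<open>g\<close> and \<open>h\<close>.\<close>
  obtain k where k: "k \<in> Hom C W X" "h \<oplus> k = Zero C W X"
    using negative[of h W X] h f by auto
  have "f \<cdot> (g \<oplus> k) = f \<cdot> (h \<oplus> k)"
    using f g h k(1) eq by simp
  then have "f \<cdot> (g \<oplus> k) = Zero C W Y"
    unfolding k(2) using f g by simp
  then have "g \<oplus> k = Zero C W X"
    using zero[of "g \<oplus> k" W] f g k(1) by simp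
  then have "k \<oplus> g = k \<oplus> h"
    using k g h f Add_commute[of k g] Add_commute[of k h] by simp
  then show "g = h"
    using Add_cancel[of k W X g h] k g h f by simp
qed (use f in simp)

lemma epiI:
  assumes f: "f \<in> Hom C X Y"
    and zero: "\<And>Z g. g \<in> Hom C Y Z \<Longrightarrow> g \<cdot> f = Zero C X Z \<Longrightarrow> g = Zero C Y Z"
  shows "is_epi C f"
  unfolding is_epi_def
proof (intro conjI allI ballI impI)
  fix Z g h
  assume g: "g \<in> Hom C (Cod C f) Z" and h: "h \<in> Hom C (Cod C f) Z" and eq: "g \<cdot> f = h \<cdot> f"
  obtain k where k: "k \<in> Hom C Y Z" "h \<oplus> k = Zero C Y Z"
    using negative[of h Y Z] h f by auto
  have "(g \<oplus> k) \<cdot> f = (h \<oplus> k) \<cdot> f"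
    using f g h k(1) eq by simp
  then have "(g \<oplus> k) \<cdot> f = Zero C X Z"
    unfolding k(2) using f g by simp
  then have "g \<oplus> k = Zero C Y Z"
    using zero[of "g \<oplus> k" Z] f g k(1) by simp
  then have "k \<oplus> g = k \<oplus> h"
    using k g h f Add_commute[of k g] Add_commute[of k h] by simp
  then show "g = h"
    using Add_cancel[of k Y Z g h] k g h f by simp
qed (use f in simp)

lemma mono_zero:
  assumes "is_mono C f" "f \<in> Hom C X Y" "g \<in> Hom C W X" "f \<cdot> g = Zero C W Y"
  shows "g = Zero C W X"
  using mono_cancel[of f X Y g W "Zero C W X"] assms by simp

lemma epi_zero:
  assumes "is_epi C f" "f \<in> Hom C X Y" "g \<in> Hom C Y Z" "g \<cdot> f = Zero C X Z"
  shows "g = Zero C Y Z"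
  using epi_cancel[of f X Y g Z "Zero C Y Z"] assms by simp

lemma epi_Comp:
  assumes "is_epi C f" "is_epi C g" "f \<in> Hom C X Y" "g \<in> Hom C Y Z"
  shows "is_epi C (g \<cdot> f)"
proof (rule epiI)
  show "g \<cdot> f \<in> Hom C X Z"
    using assms by simp
  fix W h assume h: "h \<in> Hom C Z W" "h \<cdot> (g \<cdot> f) = Zero C X W"
  then have "h \<cdot> g = Zero C Y W"
    using epi_zero[of f X Y "h \<cdot> g" W] assms by simp
  then show "h = Zero C Z W"
    using epi_zero[of g Y Z h W] assms h by simp
qed

lemma epi_factor:
  assumes "is_epi C (g \<cdot> f)" "f \<in> Hom C X Y" "g \<in> Hom C Y Z"
  shows "is_epi C g"
proof (rule epiI)
  fix W h assume h: "h \<in> Hom C Z W" "h \<cdot> g = Zero C Y W"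
  then have "h \<cdot> (g \<cdot> f) = Zero C X W"
    using assms Comp_assoc[of f g h] by simp
  then show "h = Zero C Z W"
    using epi_zero[of "g \<cdot> f" X Z h W] assms h by simp
qed (fact assms)

section \<open>Products and biproducts in preadditive categories\<close>

lemma product_Hom: "is_product C I X P p \<Longrightarrow> i \<in> I \<Longrightarrow> p i \<in> Hom C P (X i)"
  unfolding is_product_def by blast

lemma product_ex:
  assumes "is_product C I X P p" "W \<in> Obj C" "\<And>i. i \<in> I \<Longrightarrow> f i \<in> Hom C W (X i)"
  obtains h where "h \<in> Hom C W P" "\<And>i. i \<in> I \<Longrightarrow> p i \<cdot> h = f i"
  using assms unfolding is_product_def by blast

lemma product_eq:
  assumes "is_product C I X P p" "h \<in> Hom C W P" "h' \<in> Hom C W P"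
    "\<And>i. i \<in> I \<Longrightarrow> p i \<cdot> h = p i \<cdot> h'"
  shows "h = h'"
proof -
  have "\<forall>i\<in>I. p i \<cdot> h \<in> Hom C W (X i)"
    using product_Hom[OF assms(1)] assms(2) by simp
  moreover have "W \<in> Obj C"
    using assms by simp
  ultimately have "\<exists>!k. k \<in> Hom C W P \<and> (\<forall>i \<in> I. p i \<cdot> k = p i \<cdot> h)"
    using assms(1) unfolding is_product_def by (simp del: hom_iff)
  moreover have "h \<in> Hom C W P \<and> (\<forall>i \<in> I. p i \<cdot> h = p i \<cdot> h)"
    "h' \<in> Hom C W P \<and> (\<forall>i \<in> I. p i \<cdot> h' = p i \<cdot> h)"
    using assms by (simp_all del: hom_iff)
  ultimately show ?thesis
    by blast
qed

text \<open>The new family has to match \<open>X\<close> only on the index set, so with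
  \<open>\<phi>\<close> the identity this also exchanges families that agree there.\<close>

lemma product_reindex:
  assumes "is_product C I X P p" "bij_betw \<phi> I' I" "\<And>i. i \<in> I' \<Longrightarrow> X' i = X (\<phi> i)"
  shows "is_product C I' X' P (p \<circ> \<phi>)"
  unfolding is_product_def
proof (intro conjI ballI allI impI)
  show "P \<in> Obj C"
    using assms(1) unfolding is_product_def by blast
  show "(p \<circ> \<phi>) i \<in> Hom C P (X' i)" if "i \<in> I'" for i
    using product_Hom[OF assms(1), of "\<phi> i"] assms(2,3) that by (simp add: bij_betw_apply)
next
  fix W f assume W: "W \<in> Obj C" and f: "\<forall>i\<in>I'. f i \<in> Hom C W (X' i)"
  let ?\<psi> = "inv_into I' \<phi>"
  have \<psi>: "?\<psi> i \<in> I'" "\<phi> (?\<psi> i) = i" if "i \<in> I" for i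
    using assms(2) that by (metis bij_betw_def inv_into_into, metis bij_betw_inv_into_right)
  have "f (?\<psi> i) \<in> Hom C W (X i)" if "i \<in> I" for i
    using f assms(3) \<psi>[OF that] by metis
  then obtain h where h: "h \<in> Hom C W P" "\<And>i. i \<in> I \<Longrightarrow> p i \<cdot> h = f (?\<psi> i)"
    using product_ex[OF assms(1) W, of "\<lambda>i. f (?\<psi> i)"] by blast
  show "\<exists>!h. h \<in> Hom C W P \<and> (\<forall>i\<in>I'. (p \<circ> \<phi>) i \<cdot> h = f i)"
  proof (rule ex1I)
    show "h \<in> Hom C W P \<and> (\<forall>i\<in>I'. (p \<circ> \<phi>) i \<cdot> h = f i)"
      using h assms(2) by (auto simp: bij_betw_apply bij_betw_inv_into_left)
    fix k assume k: "k \<in> Hom C W P \<and> (\<forall>i\<in>I'. (p \<circ> \<phi>) i \<cdot> k = f i)"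
    show "k = h"
    proof (rule product_eq[OF assms(1)])
      show "k \<in> Hom C W P" "h \<in> Hom C W P"
        using k h by blast+
      fix i assume "i \<in> I"
      then show "p i \<cdot> k = p i \<cdot> h"
        using k h(2) \<psi> by (metis comp_apply)
    qed
  qed
qed

text \<open>The injections come from the universal property applied to identities and zero maps; the
  last equation is tested on both projections.\<close>

lemma biproduct:
  assumes "is_product C (UNIV :: bool set) (\<lambda>b. if b then X else Y) P p"
  obtains i j where "i \<in> Hom C X P" "j \<in> Hom C Y P"
    "p True \<cdot> i = Ident C X" "p False \<cdot> j = Ident C Y"
    "p False \<cdot> i = Zero C X Y" "p True \<cdot> j = Zero C Y X"
    "i \<cdot> p True \<oplus> j \<cdot> p False = Ident C P"
proof -
  have [simp]: "X \<in> Obj C" "Y \<in> Obj C"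
    using product_Hom[OF assms, of True] product_Hom[OF assms, of False] by simp_all
  have p: "p True \<in> Hom C P X" "p False \<in> Hom C P Y"
    using product_Hom[OF assms, of True] product_Hom[OF assms, of False] by simp_all
  obtain i where i: "i \<in> Hom C X P"
      "\<And>b. p b \<cdot> i = (if b then Ident C X else Zero C X Y)"
    by (rule product_ex[OF assms, of X "\<lambda>b. if b then Ident C X else Zero C X Y"])
      (auto split: if_splits)
  obtain j where j: "j \<in> Hom C Y P"
      "\<And>b. p b \<cdot> j = (if b then Zero C Y X else Ident C Y)"
    by (rule product_ex[OF assms, of Y "\<lambda>b. if b then Zero C Y X else Ident C Y"])
      (auto split: if_splits)
  have "i \<cdot> p True \<oplus> j \<cdot> p False = Ident C P"
  proof (rule product_eq[OF assms, where W = P])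
    fix b :: bool
    have "p True \<cdot> (i \<cdot> p True) = p True" "p True \<cdot> (j \<cdot> p False) = Zero C P X"
      "p False \<cdot> (i \<cdot> p True) = Zero C P Y" "p False \<cdot> (j \<cdot> p False) = p False"
      using p i j Comp_assoc[of "p True" i "p True"] Comp_assoc[of "p False" j "p True"]
        Comp_assoc[of "p True" i "p False"] Comp_assoc[of "p False" j "p False"]
      by simp_all
    then show "p b \<cdot> (i \<cdot> p True \<oplus> j \<cdot> p False) = p b \<cdot> Ident C P"
      using p i j by (cases b) simp_all
  qed (use p i j in simp_all)
  then show thesis
    using that[of i j] i j by simp
qed

end

section \<open>Abelian categories\<close>

locale abelian = preadditive +
  assumes abelian: "is_abelian C"
begin

lemma zero_object_ex: "\<exists>Z. zero_object C Z"
  using abelian unfolding is_abelian_def by blast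

lemma kernel_universal:
  assumes "is_kernel C f k" "f \<in> Hom C X Y" "k \<in> Hom C K X"
  shows "f \<cdot> k = Zero C K Y"
    and "\<And>W h. h \<in> Hom C W X \<Longrightarrow> f \<cdot> h = Zero C W Y \<Longrightarrow> \<exists>u. u \<in> Hom C W K \<and> k \<cdot> u = h"
    and "is_mono C k"
proof -
  show 1: "f \<cdot> k = Zero C K Y"
    using assms unfolding is_kernel_def by auto
  have univ: "\<exists>!u. u \<in> Hom C W K \<and> k \<cdot> u = h"
    if "h \<in> Hom C W X" "f \<cdot> h = Zero C W Y" for W h
    using assms that unfolding is_kernel_def by auto
  show "\<exists>u. u \<in> Hom C W K \<and> k \<cdot> u = h"
    if "h \<in> Hom C W X" "f \<cdot> h = Zero C W Y" for W h
    using univ[OF that] by blast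
  show "is_mono C k"
  proof (rule monoI[OF assms(3)])
    fix W g assume g: "g \<in> Hom C W K" "k \<cdot> g = Zero C W X"
    have "\<exists>!u. u \<in> Hom C W K \<and> k \<cdot> u = Zero C W X"
      using univ[of "Zero C W X" W] assms g by simp
    moreover have "Zero C W K \<in> Hom C W K \<and> k \<cdot> Zero C W K = Zero C W X"
      using assms g by simp
    ultimately show "g = Zero C W K"
      using g by blast
  qed
qed

lemma kernel_ex:
  assumes "f \<in> Hom C X Y"
  obtains K k where "is_kernel C f k" "k \<in> Hom C K X"
proof -
  obtain k where k: "is_kernel C f k"
    using abelian assms unfolding is_abelian_def by auto
  then have "k \<in> Hom C (Dom C k) X"
    using assms Arr_obj[of k] unfolding is_kernel_def by auto
  then show thesis
    using that k by blast
qed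

lemma cokernel_universal:
  assumes "is_cokernel C f c" "f \<in> Hom C X Y" "c \<in> Hom C Y Q"
  shows "c \<cdot> f = Zero C X Q"
    and "\<And>W h. h \<in> Hom C Y W \<Longrightarrow> h \<cdot> f = Zero C X W \<Longrightarrow> \<exists>u. u \<in> Hom C Q W \<and> u \<cdot> c = h"
    and "is_epi C c"
proof -
  show 1: "c \<cdot> f = Zero C X Q"
    using assms unfolding is_cokernel_def by auto
  have univ: "\<exists>!u. u \<in> Hom C Q W \<and> u \<cdot> c = h"
    if "h \<in> Hom C Y W" "h \<cdot> f = Zero C X W" for W h
    using assms that unfolding is_cokernel_def by auto
  show "\<exists>u. u \<in> Hom C Q W \<and> u \<cdot> c = h"
    if "h \<in> Hom C Y W" "h \<cdot> f = Zero C X W" for W h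
    using univ[OF that] by blast
  show "is_epi C c"
  proof (rule epiI[OF assms(3)])
    fix W g assume g: "g \<in> Hom C Q W" "g \<cdot> c = Zero C Y W"
    have "\<exists>!u. u \<in> Hom C Q W \<and> u \<cdot> c = Zero C Y W"
      using univ[of "Zero C Y W" W] assms g by simp
    moreover have "Zero C Q W \<in> Hom C Q W \<and> Zero C Q W \<cdot> c = Zero C Y W"
      using assms g by simp
    ultimately show "g = Zero C Q W"
      using g by blast
  qed
qed

lemma cokernel_ex:
  assumes "f \<in> Hom C X Y"
  obtains Q c where "is_cokernel C f c" "c \<in> Hom C Y Q"
proof -
  obtain c where c: "is_cokernel C f c"
    using abelian assms unfolding is_abelian_def by auto
  then have "c \<in> Hom C Y (Cod C c)"
    using assms Arr_obj[of c] unfolding is_cokernel_def by auto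
  then show thesis
    using that c by blast
qed

text \<open>A monomorphism is the kernel of some \<open>f\<close>, and \<open>zero\<close> at
  \<open>v = f\<close> gives the factorization. Quantifying over all \<open>v\<close> spares the
  caller from knowing that \<open>f\<close>.\<close>

lemma mono_kernel:
  assumes m: "is_mono C m" "m \<in> Hom C K X" and h: "h \<in> Hom C W X"
    and zero: "\<And>V v. v \<in> Hom C X V \<Longrightarrow> v \<cdot> m = Zero C K V \<Longrightarrow> v \<cdot> h = Zero C W V"
  obtains u where "u \<in> Hom C W K" "m \<cdot> u = h"
proof -
  obtain f where f: "is_kernel C f m"
    using abelian m unfolding is_abelian_def by blast
  then have fX: "f \<in> Hom C X (Cod C f)"
    using m Arr_obj[of f] unfolding is_kernel_def by auto
  note univ = kernel_universal[OF f fX m(2)]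
  show thesis
    using univ(2)[OF h zero[OF fX univ(1)]] that by blast
qed

lemma epi_cokernel:
  assumes e: "is_epi C e" "e \<in> Hom C X Y" and h: "h \<in> Hom C X W"
    and zero: "\<And>V v. v \<in> Hom C V X \<Longrightarrow> e \<cdot> v = Zero C V Y \<Longrightarrow> h \<cdot> v = Zero C V W"
  obtains u where "u \<in> Hom C Y W" "u \<cdot> e = h"
proof -
  obtain f where f: "is_cokernel C f e"
    using abelian e unfolding is_abelian_def by blast
  then have fX: "f \<in> Hom C (Dom C f) X"
    using e Arr_obj[of f] unfolding is_cokernel_def by auto
  note univ = cokernel_universal[OF f fX e(2)]
  show thesis
    using univ(2)[OF h zero[OF fX univ(1)]] that by blast
qed

text \<open>Abelian categories are balanced: every \<open>v\<close> that kills \<open>f\<close> is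
  zero because \<open>f\<close> is epic, so the identity factors through the monomorphism
  \<open>f\<close>.\<close>

lemma mono_epi_section:
  assumes "is_mono C f" "is_epi C f" "f \<in> Hom C X Y"
  obtains g where "g \<in> Hom C Y X" "f \<cdot> g = Ident C Y"
proof (rule mono_kernel[OF assms(1,3), of "Ident C Y" Y])
  fix V v assume v: "v \<in> Hom C Y V" "v \<cdot> f = Zero C X V"
  then show "v \<cdot> Ident C Y = Zero C Y V"
    using epi_zero[OF assms(2,3) v] by simp
qed (use assms that in auto)

text \<open>An epimorphism is the cokernel of its kernel: whatever \<open>e\<close> kills factors
  through \<open>k\<close>, so a map killing \<open>k\<close> descends along
  \<open>e\<close>.\<close>

lemma epi_short_exact:
  assumes e: "is_epi C e" "e \<in> Hom C X Y" and k: "is_kernel C e k" "k \<in> Hom C K X"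
  shows "short_exact C k e"
  unfolding short_exact_def
proof
  note univ = kernel_universal[OF k(1) e(2) k(2)]
  have uniq: "\<exists>!u. u \<in> Hom C Y W \<and> u \<cdot> e = h"
    if h: "h \<in> Hom C X W" "h \<cdot> k = Zero C K W" for W h
  proof -
    have "\<exists>u. u \<in> Hom C Y W \<and> u \<cdot> e = h"
    proof (rule epi_cokernel[OF e h(1)])
      fix V v assume v: "v \<in> Hom C V X" "e \<cdot> v = Zero C V Y"
      then obtain w where "w \<in> Hom C V K" "k \<cdot> w = v"
        using univ(2) by blast
      then show "h \<cdot> v = Zero C V W"
        using h k(2) Comp_reassoc[OF h(2), of w] by auto
    qed blast
    then show ?thesis
      using epi_cancel[OF e] by blast
  qed
  show "is_cokernel C k e"
  proof -
    have "\<forall>W. \<forall>h\<in>Hom C X W. h \<cdot> k = Zero C K W \<longrightarrow> (\<exists>!u. u \<in> Hom C Y W \<and> u \<cdot> e = h)"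
      using uniq by blast
    moreover have "Cod C k = X" "Dom C k = K" "Cod C e = Y" "Dom C e = X" "e \<in> Arr C" "k \<in> Arr C"
      using e k by simp_all
    ultimately show ?thesis
      unfolding is_cokernel_def using univ(1) by (simp del: hom_iff)
  qed
qed (fact k)

section \<open>Pullbacks, exactness and pushouts in terms of epimorphic covers\<close>

lemma biproduct_ex:
  assumes "X \<in> Obj C" "Y \<in> Obj C"
  obtains P p q i j where "p \<in> Hom C P X" "q \<in> Hom C P Y" "i \<in> Hom C X P" "j \<in> Hom C Y P"
    "p \<cdot> i = Ident C X" "q \<cdot> j = Ident C Y" "q \<cdot> i = Zero C X Y" "p \<cdot> j = Zero C Y X"
    "i \<cdot> p \<oplus> j \<cdot> q = Ident C P"
proof -
  obtain P p where P: "is_product C (UNIV :: bool set) (\<lambda>b. if b then X else Y) P p"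
    using abelian assms unfolding is_abelian_def by blast
  then have "p True \<in> Hom C P X" "p False \<in> Hom C P Y"
    using product_Hom[OF P, of True] product_Hom[OF P, of False] by simp_all
  then show thesis
    using that biproduct[OF P] by metis
qed

text \<open>This replaces the choice of preimages: the generalized element \<open>d\<close> of
  \<open>R\<close> lifts along \<open>v\<close> after passing to a cover \<open>e\<close> of its
  source. The pullback is the kernel of the difference of \<open>v \<cdot> p\<close> and
  \<open>d \<cdot> q\<close> on the biproduct, with the negative \<open>d'\<close> in place of
  subtraction.\<close>

lemma epi_pullback:
  assumes v: "is_epi C v" "v \<in> Hom C Q R" and d: "d \<in> Hom C X R"
  obtains E e t where "e \<in> Hom C E X" "is_epi C e" "t \<in> Hom C E Q" "v \<cdot> t = d \<cdot> e"
proof -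
  have QX: "Q \<in> Obj C" "X \<in> Obj C"
    using v d by simp_all
  obtain P p q i j where p: "p \<in> Hom C P Q" and q: "q \<in> Hom C P X"
    and i: "i \<in> Hom C Q P" and j: "j \<in> Hom C X P"
    and eqs: "p \<cdot> i = Ident C Q" "q \<cdot> j = Ident C X" "q \<cdot> i = Zero C Q X" "p \<cdot> j = Zero C X Q"
    by (rule biproduct_ex[OF QX]) blast
  obtain d' where d': "d' \<in> Hom C X R" "d \<oplus> d' = Zero C X R"
    using negative[OF d] .
  define \<phi> where "\<phi> = v \<cdot> p \<oplus> d' \<cdot> q"
  have \<phi>: "\<phi> \<in> Hom C P R"
    using v p d' q by (simp add: \<phi>_def)
  have \<phi>i: "\<phi> \<cdot> i = v"
    using v p d' q i by (simp add: \<phi>_def eqs)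
  have \<phi>_epi: "is_epi C \<phi>"
    using epi_factor[OF _ i \<phi>] \<phi>i v by simp
  obtain E k where k: "is_kernel C \<phi> k" "k \<in> Hom C E P"
    using kernel_ex[OF \<phi>] .
  note univ = kernel_universal[OF k(1) \<phi> k(2)]
  show thesis
  proof
    show "q \<cdot> k \<in> Hom C E X" "p \<cdot> k \<in> Hom C E Q"
      using q k p by simp_all
    have "v \<cdot> (p \<cdot> k) \<oplus> d' \<cdot> (q \<cdot> k) = Zero C E R"
      using univ(1) v p d' q k by (simp add: \<phi>_def)
    moreover have "d \<cdot> (q \<cdot> k) \<oplus> d' \<cdot> (q \<cdot> k) = (d \<oplus> d') \<cdot> (q \<cdot> k)"
      using d d'(1) q k by simp
    then have "d \<cdot> (q \<cdot> k) \<oplus> d' \<cdot> (q \<cdot> k) = Zero C E R"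
      using d d' q k by simp
    ultimately have "d' \<cdot> (q \<cdot> k) \<oplus> v \<cdot> (p \<cdot> k) = d' \<cdot> (q \<cdot> k) \<oplus> d \<cdot> (q \<cdot> k)"
      using d d'(1) q k v p by (simp add: Add_commute)
    then show "v \<cdot> (p \<cdot> k) = d \<cdot> (q \<cdot> k)"
      using Add_cancel[of "d' \<cdot> (q \<cdot> k)" E R "v \<cdot> (p \<cdot> k)" "d \<cdot> (q \<cdot> k)"] d d'(1) q k v p by simp
    show "is_epi C (q \<cdot> k)"
    proof (rule epiI)
      fix Z g assume g: "g \<in> Hom C X Z" "g \<cdot> (q \<cdot> k) = Zero C E Z"
      \<comment> \<open>\<open>g \<cdot> q\<close> vanishes on the kernel \<open>k\<close> of the
        epimorphism \<open>\<phi>\<close>, so it factors through \<open>\<phi>\<close>. Restricting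
        to the summand \<open>Q\<close> along \<open>i\<close> shows that \<open>u\<close> kills
        \<open>v\<close>, hence \<open>u\<close> is zero; restricting to \<open>X\<close> along
        \<open>j\<close> recovers \<open>g\<close>.\<close>
      obtain u where u: "u \<in> Hom C R Z" "u \<cdot> \<phi> = g \<cdot> q"
      proof (rule epi_cokernel[OF \<phi>_epi \<phi>, of "g \<cdot> q" Z])
        fix V w assume w: "w \<in> Hom C V P" "\<phi> \<cdot> w = Zero C V R"
        then obtain w' where w': "w' \<in> Hom C V E" "k \<cdot> w' = w"
          using univ(2) by blast
        have "(g \<cdot> q) \<cdot> w = (g \<cdot> (q \<cdot> k)) \<cdot> w'"
          using w' g(1) q k(2) by (simp flip: w'(2))
        then show "(g \<cdot> q) \<cdot> w = Zero C V Z"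
          unfolding g(2) using w' g(1) k(2) by simp
      qed (use g q in auto)
      have "u \<cdot> v = (u \<cdot> \<phi>) \<cdot> i"
        using u(1) \<phi> i \<phi>i by simp
      also have "\<dots> = Zero C Q Z"
        unfolding u(2) using g q i eqs by simp
      finally have "u = Zero C R Z"
        using epi_zero[OF v] u by blast
      then have "g \<cdot> q = Zero C P Z"
        using u \<phi> g by auto
      then have "(g \<cdot> q) \<cdot> j = Zero C X Z"
        using j g by simp
      then show "g = Zero C X Z"
        using g q j eqs by simp
    qed (use q k in simp)
  qed
qed

text \<open>Exactness for generalized elements. The point is that \<open>\<phi>\<close> maps
  epimorphically onto the kernel of its cokernel; the cover \<open>e\<close> is the pullback of that
  epimorphism.\<close>

lemma cokernel_exact:
  assumes \<phi>: "\<phi> \<in> Hom C A P" and c: "is_cokernel C \<phi> c" "c \<in> Hom C P Q"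
    and k: "k \<in> Hom C W P" "c \<cdot> k = Zero C W Q"
  obtains Z e w where "e \<in> Hom C Z W" "is_epi C e" "w \<in> Hom C Z A" "\<phi> \<cdot> w = k \<cdot> e"
proof -
  note univ_c = cokernel_universal[OF c(1) \<phi> c(2)]
  obtain K m where m: "is_kernel C c m" "m \<in> Hom C K P"
    using kernel_ex[OF c(2)] .
  note univ_m = kernel_universal[OF m(1) c(2) m(2)]
  obtain t where t: "t \<in> Hom C A K" "m \<cdot> t = \<phi>"
    using univ_m(2)[OF \<phi> univ_c(1)] by blast
  \<comment> \<open>If \<open>g\<close> kills \<open>t\<close>, then \<open>\<phi>\<close> factors
    through the subobject \<open>m \<cdot> n\<close>, where \<open>n\<close> is the kernel of
    \<open>g\<close>. Every map killing \<open>m \<cdot> n\<close> kills \<open>\<phi>\<close>, so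
    it factors through \<open>c\<close> and kills \<open>m\<close>. Hence \<open>m\<close> factors
    through \<open>m \<cdot> n\<close>, which makes \<open>n\<close> split epic and \<open>g\<close>
    zero.\<close>
  have t_epi: "is_epi C t"
  proof (rule epiI[OF t(1)])
    fix V g assume g: "g \<in> Hom C K V" "g \<cdot> t = Zero C A V"
    obtain N n where n: "is_kernel C g n" "n \<in> Hom C N K"
      using kernel_ex[OF g(1)] .
    note univ_n = kernel_universal[OF n(1) g(1) n(2)]
    obtain t' where t': "t' \<in> Hom C A N" "n \<cdot> t' = t"
      using univ_n(2)[OF t(1) g(2)] by blast
    have mn: "m \<cdot> n \<in> Hom C N P"
      using m n by simp
    have "is_mono C (m \<cdot> n)"
    proof (rule monoI[OF mn])
      fix U x assume x: "x \<in> Hom C U N" "(m \<cdot> n) \<cdot> x = Zero C U P"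
      then have "n \<cdot> x = Zero C U K"
        using mono_zero[OF univ_m(3) m(2), of "n \<cdot> x" U] m n by simp
      then show "x = Zero C U N"
        using mono_zero[OF univ_n(3) n(2)] x by blast
    qed
    then obtain s where s: "s \<in> Hom C K N" "(m \<cdot> n) \<cdot> s = m"
    proof (rule mono_kernel[OF _ mn m(2)])
      fix U x assume x: "x \<in> Hom C P U" "x \<cdot> (m \<cdot> n) = Zero C N U"
      have "x \<cdot> \<phi> = (x \<cdot> (m \<cdot> n)) \<cdot> t'"
        using x(1) t m n t' by auto
      also have "\<dots> = Zero C A U"
        unfolding x(2) using t' x(1) by simp
      finally obtain y where y: "y \<in> Hom C Q U" "y \<cdot> c = x"
        using univ_c(2)[OF x(1)] by blast
      then show "x \<cdot> m = Zero C K U"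
        using c(2) m(2) univ_m(1) by auto
    qed blast
    have "m \<cdot> (n \<cdot> s) = m \<cdot> Ident C K"
      using s m n by simp
    then have "n \<cdot> s = Ident C K"
      using mono_cancel[OF univ_m(3) m(2), of "n \<cdot> s" K "Ident C K"] s n by simp
    then have "g = (g \<cdot> n) \<cdot> s"
      using g n s by simp
    then show "g = Zero C K V"
      unfolding univ_n(1) using s g n by simp
  qed
  obtain u where u: "u \<in> Hom C W K" "m \<cdot> u = k"
    using univ_m(2)[OF k] by blast
  obtain Z e w where w: "e \<in> Hom C Z W" "is_epi C e" "w \<in> Hom C Z A" "t \<cdot> w = u \<cdot> e"
    using epi_pullback[OF t_epi t(1) u(1)] .
  have "\<phi> \<cdot> w = m \<cdot> (t \<cdot> w)"
    using t m w by auto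
  also have "\<dots> = k \<cdot> e"
    unfolding w(4) using u m w by auto
  finally show thesis
    using that w by blast
qed

text \<open>\<open>P\<close> is the cokernel of the map from \<open>A\<close> to the biproduct of
  \<open>D\<close> and \<open>B\<close> with components \<open>g\<close> and \<open>f\<close>; the
  sign is put into \<open>i\<close>. The last clause bounds the kernel of \<open>j\<close> by the
  image under \<open>f\<close> of the kernel of \<open>g\<close>, up to a cover.\<close>

lemma pushout:
  assumes f: "f \<in> Hom C A B" and g: "g \<in> Hom C A D"
  obtains P i j where "i \<in> Hom C D P" "j \<in> Hom C B P" "i \<cdot> g = j \<cdot> f"
    and "\<And>W k. k \<in> Hom C W B \<Longrightarrow> j \<cdot> k = Zero C W P \<Longrightarrow>
      \<exists>Z e w. e \<in> Hom C Z W \<and> is_epi C e \<and> w \<in> Hom C Z A \<and> g \<cdot> w = Zero C Z D \<and> f \<cdot> w = k \<cdot> e"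
proof -
  have DB: "D \<in> Obj C" "B \<in> Obj C"
    using f g by simp_all
  obtain P p q i j where p: "p \<in> Hom C P D" and q: "q \<in> Hom C P B"
    and i: "i \<in> Hom C D P" and j: "j \<in> Hom C B P"
    and eqs: "p \<cdot> i = Ident C D" "q \<cdot> j = Ident C B" "q \<cdot> i = Zero C D B" "p \<cdot> j = Zero C B D"
    by (rule biproduct_ex[OF DB]) blast
  define \<phi> where "\<phi> = i \<cdot> g \<oplus> j \<cdot> f"
  have \<phi>: "\<phi> \<in> Hom C A P"
    using i g j f by (simp add: \<phi>_def)
  obtain Q c where c: "is_cokernel C \<phi> c" "c \<in> Hom C P Q"
    using cokernel_ex[OF \<phi>] .
  obtain i' where i': "i' \<in> Hom C D Q" "c \<cdot> i \<oplus> i' = Zero C D Q"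
    using negative[of "c \<cdot> i" D Q] c i by auto
  show thesis
  proof
    show "i' \<in> Hom C D Q" "c \<cdot> j \<in> Hom C B Q"
      using i' c j by auto
    have "c \<cdot> (i \<cdot> g) \<oplus> c \<cdot> (j \<cdot> f) = Zero C A Q"
      using cokernel_universal(1)[OF c(1) \<phi> c(2)] i g j f c by (simp add: \<phi>_def)
    moreover have "(c \<cdot> i \<oplus> i') \<cdot> g = c \<cdot> (i \<cdot> g) \<oplus> i' \<cdot> g"
      using c i i'(1) g by simp
    then have "c \<cdot> (i \<cdot> g) \<oplus> i' \<cdot> g = Zero C A Q"
      using i' g c by simp
    ultimately have "c \<cdot> (i \<cdot> g) \<oplus> i' \<cdot> g = c \<cdot> (i \<cdot> g) \<oplus> c \<cdot> (j \<cdot> f)"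
      by simp
    then show "i' \<cdot> g = (c \<cdot> j) \<cdot> f"
      using Add_cancel[of "c \<cdot> (i \<cdot> g)" A Q "i' \<cdot> g" "c \<cdot> (j \<cdot> f)"] c i g j f i'(1) by simp
    fix W k assume k: "k \<in> Hom C W B" "(c \<cdot> j) \<cdot> k = Zero C W Q"
    then obtain Z e w where w: "e \<in> Hom C Z W" "is_epi C e" "w \<in> Hom C Z A" "\<phi> \<cdot> w = (j \<cdot> k) \<cdot> e"
      using cokernel_exact[OF \<phi> c, of "j \<cdot> k" W] c j by auto
    \<comment> \<open>By \<open>w(4)\<close> this equals \<open>j \<cdot> (k \<cdot> e)\<close>,
      which lies in the summand \<open>B\<close>. Applying \<open>p\<close> and \<open>q\<close>
      separates the two components.\<close>
    have \<phi>w: "\<phi> \<cdot> w = i \<cdot> (g \<cdot> w) \<oplus> j \<cdot> (f \<cdot> w)"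
      using i g j f w(3) by (simp add: \<phi>_def)
    have "g \<cdot> w = p \<cdot> (\<phi> \<cdot> w)"
      unfolding \<phi>w using p i g j f w(3) by (simp add: Comp_reassoc[OF eqs(1)] Comp_reassoc[OF eqs(4)])
    also have "\<dots> = Zero C Z D"
      unfolding w(4) using p j k w(1) by (simp add: Comp_reassoc[OF eqs(4)])
    finally have gw: "g \<cdot> w = Zero C Z D" .
    have "f \<cdot> w = q \<cdot> (\<phi> \<cdot> w)"
      unfolding \<phi>w using q i g j f w(3) by (simp add: Comp_reassoc[OF eqs(2)] Comp_reassoc[OF eqs(3)])
    also have "\<dots> = k \<cdot> e"
      unfolding w(4) using q j k w(1) by (simp add: Comp_reassoc[OF eqs(2)])
    finally show "\<exists>Z e w. e \<in> Hom C Z W \<and> is_epi C e \<and> w \<in> Hom C Z A \<and>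
        g \<cdot> w = Zero C Z D \<and> f \<cdot> w = k \<cdot> e"
      using w gw by blast
  qed
qed

end

section \<open>Liftable morphisms\<close>

locale exact_products = abelian C
  for C :: "('o, 'm) preadditive_category" (structure) +
  fixes \<kappa> :: "'u rel"
  assumes inaccessible: "inaccessible \<kappa>"
    and locally_small: "locally_small \<kappa> C"
    and generator_ex: "\<exists>G. generator C G"
    and small_coproducts: "has_small_coproducts \<kappa> C"
    and small_products: "has_small_products \<kappa> C"
    and exact_products: "exact_small_products \<kappa> C"
begin

lemma product_small_ex:
  assumes "small \<kappa> I" "\<And>i. i \<in> I \<Longrightarrow> X i \<in> Obj C"
  obtains P p where "is_product C I X P p"
proof -
  obtain \<phi> :: "_ \<Rightarrow> 'u" where \<phi>: "inj_on \<phi> I" "small \<kappa> (\<phi> ` I)"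
    using small_embedding[OF inaccessible assms(1)] .
  have "(X \<circ> inv_into I \<phi>) ` \<phi> ` I \<subseteq> Obj C"
    using assms(2) \<phi>(1) by auto
  then obtain P p where "is_product C (\<phi> ` I) (X \<circ> inv_into I \<phi>) P p"
    using small_products \<phi>(2) unfolding has_small_products_def by blast
  then have "is_product C I X P (p \<circ> \<phi>)"
    by (rule product_reindex) (use \<phi>(1) in \<open>auto simp: bij_betw_def\<close>)
  then show thesis
    by (rule that)
qed

lemma generator_zero:
  assumes G: "generator C G" and g: "g \<in> Hom C X Z"
    and zero: "\<And>h. h \<in> Hom C G X \<Longrightarrow> g \<cdot> h = Zero C G Z"
  shows "g = Zero C X Z"
proof -
  have GX: "G \<in> Obj C" "X \<in> Obj C" "Z \<in> Obj C"
    using G g unfolding generator_def by auto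
  then have inj: "inj_on (\<lambda>f. \<lambda>h \<in> Hom C G X. f \<cdot> h) (Hom C X Z)"
    using G unfolding generator_def by blast
  have "(\<lambda>h \<in> Hom C G X. g \<cdot> h) = (\<lambda>h \<in> Hom C G X. Zero C X Z \<cdot> h)"
  proof
    fix h
    show "(\<lambda>h \<in> Hom C G X. g \<cdot> h) h = (\<lambda>h \<in> Hom C G X. Zero C X Z \<cdot> h) h"
      using zero[of h] GX by (auto simp: restrict_def)
  qed
  moreover have "Zero C X Z \<in> Hom C X Z"
    using GX by simp
  ultimately show ?thesis
    using inj_onD[OF inj _ g] by blast
qed

text \<open>\<open>Q\<close> is a sum of copies of \<open>G\<close>, one for each member of
  \<open>J\<close>, and \<open>c\<close> has the members of \<open>J\<close> as components. So a map
  killing \<open>c\<close> kills all of \<open>J\<close>, and lifting every member of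
  \<open>J\<close> along \<open>e\<close> lifts \<open>c\<close>.\<close>

lemma generated_cover:
  assumes G: "generator C G" and X: "X \<in> Obj C" and J: "J \<subseteq> Hom C G X"
  obtains Q c where "c \<in> Hom C Q X"
    and "\<And>Z g j. g \<in> Hom C X Z \<Longrightarrow> g \<cdot> c = Zero C Q Z \<Longrightarrow> j \<in> J \<Longrightarrow> g \<cdot> j = Zero C G Z"
    and "\<And>Y e. e \<in> Hom C Y X \<Longrightarrow> J \<subseteq> (\<lambda>h. e \<cdot> h) ` Hom C G Y \<Longrightarrow>
      \<exists>r. r \<in> Hom C Q Y \<and> e \<cdot> r = c"
proof -
  have Gob: "G \<in> Obj C"
    using G unfolding generator_def by blast
  have "small \<kappa> (Hom C G X)"
    using locally_small Gob X unfolding locally_small_def by blast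
  then have "small \<kappa> J"
    using small_subset[OF inaccessible] J by blast
  then obtain \<phi> :: "'m \<Rightarrow> 'u" where \<phi>: "inj_on \<phi> J" "small \<kappa> (\<phi> ` J)"
    using small_embedding[OF inaccessible] by blast
  define \<psi> where "\<psi> = inv_into J \<phi>"
  have \<psi>: "\<psi> (\<phi> j) = j" if "j \<in> J" for j
    unfolding \<psi>_def using \<phi>(1) that by simp
  obtain Q q where Q: "is_coproduct C (\<phi> ` J) (\<lambda>_. G) Q q"
    using small_coproducts \<phi>(2) Gob unfolding has_small_coproducts_def by (metis image_subsetI)
  have q: "q i \<in> Hom C G Q" if "i \<in> \<phi> ` J" for i
    using Q that unfolding is_coproduct_def by blast
  have univ: "\<exists>!h. h \<in> Hom C Q W \<and> (\<forall>i \<in> \<phi> ` J. h \<cdot> q i = f i)"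
    if "W \<in> Obj C" "\<forall>i \<in> \<phi> ` J. f i \<in> Hom C G W" for W f
    using Q[unfolded is_coproduct_def, THEN conjunct2, THEN conjunct2] that by (simp only: simp_thms)
  have \<psi>_Hom: "\<forall>i \<in> \<phi> ` J. \<psi> i \<in> Hom C G X"
  proof
    fix i assume "i \<in> \<phi> ` J"
    then obtain j where "j \<in> J" "i = \<phi> j"
      by blast
    then show "\<psi> i \<in> Hom C G X"
      using \<psi> J by (metis subsetD)
  qed
  then obtain c where c: "c \<in> Hom C Q X" "\<forall>i \<in> \<phi> ` J. c \<cdot> q i = \<psi> i"
    using ex1_implies_ex[OF univ[OF X \<psi>_Hom]] by blast
  show thesis
  proof (rule that[OF c(1)])
    fix Z g j assume g: "g \<in> Hom C X Z" "g \<cdot> c = Zero C Q Z" and j: "j \<in> J"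
    have "g \<cdot> j = g \<cdot> (c \<cdot> q (\<phi> j))"
      using c(2) \<psi>[OF j] j by simp
    also have "\<dots> = Zero C G Z"
      using q[of "\<phi> j"] j g(1) c(1) Comp_reassoc[OF g(2), of "q (\<phi> j)"] by simp
    finally show "g \<cdot> j = Zero C G Z" .
  next
    fix Y e assume e: "e \<in> Hom C Y X" and sub: "J \<subseteq> (\<lambda>h. e \<cdot> h) ` Hom C G Y"
    then have "\<forall>j\<in>J. \<exists>h. h \<in> Hom C G Y \<and> e \<cdot> h = j"
      by blast
    then obtain l where l: "\<And>j. j \<in> J \<Longrightarrow> l j \<in> Hom C G Y" "\<And>j. j \<in> J \<Longrightarrow> e \<cdot> l j = j"
      by metis
    have "\<forall>i \<in> \<phi> ` J. l (\<psi> i) \<in> Hom C G Y"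
    proof
      fix i assume "i \<in> \<phi> ` J"
      then show "l (\<psi> i) \<in> Hom C G Y"
        using \<psi> l(1) by (metis imageE)
    qed
    moreover have "Y \<in> Obj C"
      using e by simp
    ultimately obtain r where r: "r \<in> Hom C Q Y" "\<forall>i \<in> \<phi> ` J. r \<cdot> q i = l (\<psi> i)"
      using univ[of Y "\<lambda>i. l (\<psi> i)"] by blast
    have "(e \<cdot> r) \<cdot> q i = c \<cdot> q i" if i: "i \<in> \<phi> ` J" for i
    proof -
      have "(e \<cdot> r) \<cdot> q i = e \<cdot> (r \<cdot> q i)"
        using q[OF i] e r(1) by simp
      also have "\<dots> = \<psi> i"
        using r(2) i l(2) \<psi> by auto
      finally show ?thesis
        unfolding bspec[OF c(2) i] .
    qed
    moreover have "\<forall>i \<in> \<phi> ` J. c \<cdot> q i \<in> Hom C G X"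
      using c(2) \<psi>_Hom by (simp del: hom_iff)
    moreover have "e \<cdot> r \<in> Hom C Q X"
      using e r by simp
    ultimately have "e \<cdot> r = c"
      using univ[OF X, of "\<lambda>i. c \<cdot> q i"] c(1) by blast
    then show "\<exists>r. r \<in> Hom C Q Y \<and> e \<cdot> r = c"
      using r(1) by blast
  qed
qed

text \<open>Exactness of products is assumed for short exact sequences, so each \<open>e i\<close>
  is completed by its kernel, and the product of the kernels supplies the left-hand term.\<close>

lemma product_epi:
  fixes I :: "'u set"
  assumes "small \<kappa> I" and e: "\<And>i. i \<in> I \<Longrightarrow> e i \<in> Hom C (X i) (Y i)"
    and epi: "\<And>i. i \<in> I \<Longrightarrow> is_epi C (e i)"
    and P: "is_product C I X P p" and R: "is_product C I Y R r"
    and v: "v \<in> Hom C P R" "\<And>i. i \<in> I \<Longrightarrow> r i \<cdot> v = e i \<cdot> p i"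
  shows "is_epi C v"
proof -
  have "\<forall>i\<in>I. \<exists>k. is_kernel C (e i) k \<and> k \<in> Hom C (Dom C k) (X i)"
  proof
    fix i assume "i \<in> I"
    then obtain K k where "is_kernel C (e i) k" "k \<in> Hom C K (X i)"
      using kernel_ex[OF e] by blast
    then show "\<exists>k. is_kernel C (e i) k \<and> k \<in> Hom C (Dom C k) (X i)"
      by auto
  qed
  then obtain k where k: "\<And>i. i \<in> I \<Longrightarrow> is_kernel C (e i) (k i)"
    "\<And>i. i \<in> I \<Longrightarrow> k i \<in> Hom C (Dom C (k i)) (X i)"
    by metis
  obtain K q where K: "is_product C I (\<lambda>i. Dom C (k i)) K q"
    using product_small_ex[OF assms(1), of "\<lambda>i. Dom C (k i)"] k(2) by auto
  have P': "is_product C I (\<lambda>i. Cod C (k i)) P p"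
    using product_reindex[OF P bij_betw_id, of "\<lambda>i. Cod C (k i)"] k(2) by simp
  have R': "is_product C I (\<lambda>i. Cod C (e i)) R r"
    using product_reindex[OF R bij_betw_id, of "\<lambda>i. Cod C (e i)"] e by simp
  have "K \<in> Obj C"
    using K unfolding is_product_def by blast
  moreover have "k i \<cdot> q i \<in> Hom C K (X i)" if "i \<in> I" for i
    using product_Hom[OF K that] k(2)[OF that] by simp
  ultimately obtain u where u: "u \<in> Hom C K P" "\<And>i. i \<in> I \<Longrightarrow> p i \<cdot> u = k i \<cdot> q i"
    using product_ex[OF P, of K "\<lambda>i. k i \<cdot> q i"] by blast
  have "\<forall>i\<in>I. short_exact C (k i) (e i)"
    using epi_short_exact[OF epi e k] by blast
  then have "short_exact C u v"
    using exact_products[unfolded exact_small_products_def, rule_format, of I k e K q P p R r u v]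
      assms(1) K P' R' u v by blast
  then show ?thesis
    using cokernel_universal(3)[OF _ u(1) v(1)] unfolding short_exact_def by blast
qed

text \<open>A substitute for projectivity, asked of the single map \<open>v\<close> instead of all
  maps out of its domain: no projective objects are assumed to exist.\<close>

definition liftable where
  "liftable v \<longleftrightarrow> v \<in> Arr C \<and>
    (\<forall>Y e. e \<in> Hom C Y (Cod C v) \<and> is_epi C e \<longrightarrow> (\<exists>u. u \<in> Hom C (Dom C v) Y \<and> e \<cdot> u = v))"

lemma liftableD:
  assumes "liftable v" "v \<in> Hom C W X" "e \<in> Hom C Y X" "is_epi C e"
  obtains u where "u \<in> Hom C W Y" "e \<cdot> u = v"
  using assms unfolding liftable_def by auto

text \<open>Pull the epimorphism back along \<open>f\<close> and lift \<open>v\<close> through the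
  pullback.\<close>

lemma liftable_Comp:
  assumes "liftable v" "v \<in> Hom C W X" "f \<in> Hom C X Y"
  shows "liftable (f \<cdot> v)"
  unfolding liftable_def
proof (intro conjI allI impI)
  fix Z e assume "e \<in> Hom C Z (Cod C (f \<cdot> v)) \<and> is_epi C e"
  then have e: "e \<in> Hom C Z Y" "is_epi C e"
    using assms by auto
  obtain E e' t where e': "e' \<in> Hom C E X" "is_epi C e'" "t \<in> Hom C E Z" "e \<cdot> t = f \<cdot> e'"
    using epi_pullback[OF e(2,1) assms(3)] .
  obtain u where u: "u \<in> Hom C W E" "e' \<cdot> u = v"
    using liftableD[OF assms(1,2) e'(1,2)] .
  have "e \<cdot> (t \<cdot> u) = f \<cdot> v"
    using e e' u assms Comp_reassoc[OF e'(4), of u] by auto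
  then show "\<exists>u. u \<in> Hom C (Dom C (f \<cdot> v)) Z \<and> e \<cdot> u = f \<cdot> v"
    using assms e' u by (intro exI[of _ "t \<cdot> u"]) simp
qed (use assms in simp)

text \<open>
  Up to refinement there is only a small set of epimorphisms onto \<open>X\<close>: the maps \<open>\<Oplus>\<^sub>J G \<rightarrow> X\<close> given by
  jointly epic \<open>J \<subseteq> Hom(G, X)\<close>. Their product is epic by exactness of products, and its pullback
  along the diagonal of \<open>X\<close> refines all of them simultaneously.
\<close>

theorem liftable_epi_ex:
  assumes X: "X \<in> Obj C"
  obtains Z z where "z \<in> Hom C Z X" "is_epi C z" "liftable z"
proof -
  obtain G where G: "generator C G"
    using generator_ex by blast
  have Gob: "G \<in> Obj C"
    using G unfolding generator_def by blast
  let ?cover = "\<lambda>J Q c. c \<in> Hom C Q X \<and>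
    (\<forall>Z g j. g \<in> Hom C X Z \<and> g \<cdot> c = Zero C Q Z \<and> j \<in> J \<longrightarrow> g \<cdot> j = Zero C G Z) \<and>
    (\<forall>Y e. e \<in> Hom C Y X \<and> J \<subseteq> (\<lambda>h. e \<cdot> h) ` Hom C G Y \<longrightarrow> (\<exists>r. r \<in> Hom C Q Y \<and> e \<cdot> r = c))"
  have "\<exists>Q c. ?cover J Q c" if "J \<subseteq> Hom C G X" for J
    by (rule generated_cover[OF G X that]) blast
  then obtain Q c where cover: "\<And>J. J \<subseteq> Hom C G X \<Longrightarrow> ?cover J (Q J) (c J)"
    by metis
  define \<J> where "\<J> = {J. J \<subseteq> Hom C G X \<and> is_epi C (c J)}"
  have "small \<kappa> (Pow (Hom C G X))"
    using locally_small Gob X small_Pow[OF inaccessible] unfolding locally_small_def by blast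
  moreover have "\<J> \<subseteq> Pow (Hom C G X)"
    unfolding \<J>_def by blast
  ultimately have "small \<kappa> \<J>"
    by (rule small_subset[OF inaccessible])
  then obtain \<phi> :: "'m set \<Rightarrow> 'u" where \<phi>: "inj_on \<phi> \<J>" "small \<kappa> (\<phi> ` \<J>)"
    using small_embedding[OF inaccessible] by blast
  define I where "I = \<phi> ` \<J>"
  define \<psi> where "\<psi> = inv_into \<J> \<phi>"
  have \<psi>\<phi>: "\<psi> (\<phi> J) = J" if "J \<in> \<J>" for J
    unfolding \<psi>_def using \<phi>(1) that by simp
  have I: "small \<kappa> I" "\<And>i. i \<in> I \<Longrightarrow> \<psi> i \<in> \<J>"
    using \<phi>(2) \<psi>\<phi> unfolding I_def by auto
  have c: "c (\<psi> i) \<in> Hom C (Q (\<psi> i)) X" "is_epi C (c (\<psi> i))" if "i \<in> I" for i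
    using I(2)[OF that] cover[of "\<psi> i"] unfolding \<J>_def by (blast, blast)
  obtain P p where P: "is_product C I (\<lambda>i. Q (\<psi> i)) P p"
    by (rule product_small_ex[OF I(1), of "\<lambda>i. Q (\<psi> i)"]) (use c in auto)
  obtain R r where R: "is_product C I (\<lambda>_. X) R r"
    by (rule product_small_ex[OF I(1), of "\<lambda>_. X"]) (use X in auto)
  have ob: "P \<in> Obj C" "R \<in> Obj C"
    using P R unfolding is_product_def by auto
  have "c (\<psi> i) \<cdot> p i \<in> Hom C P X" if "i \<in> I" for i
    using product_Hom[OF P that] c[OF that] by simp
  then obtain v where v: "v \<in> Hom C P R" "\<And>i. i \<in> I \<Longrightarrow> r i \<cdot> v = c (\<psi> i) \<cdot> p i"
    using product_ex[OF R ob(1), of "\<lambda>i. c (\<psi> i) \<cdot> p i"] by blast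
  have v_epi: "is_epi C v"
    by (rule product_epi[OF I(1) c P R v])
  obtain d where d: "d \<in> Hom C X R" "\<And>i. i \<in> I \<Longrightarrow> r i \<cdot> d = Ident C X"
    using product_ex[OF R X, of "\<lambda>_. Ident C X"] Ident_Hom[OF X] by blast
  obtain Z z t where z: "z \<in> Hom C Z X" "is_epi C z" "t \<in> Hom C Z P" "v \<cdot> t = d \<cdot> z"
    using epi_pullback[OF v_epi v(1) d(1)] .
  have "liftable z"
    unfolding liftable_def
  proof (intro conjI allI impI)
    fix Y e assume "e \<in> Hom C Y (Cod C z) \<and> is_epi C e"
    then have e: "e \<in> Hom C Y X" "is_epi C e"
      using z by auto
    \<comment> \<open>\<open>J\<close> collects the maps from \<open>G\<close> to \<open>X\<close>
      that lift along \<open>e\<close>, so \<open>c J\<close> factors through \<open>e\<close>. It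
      is epic: a map killing it composes with \<open>e\<close> to a map that vanishes on all of
      \<open>Hom C G Y\<close>, hence is zero.\<close>
    define J where "J = (\<lambda>h. e \<cdot> h) ` Hom C G Y"
    have J: "J \<subseteq> Hom C G X"
      using e unfolding J_def by auto
    note cJ = cover[OF J]
    have "is_epi C (c J)"
    proof (rule epiI)
      show "c J \<in> Hom C (Q J) X"
        using cJ by blast
      fix V g assume g: "g \<in> Hom C X V" "g \<cdot> c J = Zero C (Q J) V"
      have "(g \<cdot> e) \<cdot> h = Zero C G V" if h: "h \<in> Hom C G Y" for h
      proof -
        have "g \<cdot> (e \<cdot> h) = Zero C G V"
          using cJ g h unfolding J_def by blast
        then show ?thesis
          using g e h by simp
      qed
      moreover have "g \<cdot> e \<in> Hom C Y V"
        using g e by simp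
      ultimately have "g \<cdot> e = Zero C Y V"
        using generator_zero[OF G] by blast
      then show "g = Zero C X V"
        using epi_zero[OF e(2,1) g(1)] by blast
    qed
    then have J\<J>: "J \<in> \<J>"
      using J unfolding \<J>_def by blast
    then have i: "\<phi> J \<in> I" "\<psi> (\<phi> J) = J"
      using \<psi>\<phi> unfolding I_def by auto
    obtain s where s: "s \<in> Hom C (Q J) Y" "e \<cdot> s = c J"
      using cJ e(1) unfolding J_def by blast
    have pJ: "p (\<phi> J) \<in> Hom C P (Q J)" "r (\<phi> J) \<in> Hom C R X"
      using product_Hom[OF P i(1)] product_Hom[OF R i(1)] i(2) by simp_all
    have cJ1: "c J \<in> Hom C (Q J) X"
      using cJ by blast
    \<comment> \<open>Read \<open>v \<cdot> t = d \<cdot> z\<close> at the coordinate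
      \<open>\<phi> J\<close>: the left side passes through \<open>c J\<close>, hence through
      \<open>e\<close>, and the right side is \<open>z\<close> because \<open>d\<close> is the
      diagonal.\<close>
    have "e \<cdot> (s \<cdot> (p (\<phi> J) \<cdot> t)) = c J \<cdot> (p (\<phi> J) \<cdot> t)"
      using s e pJ z by (intro Comp_reassoc) simp_all
    also have "\<dots> = (c (\<psi> (\<phi> J)) \<cdot> p (\<phi> J)) \<cdot> t"
      using cJ1 pJ z i(2) by simp
    also have "\<dots> = (r (\<phi> J) \<cdot> v) \<cdot> t"
      unfolding v(2)[OF i(1)] ..
    also have "\<dots> = r (\<phi> J) \<cdot> (v \<cdot> t)"
      using pJ v(1) z by simp
    also have "\<dots> = (r (\<phi> J) \<cdot> d) \<cdot> z"
      unfolding z(4) using pJ d(1) z by simp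
    also have "\<dots> = z"
      unfolding d(2)[OF i(1)] using z by simp
    finally show "\<exists>u. u \<in> Hom C (Dom C z) Y \<and> e \<cdot> u = z"
      using s pJ z by (intro exI[of _ "s \<cdot> (p (\<phi> J) \<cdot> t)"]) simp
  qed (use z in simp)
  then show thesis
    using that z by blast
qed

text \<open>
  Composing a liftable epimorphism onto \<open>Y\<close> with \<open>e\<close> shows that the lift can again be chosen
  liftable; so liftable morphisms can be lifted along a whole tower of epimorphisms.
\<close>

lemma liftable_lift:
  assumes v: "liftable v" "v \<in> Hom C W X" and e: "e \<in> Hom C Y X" "is_epi C e"
  obtains u where "u \<in> Hom C W Y" "e \<cdot> u = v" "liftable u"
proof -
  have "Y \<in> Obj C"
    using e by simp
  then obtain Z z where z: "z \<in> Hom C Z Y" "is_epi C z" "liftable z"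
    using liftable_epi_ex by blast
  have "e \<cdot> z \<in> Hom C Z X" "is_epi C (e \<cdot> z)"
    using z e epi_Comp[OF z(2) e(2) z(1) e(1)] by simp_all
  then obtain u where u: "u \<in> Hom C W Z" "(e \<cdot> z) \<cdot> u = v"
    using liftableD[OF v] by blast
  show thesis
  proof
    show "z \<cdot> u \<in> Hom C W Y" "e \<cdot> (z \<cdot> u) = v"
      using z e u by simp_all
    show "liftable (z \<cdot> u)"
      unfolding liftable_def
    proof (intro conjI allI impI)
      fix V f assume "f \<in> Hom C V (Cod C (z \<cdot> u)) \<and> is_epi C f"
      then have f: "f \<in> Hom C V Y" "is_epi C f"
        using z u by auto
      obtain t where t: "t \<in> Hom C Z V" "f \<cdot> t = z"
        using liftableD[OF z(3,1) f] .
      then have "f \<cdot> (t \<cdot> u) = z \<cdot> u"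
        using Comp_reassoc[OF t(2), of u] f u z by simp
      then show "\<exists>w. w \<in> Hom C (Dom C (z \<cdot> u)) V \<and> f \<cdot> w = z \<cdot> u"
        using t u z by (intro exI[of _ "t \<cdot> u"]) simp
    qed (use z u in simp)
  qed
qed

text \<open>A liftable epimorphism onto \<open>M n\<close> lifts step by step through the whole
  tower, which gives a compatible family out of a single \<open>Z\<close>. By \<open>zero\<close>
  this family vanishes, and an object onto which the zero map is epic has zero identity.\<close>

theorem epi_tower_zero:
  assumes f: "\<And>n. f n \<in> Hom C (M (Suc n)) (M n)" "\<And>n. is_epi C (f n)"
    and zero: "\<And>W y i. W \<in> Obj C \<Longrightarrow> (\<And>i. y i \<in> Hom C W (M i)) \<Longrightarrow>
      (\<And>i. y i = f i \<cdot> y (Suc i)) \<Longrightarrow> y i = Zero C W (M i)"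
  shows "Ident C (M n) = Zero C (M n) (M n)"
proof (induction n rule: less_induct)
  case (less n)
  have M: "M i \<in> Obj C" for i
    using f(1)[of i] by simp
  obtain Z z where z: "z \<in> Hom C Z (M n)" "is_epi C z" "liftable z"
    using liftable_epi_ex[OF M] .
  have "\<exists>w. \<forall>k. (w k \<in> Hom C Z (M (n + k)) \<and> liftable (w k) \<and> (k = 0 \<longrightarrow> w k = z)) \<and>
      f (n + k) \<cdot> w (Suc k) = w k"
  proof (rule dependent_nat_choice)
    show "\<exists>x. x \<in> Hom C Z (M (n + 0)) \<and> liftable x \<and> (0 = (0::nat) \<longrightarrow> x = z)"
      using z by auto
    fix x k assume x: "x \<in> Hom C Z (M (n + k)) \<and> liftable x \<and> (k = 0 \<longrightarrow> x = z)"
    obtain y where "y \<in> Hom C Z (M (Suc (n + k)))" "f (n + k) \<cdot> y = x" "liftable y"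
      using liftable_lift[of x Z "M (n + k)" "f (n + k)" "M (Suc (n + k))"] x f by blast
    then show "\<exists>y. (y \<in> Hom C Z (M (n + Suc k)) \<and> liftable y \<and> (Suc k = 0 \<longrightarrow> y = z)) \<and>
        f (n + k) \<cdot> y = x"
      by auto
  qed
  then obtain w where w: "\<And>k. w k \<in> Hom C Z (M (n + k))" "w 0 = z"
    "\<And>k. f (n + k) \<cdot> w (Suc k) = w k"
    by blast
  \<comment> \<open>A compatible family also needs entries below \<open>n\<close>. There the
    induction hypothesis makes every map into \<open>M i\<close> zero, so padding by zero is
    compatible, also at the junction of degrees \<open>n - 1\<close> and \<open>n\<close>.\<close>
  define y where "y = (\<lambda>i. if i < n then Zero C Z (M i) else w (i - n))"
  have Z: "Z \<in> Obj C"
    using z by simp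
  have y: "y i \<in> Hom C Z (M i)" for i
  proof (cases "i < n")
    case True
    then show ?thesis
      using Z M by (simp add: y_def)
  next
    case False
    then show ?thesis
      using w(1)[of "i - n"] by (simp add: y_def)
  qed
  have y_compat: "y i = f i \<cdot> y (Suc i)" for i
  proof (cases "i < n")
    case True
    have fy: "f i \<cdot> y (Suc i) \<in> Hom C Z (M i)"
      by (rule Comp_Hom[OF y f(1)])
    then have "f i \<cdot> y (Suc i) = Ident C (M i) \<cdot> (f i \<cdot> y (Suc i))"
      by simp
    also have "\<dots> = Zero C Z (M i)"
      unfolding less.IH[OF True] using fy by simp
    finally show ?thesis
      using True by (simp add: y_def)
  next
    case False
    then show ?thesis
      using w(3)[of "i - n"] by (simp add: y_def Suc_diff_le)
  qed
  have "z = Zero C Z (M n)"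
    using zero[OF Z y y_compat, of n] w(2) by (simp add: y_def)
  then have "Ident C (M n) \<cdot> z = Zero C Z (M n)"
    using z by simp
  then show ?case
    using epi_zero[OF z(2,1)] Ident_Hom[OF M] by blast
qed

end

section \<open>Inverse sequences\<close>

context preadditive
begin

abbreviation "Seq \<equiv> seq_category C"

text \<open>The arrows of \<open>Seq\<close> carry their domain and codomain; this is the same
  notion on the bare family of components.\<close>

definition seq_hom where
  "seq_hom S \<phi> T \<longleftrightarrow> is_inverse_sequence C S \<and> is_inverse_sequence C T \<and>
    (\<forall>i. \<phi> i \<in> Hom C (ob S i) (ob T i)) \<and> (\<forall>i. \<phi> i \<cdot> bond S i = bond T i \<cdot> \<phi> (Suc i))"

lemma inverse_sequenceD [simp]:
  assumes "is_inverse_sequence C S"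
  shows "ob S i \<in> Obj C" "bond S i \<in> Arr C" "Dom C (bond S i) = ob S (Suc i)"
    "Cod C (bond S i) = ob S i"
  using assms unfolding is_inverse_sequence_def by simp_all

lemma seq_homD:
  assumes "seq_hom S \<phi> T"
  shows "is_inverse_sequence C S" "is_inverse_sequence C T" "\<phi> i \<in> Hom C (ob S i) (ob T i)"
    "\<phi> i \<cdot> bond S i = bond T i \<cdot> \<phi> (Suc i)"
  using assms unfolding seq_hom_def by blast+

lemma Obj_Seq: "S \<in> Obj Seq \<longleftrightarrow> is_inverse_sequence C S"
  by (simp add: seq_category_def)

lemma Hom_Seq: "F \<in> Hom Seq S T \<longleftrightarrow> (\<exists>\<phi>. F = (S, \<phi>, T) \<and> seq_hom S \<phi> T)"
  by (auto simp: Hom_def seq_category_def seq_hom_def)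

lemma Arr_Seq: "(S, \<phi>, T) \<in> Arr Seq \<longleftrightarrow> seq_hom S \<phi> T"
  by (auto simp: seq_category_def seq_hom_def)

lemma Seq_simps:
  "Dom Seq (S, \<phi>, T) = S" "Cod Seq (S, \<phi>, T) = T"
  "Ident Seq S = (S, \<lambda>i. Ident C (ob S i), S)"
  "(T', \<psi>, U) \<cdot>\<^bsub>Seq\<^esub> (S, \<phi>, T) = (S, \<lambda>i. \<psi> i \<cdot> \<phi> i, U)"
  "Zero Seq S T = (S, \<lambda>i. Zero C (ob S i) (ob T i), T)"
  by (simp_all add: seq_category_def)

lemma seq_hom_Ident: "is_inverse_sequence C S \<Longrightarrow> seq_hom S (\<lambda>i. Ident C (ob S i)) S"
  unfolding seq_hom_def by simp

lemma seq_hom_Zero: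
  "is_inverse_sequence C S \<Longrightarrow> is_inverse_sequence C T \<Longrightarrow>
    seq_hom S (\<lambda>i. Zero C (ob S i) (ob T i)) T"
  unfolding seq_hom_def by simp

lemma seq_hom_Comp:
  assumes "seq_hom S \<phi> T" "seq_hom T \<psi> U"
  shows "seq_hom S (\<lambda>i. \<psi> i \<cdot> \<phi> i) U"
  unfolding seq_hom_def
proof (intro conjI allI)
  note \<phi> = seq_homD[OF assms(1)] and \<psi> = seq_homD[OF assms(2)]
  show "is_inverse_sequence C S" "is_inverse_sequence C U"
    using \<phi> \<psi> by blast+
  fix i
  show "\<psi> i \<cdot> \<phi> i \<in> Hom C (ob S i) (ob U i)"
    using \<phi>(3) \<psi>(3) by (rule Comp_Hom)
  have "(\<psi> i \<cdot> \<phi> i) \<cdot> bond S i = \<psi> i \<cdot> (bond T i \<cdot> \<phi> (Suc i))"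
    using \<phi>(1,2) \<phi>(3)[of i] \<psi>(3)[of i] \<phi>(4)[of i] by simp
  also have "\<dots> = (bond U i \<cdot> \<psi> (Suc i)) \<cdot> \<phi> (Suc i)"
    using \<phi>(1,2) \<phi>(3)[of "Suc i"] \<psi>(3)[of i] \<psi>(2)
    by (simp flip: \<psi>(4))
  also have "\<dots> = bond U i \<cdot> (\<psi> (Suc i) \<cdot> \<phi> (Suc i))"
    using \<phi>(3)[of "Suc i"] \<psi>(3)[of "Suc i"] \<psi>(2) by simp
  finally show "(\<psi> i \<cdot> \<phi> i) \<cdot> bond S i = bond U i \<cdot> (\<psi> (Suc i) \<cdot> \<phi> (Suc i))" .
qed

lemma zero_object_Hom:
  assumes "zero_object C Z"
  shows "u \<in> Hom C W Z \<Longrightarrow> u = Zero C W Z" "u \<in> Hom C Z W \<Longrightarrow> u = Zero C Z W"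
proof -
  have Z: "Z \<in> Obj C"
    using assms unfolding zero_object_def by blast
  show "u = Zero C W Z" if u: "u \<in> Hom C W Z"
  proof -
    have "W \<in> Obj C" "Zero C W Z \<in> Hom C W Z"
      using u by simp_all
    then show ?thesis
      using assms u unfolding zero_object_def by blast
  qed
  show "u = Zero C Z W" if u: "u \<in> Hom C Z W"
  proof -
    have "W \<in> Obj C" "Zero C Z W \<in> Hom C Z W"
      using u by simp_all
    then show ?thesis
      using assms u unfolding zero_object_def by blast
  qed
qed

section \<open>Locality as unique solvability\<close>

text \<open>A solution \<open>y\<close> of \<open>(1 - F) y = x\<close> in generalized elements of \<open>\<Prod>\<^sub>i S\<^sub>i\<close>.\<close>

definition solution where
  "solution S W x y \<longleftrightarrow>
    (\<forall>i. y i \<in> Hom C W (ob S i)) \<and> (\<forall>i. y i = x i \<oplus> bond S i \<cdot> y (Suc i))"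

text \<open>This is invertibility of \<open>1 - F\<close>, seen through the functors represented by
  all \<open>W\<close>. It mentions no product, so it can be compared along morphisms of sequences
  without choosing products.\<close>

definition uniquely_solvable where
  "uniquely_solvable S \<longleftrightarrow> is_inverse_sequence C S \<and>
    (\<forall>W x. W \<in> Obj C \<and> (\<forall>i. x i \<in> Hom C W (ob S i)) \<longrightarrow> (\<exists>!y. solution S W x y))"

lemma solution_ex:
  assumes "uniquely_solvable S" "W \<in> Obj C" "\<And>i. x i \<in> Hom C W (ob S i)"
  obtains y where "solution S W x y"
  using assms unfolding uniquely_solvable_def by blast

lemma solution_unique:
  assumes "uniquely_solvable S" "W \<in> Obj C" "\<And>i. x i \<in> Hom C W (ob S i)"
    "solution S W x y" "solution S W x y'"
  shows "y = y'"
proof -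
  have "\<exists>!y. solution S W x y"
    using assms(1,2,3) unfolding uniquely_solvable_def by (simp del: hom_iff)
  then show ?thesis
    using assms(4,5) by blast
qed

text \<open>Both \<open>y\<close> and zero solve the system with right-hand side zero. This is the
  half of locality that expresses \<open>lim S = 0\<close>.\<close>

lemma homogeneous_zero:
  assumes S: "uniquely_solvable S" and W: "W \<in> Obj C"
    and y: "\<And>i. y i \<in> Hom C W (ob S i)" "\<And>i. y i = bond S i \<cdot> y (Suc i)"
  shows "y i = Zero C W (ob S i)"
proof -
  have inv: "is_inverse_sequence C S"
    using S unfolding uniquely_solvable_def by blast
  let ?zero = "\<lambda>i. Zero C W (ob S i)"
  have "?zero i \<oplus> bond S i \<cdot> y (Suc i) = bond S i \<cdot> y (Suc i)" for i
    using y(1)[of "Suc i"] inv by simp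
  then have "y i = ?zero i \<oplus> bond S i \<cdot> y (Suc i)" for i
    by (rule trans[OF y(2) sym])
  with y(1) have "solution S W ?zero y"
    unfolding solution_def by blast
  moreover have "solution S W ?zero ?zero"
    using W inv unfolding solution_def by simp
  ultimately have "y = ?zero"
    by (rule solution_unique[OF S W, rotated]) (use W inv in simp)
  then show ?thesis
    by (rule fun_cong)
qed

lemma difference:
  assumes "f \<in> Hom C X Y" "g \<in> Hom C X Y"
  obtains d where "d \<in> Hom C X Y" "f = g \<oplus> d"
proof -
  obtain g' where g': "g' \<in> Hom C X Y" "g \<oplus> g' = Zero C X Y"
    using negative[OF assms(2)] .
  have "f = f \<oplus> (g \<oplus> g')"
    unfolding g'(2) using assms by simp
  also have "\<dots> = g \<oplus> (f \<oplus> g')"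
    using assms g'(1) by (intro Add_left_commute) simp_all
  finally show thesis
    using that[of "f \<oplus> g'"] assms g'(1) by simp
qed

lemma solution_Comp:
  assumes S: "is_inverse_sequence C S" and x: "\<And>i. x i \<in> Hom C W (ob S i)"
    and y: "solution S W x y" and h: "h \<in> Hom C V W"
  shows "solution S V (\<lambda>i. x i \<cdot> h) (\<lambda>i. y i \<cdot> h)"
  unfolding solution_def
proof (intro conjI allI)
  have yi: "y i \<in> Hom C W (ob S i)" "y i = x i \<oplus> bond S i \<cdot> y (Suc i)" for i
    using y unfolding solution_def by blast+
  fix i
  show "y i \<cdot> h \<in> Hom C V (ob S i)"
    using h yi(1) by (rule Comp_Hom)
  have "y i \<cdot> h = (x i \<oplus> bond S i \<cdot> y (Suc i)) \<cdot> h"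
    by (rule arg_cong[OF yi(2)])
  also have "\<dots> = x i \<cdot> h \<oplus> bond S i \<cdot> (y (Suc i) \<cdot> h)"
    using S x[of i] yi(1)[of "Suc i"] h by simp
  finally show "y i \<cdot> h = x i \<cdot> h \<oplus> bond S i \<cdot> (y (Suc i) \<cdot> h)" .
qed

lemma solution_seq_hom:
  assumes \<phi>: "seq_hom S \<phi> T" and x: "\<And>i. x i \<in> Hom C W (ob S i)"
    and y: "solution S W x y"
  shows "solution T W (\<lambda>i. \<phi> i \<cdot> x i) (\<lambda>i. \<phi> i \<cdot> y i)"
  unfolding solution_def
proof (intro conjI allI)
  note \<phi> = seq_homD[OF \<phi>]
  have yi: "y i \<in> Hom C W (ob S i)" "y i = x i \<oplus> bond S i \<cdot> y (Suc i)" for i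
    using y unfolding solution_def by blast+
  fix i
  show "\<phi> i \<cdot> y i \<in> Hom C W (ob T i)"
    using yi(1) \<phi>(3) by (rule Comp_Hom)
  have "\<phi> i \<cdot> y i = \<phi> i \<cdot> (x i \<oplus> bond S i \<cdot> y (Suc i))"
    by (rule arg_cong[OF yi(2)])
  also have "\<dots> = \<phi> i \<cdot> x i \<oplus> (\<phi> i \<cdot> bond S i) \<cdot> y (Suc i)"
    using \<phi>(1,2) \<phi>(3)[of i] x[of i] yi(1)[of "Suc i"] by simp
  also have "\<dots> = \<phi> i \<cdot> x i \<oplus> bond T i \<cdot> (\<phi> (Suc i) \<cdot> y (Suc i))"
    unfolding \<phi>(4) using \<phi>(1,2) \<phi>(3)[of "Suc i"] yi(1)[of "Suc i"] by simp
  finally show "\<phi> i \<cdot> y i = \<phi> i \<cdot> x i \<oplus> bond T i \<cdot> (\<phi> (Suc i) \<cdot> y (Suc i))" .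
qed

text \<open>Adding \<open>F \<cdot> Y\<close> to both sides turns the equation into
  \<open>Y = X \<oplus> F \<cdot> Y\<close>, which is then read off on every projection.\<close>

lemma shift_solution:
  assumes S: "is_inverse_sequence C S" and F: "is_shift C S P pr F"
    and X: "X \<in> Hom C W P" and Y: "Y \<in> Hom C W P"
  shows "Minus C (Ident C P) F \<cdot> Y = X \<longleftrightarrow> solution S W (\<lambda>i. pr i \<cdot> X) (\<lambda>i. pr i \<cdot> Y)"
proof -
  have P: "is_product C UNIV (ob S) P pr" and FP: "F \<in> Hom C P P"
    and prF: "pr i \<cdot> F = bond S i \<cdot> pr (Suc i)" for i
    using F unfolding is_shift_def by blast+
  have pr: "pr i \<in> Hom C P (ob S i)" for i
    using product_Hom[OF P] by blast
  have P_ob: "P \<in> Obj C"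
    using FP by simp
  let ?D = "Minus C (Ident C P) F"
  have D: "?D \<in> Hom C P P" "?D \<oplus> F = Ident C P"
    using Minus_Hom[OF Ident_Hom[OF P_ob] FP] .
  have "Y = (?D \<oplus> F) \<cdot> Y"
    unfolding D(2) using Y by simp
  then have Y_eq: "Y = ?D \<cdot> Y \<oplus> F \<cdot> Y"
    using D(1) FP Y by simp
  have "?D \<cdot> Y = X \<longleftrightarrow> Y = X \<oplus> F \<cdot> Y"
  proof
    assume "Y = X \<oplus> F \<cdot> Y"
    then have "F \<cdot> Y \<oplus> ?D \<cdot> Y = F \<cdot> Y \<oplus> X"
      using Y_eq Add_commute[of "F \<cdot> Y" "?D \<cdot> Y"] Add_commute[of "F \<cdot> Y" X] D(1) FP X Y by simp
    then show "?D \<cdot> Y = X"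
      using Add_cancel[of "F \<cdot> Y" W P "?D \<cdot> Y" X] D(1) FP X Y by simp
  qed (use Y_eq in simp)
  also have "\<dots> \<longleftrightarrow> (\<forall>i. pr i \<cdot> Y = pr i \<cdot> (X \<oplus> F \<cdot> Y))"
    using product_eq[OF P Y, of "X \<oplus> F \<cdot> Y"] X Y FP by auto
  also have "\<dots> \<longleftrightarrow> (\<forall>i. pr i \<cdot> Y = pr i \<cdot> X \<oplus> bond S i \<cdot> (pr (Suc i) \<cdot> Y))"
  proof -
    have "pr i \<cdot> (X \<oplus> F \<cdot> Y) = pr i \<cdot> X \<oplus> bond S i \<cdot> (pr (Suc i) \<cdot> Y)" for i
      using pr[of i] pr[of "Suc i"] S X Y FP Comp_reassoc[OF prF[of i], of Y] by simp
    then show ?thesis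
      by simp
  qed
  also have "\<dots> \<longleftrightarrow> solution S W (\<lambda>i. pr i \<cdot> X) (\<lambda>i. pr i \<cdot> Y)"
    using Comp_Hom[OF Y pr] unfolding solution_def by (simp del: hom_iff)
  finally show ?thesis .
qed

end

context exact_products
begin

text \<open>Uniqueness of solutions says that \<open>1 - F\<close> is monic, existence over all
  \<open>W\<close> that it has a right inverse. The vanishing cokernel by itself only makes
  \<open>1 - F\<close> epic; that a monic epimorphism has a section closes the gap.\<close>

theorem local_iff_uniquely_solvable: "S \<in> local_sequences C \<longleftrightarrow> uniquely_solvable S"
proof
  assume "S \<in> local_sequences C"
  then obtain Z where S: "is_inverse_sequence C S" and Z: "zero_object C Z"
    and lim: "is_lim C S Z" and lim1: "is_lim1 C S Z"
    unfolding local_sequences_def by blast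
  obtain P pr F k where F: "is_shift C S P pr F"
    and k: "is_kernel C (Minus C (Ident C P) F) k" "Dom C k = Z"
    using lim unfolding is_lim_def by blast
  obtain P' pr' F' c where F': "is_shift C S P' pr' F'"
    and c: "is_cokernel C (Minus C (Ident C P') F') c" "Cod C c = Z"
    using lim1 unfolding is_lim1_def by blast
  have P: "is_product C UNIV (ob S) P pr" and FP: "F \<in> Hom C P P"
    using F unfolding is_shift_def by blast+
  have P': "is_product C UNIV (ob S) P' pr'" and FP': "F' \<in> Hom C P' P'"
    using F' unfolding is_shift_def by blast+
  have ob: "P \<in> Obj C" "P' \<in> Obj C" "Z \<in> Obj C"
    using FP FP' Z unfolding zero_object_def by simp_all
  let ?D = "Minus C (Ident C P) F" and ?D' = "Minus C (Ident C P') F'"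
  have D: "?D \<in> Hom C P P" "?D' \<in> Hom C P' P'"
    using Minus_Hom[OF Ident_Hom[OF ob(1)] FP] Minus_Hom[OF Ident_Hom[OF ob(2)] FP'] by blast+
  have kP: "k \<in> Hom C Z P" and cP: "c \<in> Hom C P' Z"
    using k c D ob unfolding is_kernel_def is_cokernel_def by auto
  have D_mono: "is_mono C ?D"
  proof (rule monoI[OF D(1)])
    fix W g assume g: "g \<in> Hom C W P" "?D \<cdot> g = Zero C W P"
    then obtain u where u: "u \<in> Hom C W Z" "k \<cdot> u = g"
      using kernel_universal(2)[OF k(1) D(1) kP] by blast
    then have "u = Zero C W Z"
      using zero_object_Hom[OF Z] by blast
    then show "g = Zero C W P"
      using u kP by auto
  qed
  have pr: "pr i \<in> Hom C P (ob S i)" "pr' i \<in> Hom C P' (ob S i)" for i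
    using product_Hom[OF P] product_Hom[OF P'] by blast+
  \<comment> \<open>\<open>is_lim\<close> and \<open>is_lim1\<close> may use different products
    \<open>P\<close> and \<open>P'\<close>. Uniqueness of solutions mentions no product, so it
    carries monicity from \<open>?D\<close> over to \<open>?D'\<close>.\<close>
  have unique: "y = y'" if W: "W \<in> Obj C" and x: "\<And>i. x i \<in> Hom C W (ob S i)"
    and y: "solution S W x y" and y': "solution S W x y'" for W x y y'
  proof -
    have yi: "y i \<in> Hom C W (ob S i)" "y' i \<in> Hom C W (ob S i)" for i
      using y y' unfolding solution_def by blast+
    obtain X where X: "X \<in> Hom C W P" "\<And>i. pr i \<cdot> X = x i"
      using product_ex[OF P W x] by auto
    obtain Y where Y: "Y \<in> Hom C W P" "\<And>i. pr i \<cdot> Y = y i"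
      using product_ex[OF P W yi(1)] by auto
    obtain Y' where Y': "Y' \<in> Hom C W P" "\<And>i. pr i \<cdot> Y' = y' i"
      using product_ex[OF P W yi(2)] by auto
    have "?D \<cdot> Y = X" "?D \<cdot> Y' = X"
      using y y' shift_solution[OF S F X(1) Y(1)] shift_solution[OF S F X(1) Y'(1)] X(2) Y(2) Y'(2)
      by simp_all
    then have "Y = Y'"
      using mono_cancel[OF D_mono D(1) Y(1) Y'(1)] by simp
    then show ?thesis
      using Y(2) Y'(2) by auto
  qed
  have D'_mono: "is_mono C ?D'"
  proof (rule monoI[OF D(2)])
    fix W g assume g: "g \<in> Hom C W P'" "?D' \<cdot> g = Zero C W P'"
    have W: "W \<in> Obj C" and 0: "Zero C W P' \<in> Hom C W P'"
      using g ob by simp_all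
    have "(\<lambda>i. pr' i \<cdot> g) = (\<lambda>i. pr' i \<cdot> Zero C W P')"
    proof (rule unique[OF W Comp_Hom[OF 0 pr(2)]])
      show "solution S W (\<lambda>i. pr' i \<cdot> Zero C W P') (\<lambda>i. pr' i \<cdot> g)"
        using g shift_solution[OF S F' 0 g(1)] by blast
      show "solution S W (\<lambda>i. pr' i \<cdot> Zero C W P') (\<lambda>i. pr' i \<cdot> Zero C W P')"
        using W ob D(2) by (intro iffD1[OF shift_solution[OF S F' 0 0]]) simp
    qed
    then show "g = Zero C W P'"
      using product_eq[OF P' g(1) 0] by metis
  qed
  have D'_epi: "is_epi C ?D'"
  proof (rule epiI[OF D(2)])
    fix W g assume g: "g \<in> Hom C P' W" "g \<cdot> ?D' = Zero C P' W"
    then obtain u where u: "u \<in> Hom C Z W" "u \<cdot> c = g"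
      using cokernel_universal(2)[OF c(1) D(2) cP] by blast
    then have "u = Zero C Z W"
      using zero_object_Hom[OF Z] by blast
    then show "g = Zero C P' W"
      using u cP by auto
  qed
  obtain t where t: "t \<in> Hom C P' P'" "?D' \<cdot> t = Ident C P'"
    using mono_epi_section[OF D'_mono D'_epi D(2)] .
  show "uniquely_solvable S"
    unfolding uniquely_solvable_def
  proof (intro conjI allI impI S)
    fix W x assume "W \<in> Obj C \<and> (\<forall>i. x i \<in> Hom C W (ob S i))"
    then have W: "W \<in> Obj C" and x: "x i \<in> Hom C W (ob S i)" for i
      by blast+
    obtain X where X: "X \<in> Hom C W P'" "\<And>i. pr' i \<cdot> X = x i"
      using product_ex[OF P' W x] by auto
    have tX: "t \<cdot> X \<in> Hom C W P'"
      using X t by simp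
    have "?D' \<cdot> (t \<cdot> X) = X"
      using Comp_reassoc[OF t(2), of X] X t D(2) by simp
    then have "solution S W x (\<lambda>i. pr' i \<cdot> (t \<cdot> X))"
      using shift_solution[OF S F' X(1) tX] X(2) by simp
    then show "\<exists>!y. solution S W x y"
      using unique[OF W x] by blast
  qed
next
  assume us: "uniquely_solvable S"
  then have S: "is_inverse_sequence C S"
    unfolding uniquely_solvable_def by blast
  obtain P pr where P: "is_product C UNIV (ob S) P pr"
    by (rule product_small_ex[OF small_nat[OF inaccessible], of "ob S"]) (use S in auto)
  then have ob: "P \<in> Obj C" and pr: "pr i \<in> Hom C P (ob S i)" for i
    unfolding is_product_def by blast+
  have "bond S i \<cdot> pr (Suc i) \<in> Hom C P (ob S i)" for i
    using pr[of "Suc i"] S by simp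
  then obtain F where F: "F \<in> Hom C P P" "\<And>i. pr i \<cdot> F = bond S i \<cdot> pr (Suc i)"
    using product_ex[OF P ob, of "\<lambda>i. bond S i \<cdot> pr (Suc i)"] by auto
  have shift: "is_shift C S P pr F"
    unfolding is_shift_def using P F by blast
  let ?D = "Minus C (Ident C P) F"
  have D: "?D \<in> Hom C P P"
    using Minus_Hom[OF Ident_Hom[OF ob] F(1)] by blast
  obtain Z where Z: "zero_object C Z"
    using zero_object_ex by blast
  then have Z_ob: "Z \<in> Obj C"
    unfolding zero_object_def by blast
  have "is_kernel C ?D (Zero C Z P)"
    unfolding is_kernel_def
  proof (intro conjI allI ballI impI)
    fix W h assume "h \<in> Hom C W (Dom C ?D)" "?D \<cdot> h = Zero C W (Cod C ?D)"
    then have h: "h \<in> Hom C W P" "?D \<cdot> h = Zero C W P"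
      using D by auto
    have W: "W \<in> Obj C" and 0: "Zero C W P \<in> Hom C W P"
      using h ob by simp_all
    have "(\<lambda>i. pr i \<cdot> h) = (\<lambda>i. pr i \<cdot> Zero C W P)"
    proof (rule solution_unique[OF us W Comp_Hom[OF 0 pr]])
      show "solution S W (\<lambda>i. pr i \<cdot> Zero C W P) (\<lambda>i. pr i \<cdot> h)"
        using h shift_solution[OF S shift 0 h(1)] by blast
      show "solution S W (\<lambda>i. pr i \<cdot> Zero C W P) (\<lambda>i. pr i \<cdot> Zero C W P)"
        using W ob D by (intro iffD1[OF shift_solution[OF S shift 0 0]]) simp
    qed
    then have h0: "h = Zero C W P"
      using product_eq[OF P h(1) 0] by metis
    show "\<exists>!u. u \<in> Hom C W (Dom C (Zero C Z P)) \<and> Zero C Z P \<cdot> u = h"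
    proof (rule ex1I)
      show "Zero C W Z \<in> Hom C W (Dom C (Zero C Z P)) \<and> Zero C Z P \<cdot> Zero C W Z = h"
        using h0 W ob Z_ob by simp
      show "u = Zero C W Z" if "u \<in> Hom C W (Dom C (Zero C Z P)) \<and> Zero C Z P \<cdot> u = h" for u
        using zero_object_Hom(1)[OF Z, of u W] that ob Z_ob by simp
    qed
  qed (use D ob Z_ob in simp_all)
  then have lim: "is_lim C S Z"
    unfolding is_lim_def using shift ob Z_ob
    by (intro exI[of _ P] exI[of _ pr] exI[of _ F] exI[of _ "Zero C Z P"]) simp
  have "is_cokernel C ?D (Zero C P Z)"
    unfolding is_cokernel_def
  proof (intro conjI allI ballI impI)
    fix W h assume "h \<in> Hom C (Cod C ?D) W" "h \<cdot> ?D = Zero C (Dom C ?D) W"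
    then have h: "h \<in> Hom C P W" "h \<cdot> ?D = Zero C P W"
      using D by auto
    \<comment> \<open>The universal right-hand side: the projections are the coordinates of
      \<open>Ident C P\<close>, so the solution is a right inverse of \<open>?D\<close>, and
      whatever kills \<open>?D\<close> from the left is zero.\<close>
    obtain y where y: "solution S P pr y"
      using solution_ex[OF us ob pr] .
    then have yi: "y i \<in> Hom C P (ob S i)" for i
      unfolding solution_def by blast
    obtain Y where Y: "Y \<in> Hom C P P" "\<And>i. pr i \<cdot> Y = y i"
      using product_ex[OF P ob yi] by auto
    have "pr i \<cdot> Ident C P = pr i" for i
      using pr[of i] by simp
    then have "?D \<cdot> Y = Ident C P"
      using shift_solution[OF S shift Ident_Hom[OF ob] Y(1)] y Y(2) by simp
    then have "h = h \<cdot> (?D \<cdot> Y)"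
      using h by simp
    also have "\<dots> = Zero C P W"
      using Comp_reassoc[OF h(2), of Y] h(1) D Y(1) by simp
    finally have h0: "h = Zero C P W" .
    have W: "W \<in> Obj C"
      using h by simp
    show "\<exists>!u. u \<in> Hom C (Cod C (Zero C P Z)) W \<and> u \<cdot> Zero C P Z = h"
    proof (rule ex1I)
      show "Zero C Z W \<in> Hom C (Cod C (Zero C P Z)) W \<and> Zero C Z W \<cdot> Zero C P Z = h"
        using h0 W ob Z_ob by simp
      show "u = Zero C Z W" if "u \<in> Hom C (Cod C (Zero C P Z)) W \<and> u \<cdot> Zero C P Z = h" for u
        using zero_object_Hom(2)[OF Z, of u W] that ob Z_ob by simp
    qed
  qed (use D ob Z_ob in simp_all)
  then have lim1: "is_lim1 C S Z"
    unfolding is_lim1_def using shift ob Z_ob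
    by (intro exI[of _ P] exI[of _ pr] exI[of _ F] exI[of _ "Zero C P Z"]) simp
  show "S \<in> local_sequences C"
    unfolding local_sequences_def using S Z lim lim1 by blast
qed

end

section \<open>Limits of inverse sequences\<close>

context preadditive
begin

text \<open>A limit in \<open>Seq\<close> with the triples stripped off: \<open>\<delta>\<close> and
  \<open>\<pi>\<close> are the components of the diagram arrows and of the cone, and the universal
  property is split into existence and uniqueness.\<close>

lemma is_limit_SeqI:
  assumes "is_functor J Seq D D'"
    and D': "\<And>a. a \<in> Arr J \<Longrightarrow> D' a = (D (Dom J a), \<delta> a, D (Cod J a))"
    and J: "\<And>a. a \<in> Arr J \<Longrightarrow> Dom J a \<in> Obj J \<and> Cod J a \<in> Obj J"
    and L: "is_inverse_sequence C L"
    and \<pi>: "\<And>j. j \<in> Obj J \<Longrightarrow> seq_hom L (\<pi> j) (D j)"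
    and cone: "\<And>a i. a \<in> Arr J \<Longrightarrow> \<delta> a i \<cdot> \<pi> (Dom J a) i = \<pi> (Cod J a) i"
    and univ: "\<And>W q. is_inverse_sequence C W \<Longrightarrow> (\<And>j. j \<in> Obj J \<Longrightarrow> seq_hom W (q j) (D j)) \<Longrightarrow>
      (\<And>a i. a \<in> Arr J \<Longrightarrow> \<delta> a i \<cdot> q (Dom J a) i = q (Cod J a) i) \<Longrightarrow>
      \<exists>h. seq_hom W h L \<and> (\<forall>j \<in> Obj J. \<forall>i. \<pi> j i \<cdot> h i = q j i)"
    and uniq: "\<And>W h h'. seq_hom W h L \<Longrightarrow> seq_hom W h' L \<Longrightarrow>
      (\<And>j i. j \<in> Obj J \<Longrightarrow> \<pi> j i \<cdot> h i = \<pi> j i \<cdot> h' i) \<Longrightarrow> h = h'"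
  shows "is_limit J Seq D D' L (\<lambda>j. (L, \<pi> j, D j))"
  unfolding is_limit_def
proof (intro conjI allI impI)
  show "is_cone J Seq D D' L (\<lambda>j. (L, \<pi> j, D j))"
    unfolding is_cone_def Obj_Seq Hom_Seq using L \<pi> cone J by (auto simp: D' Seq_simps)
  fix W q assume "is_cone J Seq D D' W q"
  then have W: "is_inverse_sequence C W"
    and q: "\<And>j. j \<in> Obj J \<Longrightarrow> \<exists>\<phi>. q j = (W, \<phi>, D j) \<and> seq_hom W \<phi> (D j)"
    and q_cone: "\<And>a. a \<in> Arr J \<Longrightarrow> D' a \<cdot>\<^bsub>Seq\<^esub> q (Dom J a) = q (Cod J a)"
    unfolding is_cone_def Obj_Seq Hom_Seq by blast+
  obtain \<phi> where \<phi>: "\<And>j. j \<in> Obj J \<Longrightarrow> q j = (W, \<phi> j, D j)" "\<And>j. j \<in> Obj J \<Longrightarrow> seq_hom W (\<phi> j) (D j)"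
    using q by metis
  have "\<delta> a i \<cdot> \<phi> (Dom J a) i = \<phi> (Cod J a) i" if "a \<in> Arr J" for a i
    using q_cone[OF that] J[OF that] D'[OF that] by (auto simp: \<phi> Seq_simps dest: fun_cong)
  then obtain h where h: "seq_hom W h L" "\<forall>j \<in> Obj J. \<forall>i. \<pi> j i \<cdot> h i = \<phi> j i"
    using univ[OF W \<phi>(2)] by blast
  show "\<exists>!h. h \<in> Hom Seq W L \<and> (\<forall>j \<in> Obj J. (L, \<pi> j, D j) \<cdot>\<^bsub>Seq\<^esub> h = q j)"
  proof (rule ex1I[of _ "(W, h, L)"])
    show "(W, h, L) \<in> Hom Seq W L \<and> (\<forall>j \<in> Obj J. (L, \<pi> j, D j) \<cdot>\<^bsub>Seq\<^esub> (W, h, L) = q j)"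
      using h by (auto simp: Hom_Seq Seq_simps \<phi>)
    fix k assume k: "k \<in> Hom Seq W L \<and> (\<forall>j \<in> Obj J. (L, \<pi> j, D j) \<cdot>\<^bsub>Seq\<^esub> k = q j)"
    then obtain h' where h': "k = (W, h', L)" "seq_hom W h' L"
      unfolding Hom_Seq by blast
    have "h' = h"
    proof (rule uniq[OF h'(2) h(1)])
      fix j i assume "j \<in> Obj J"
      then show "\<pi> j i \<cdot> h' i = \<pi> j i \<cdot> h i"
        using k h(2) by (auto simp: h'(1) Seq_simps \<phi> dest: fun_cong)
    qed
    then show "k = (W, h, L)"
      using h'(1) by simp
  qed
qed

lemma is_limit_SeqD:
  assumes diagram: "is_functor J Seq D D'" and lim: "is_limit J Seq D D' L p"
    and D': "\<And>a. a \<in> Arr J \<Longrightarrow> D' a = (D (Dom J a), \<delta> a, D (Cod J a))"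
    and J: "\<And>a. a \<in> Arr J \<Longrightarrow> Dom J a \<in> Obj J \<and> Cod J a \<in> Obj J"
  obtains \<pi> where "is_inverse_sequence C L"
    "\<And>j. j \<in> Obj J \<Longrightarrow> seq_hom L (\<pi> j) (D j)"
    "\<And>a i. a \<in> Arr J \<Longrightarrow> \<delta> a i \<cdot> \<pi> (Dom J a) i = \<pi> (Cod J a) i"
    "\<And>W q. is_inverse_sequence C W \<Longrightarrow> (\<And>j. j \<in> Obj J \<Longrightarrow> seq_hom W (q j) (D j)) \<Longrightarrow>
      (\<And>a i. a \<in> Arr J \<Longrightarrow> \<delta> a i \<cdot> q (Dom J a) i = q (Cod J a) i) \<Longrightarrow>
      \<exists>h. seq_hom W h L \<and> (\<forall>j \<in> Obj J. \<forall>i. \<pi> j i \<cdot> h i = q j i)"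
    "\<And>W h h'. seq_hom W h L \<Longrightarrow> seq_hom W h' L \<Longrightarrow>
      (\<And>j i. j \<in> Obj J \<Longrightarrow> \<pi> j i \<cdot> h i = \<pi> j i \<cdot> h' i) \<Longrightarrow> h = h'"
proof -
  have "is_cone J Seq D D' L p"
    using lim unfolding is_limit_def by blast
  then have L: "is_inverse_sequence C L"
    and p: "\<And>j. j \<in> Obj J \<Longrightarrow> \<exists>\<phi>. p j = (L, \<phi>, D j) \<and> seq_hom L \<phi> (D j)"
    and p_cone: "\<And>a. a \<in> Arr J \<Longrightarrow> D' a \<cdot>\<^bsub>Seq\<^esub> p (Dom J a) = p (Cod J a)"
    unfolding is_cone_def Obj_Seq Hom_Seq by blast+
  obtain \<pi> where \<pi>: "\<And>j. j \<in> Obj J \<Longrightarrow> p j = (L, \<pi> j, D j)" "\<And>j. j \<in> Obj J \<Longrightarrow> seq_hom L (\<pi> j) (D j)"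
    using p by metis
  have cone: "\<delta> a i \<cdot> \<pi> (Dom J a) i = \<pi> (Cod J a) i" if "a \<in> Arr J" for a i
    using p_cone[OF that] J[OF that] D'[OF that] by (auto simp: \<pi> Seq_simps dest: fun_cong)
  have univ: "\<exists>!h. seq_hom W h L \<and> (\<forall>j \<in> Obj J. \<forall>i. \<pi> j i \<cdot> h i = q j i)"
    if W: "is_inverse_sequence C W" and q: "\<And>j. j \<in> Obj J \<Longrightarrow> seq_hom W (q j) (D j)"
      and qc: "\<And>a i. a \<in> Arr J \<Longrightarrow> \<delta> a i \<cdot> q (Dom J a) i = q (Cod J a) i" for W q
  proof -
    have "is_cone J Seq D D' W (\<lambda>j. (W, q j, D j))"
      unfolding is_cone_def Obj_Seq Hom_Seq using W q qc by (auto simp: D' Seq_simps)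
    then have ex1: "\<exists>!h. h \<in> Hom Seq W L \<and> (\<forall>j \<in> Obj J. p j \<cdot>\<^bsub>Seq\<^esub> h = (W, q j, D j))"
      using lim unfolding is_limit_def by blast
    have iff: "(W, h, L) \<in> Hom Seq W L \<and> (\<forall>j \<in> Obj J. p j \<cdot>\<^bsub>Seq\<^esub> (W, h, L) = (W, q j, D j)) \<longleftrightarrow>
        seq_hom W h L \<and> (\<forall>j \<in> Obj J. \<forall>i. \<pi> j i \<cdot> h i = q j i)" for h
      by (auto simp: Hom_Seq Seq_simps \<pi> dest: fun_cong)
    from ex1 obtain k where k: "k \<in> Hom Seq W L" "\<forall>j \<in> Obj J. p j \<cdot>\<^bsub>Seq\<^esub> k = (W, q j, D j)"
      by blast
    then obtain h where "k = (W, h, L)"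
      unfolding Hom_Seq by blast
    then have "seq_hom W h L \<and> (\<forall>j \<in> Obj J. \<forall>i. \<pi> j i \<cdot> h i = q j i)"
      using k iff[of h] by blast
    moreover have "h = h'" if "seq_hom W h L \<and> (\<forall>j \<in> Obj J. \<forall>i. \<pi> j i \<cdot> h i = q j i)"
      "seq_hom W h' L \<and> (\<forall>j \<in> Obj J. \<forall>i. \<pi> j i \<cdot> h' i = q j i)" for h h'
    proof -
      have "(W, h, L) = (W, h', L)"
        using ex1 that unfolding iff[symmetric] by blast
      then show ?thesis
        by simp
    qed
    ultimately show ?thesis
      by blast
  qed
  show thesis
  proof (rule that[OF L \<pi>(2) cone])
    show "\<exists>h. seq_hom W h L \<and> (\<forall>j \<in> Obj J. \<forall>i. \<pi> j i \<cdot> h i = q j i)"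
      if "is_inverse_sequence C W" "\<And>j. j \<in> Obj J \<Longrightarrow> seq_hom W (q j) (D j)"
        "\<And>a i. a \<in> Arr J \<Longrightarrow> \<delta> a i \<cdot> q (Dom J a) i = q (Cod J a) i" for W q
      using univ[of W q] that by blast
    show "h = h'"
      if h: "seq_hom W h L" "seq_hom W h' L"
        and eq: "\<And>j i. j \<in> Obj J \<Longrightarrow> \<pi> j i \<cdot> h i = \<pi> j i \<cdot> h' i" for W h h'
    proof -
      have "\<exists>!k. seq_hom W k L \<and> (\<forall>j \<in> Obj J. \<forall>i. \<pi> j i \<cdot> k i = \<pi> j i \<cdot> h i)"
      proof (rule univ)
        show "is_inverse_sequence C W"
          using h(1) by (rule seq_homD)
        show "seq_hom W (\<lambda>i. \<pi> j i \<cdot> h i) (D j)" if "j \<in> Obj J" for j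
          using h(1) \<pi>(2)[OF that] by (rule seq_hom_Comp)
        fix a i assume a: "a \<in> Arr J"
        have "seq_hom (D (Dom J a)) (\<delta> a) (D (Cod J a))"
          using diagram a unfolding is_functor_def Hom_Seq by (auto simp: D')
        then show "\<delta> a i \<cdot> (\<pi> (Dom J a) i \<cdot> h i) = \<pi> (Cod J a) i \<cdot> h i"
          using cone[OF a, of i] seq_homD(3)[OF h(1), of i] seq_homD(3)[OF \<pi>(2), of "Dom J a" i]
            J[OF a] seq_homD(3)[of "D (Dom J a)" "\<delta> a" "D (Cod J a)" i]
          by (intro Comp_reassoc) auto
      qed
      then show ?thesis
        using h eq by (metis (no_types, lifting))
    qed
  qed
qed

end

section \<open>Local sequences form a closed class\<close>

context abelian
begin

text \<open>
  The sequence \<open>W \<oplus> L\<^sub>i\<close> with the twisted bonding maps \<open>(w, l) \<mapsto> (w, f\<^sub>i l - x\<^sub>i w)\<close>: its morphisms to \<open>T\<close>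
  that extend \<open>\<phi> : L \<rightarrow> T\<close> are the solutions \<open>y\<close> of \<open>(1 - F) y = \<phi> x\<close> in \<open>T\<close>.
\<close>

lemma twisted_sum:
  assumes L: "is_inverse_sequence C L" and W: "W \<in> Obj C"
    and x: "\<And>i. x i \<in> Hom C W (ob L i)"
  obtains Y s t where "is_inverse_sequence C Y" "\<And>i. s i \<in> Hom C W (ob Y i)" "seq_hom L t Y"
    "\<And>i. s i = bond Y i \<cdot> s (Suc i) \<oplus> t i \<cdot> x i"
    "\<And>T \<phi> y. seq_hom L \<phi> T \<Longrightarrow> solution T W (\<lambda>i. \<phi> i \<cdot> x i) y \<Longrightarrow>
      \<exists>\<theta>. seq_hom Y \<theta> T \<and> (\<forall>i. \<theta> i \<cdot> s i = y i) \<and> (\<forall>i. \<theta> i \<cdot> t i = \<phi> i)"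
    "\<And>T \<theta> \<theta>' i. \<theta> \<in> Hom C (ob Y i) T \<Longrightarrow> \<theta>' \<in> Hom C (ob Y i) T \<Longrightarrow>
      \<theta> \<cdot> s i = \<theta>' \<cdot> s i \<Longrightarrow> \<theta> \<cdot> t i = \<theta>' \<cdot> t i \<Longrightarrow> \<theta> = \<theta>'"
proof -
  have "\<exists>P p q s t. p \<in> Hom C P W \<and> q \<in> Hom C P (ob L i) \<and> s \<in> Hom C W P \<and> t \<in> Hom C (ob L i) P \<and>
    p \<cdot> s = Ident C W \<and> q \<cdot> t = Ident C (ob L i) \<and>
    q \<cdot> s = Zero C W (ob L i) \<and> p \<cdot> t = Zero C (ob L i) W \<and> s \<cdot> p \<oplus> t \<cdot> q = Ident C P" for i
    by (rule biproduct_ex[OF W inverse_sequenceD(1)[OF L]]) blast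
  then obtain P p q s t where p: "\<And>i. p i \<in> Hom C (P i) W" and q: "\<And>i. q i \<in> Hom C (P i) (ob L i)"
    and s: "\<And>i. s i \<in> Hom C W (P i)" and t: "\<And>i. t i \<in> Hom C (ob L i) (P i)"
    and ps: "\<And>i. p i \<cdot> s i = Ident C W" and qt: "\<And>i. q i \<cdot> t i = Ident C (ob L i)"
    and qs: "\<And>i. q i \<cdot> s i = Zero C W (ob L i)" and pt: "\<And>i. p i \<cdot> t i = Zero C (ob L i) W"
    and sum: "\<And>i. s i \<cdot> p i \<oplus> t i \<cdot> q i = Ident C (P i)"
    by metis
  have "\<exists>z. z \<in> Hom C W (ob L i) \<and> x i \<oplus> z = Zero C W (ob L i)" for i
    using negative[OF x] by blast
  then obtain x' where x': "\<And>i. x' i \<in> Hom C W (ob L i)" "\<And>i. x i \<oplus> x' i = Zero C W (ob L i)"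
    by metis
  \<comment> \<open>The matrix of the twisted bonding map: the identity on \<open>W\<close>,
    \<open>bond L\<close> on \<open>L\<close>, and \<open>x'\<close>, the negative of
    \<open>x\<close>, from \<open>W\<close> to \<open>L\<close>.\<close>
  define Y where "Y = \<lparr>ob = P, bond = \<lambda>i. s i \<cdot> p (Suc i) \<oplus>
    (t i \<cdot> (bond L i \<cdot> q (Suc i)) \<oplus> t i \<cdot> (x' i \<cdot> p (Suc i)))\<rparr>"
  note [simp] = p[simplified] q[simplified] s[simplified] t[simplified] x[simplified]
    x'(1)[simplified]
  note reassoc = Comp_reassoc[OF ps] Comp_reassoc[OF qt] Comp_reassoc[OF qs] Comp_reassoc[OF pt]
  have Y: "is_inverse_sequence C Y"
    unfolding is_inverse_sequence_def Y_def using L by simp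
  have bond_t: "t i \<cdot> bond L i = bond Y i \<cdot> t (Suc i)" for i
    using L by (simp add: Y_def qt pt)
  have bond_s: "bond Y i \<cdot> s (Suc i) = s i \<oplus> t i \<cdot> x' i" for i
    using L by (simp add: Y_def qs ps)
  have ext: "\<theta> = \<theta>'" if \<theta>: "\<theta> \<in> Hom C (ob Y i) T" "\<theta>' \<in> Hom C (ob Y i) T"
    and eq: "\<theta> \<cdot> s i = \<theta>' \<cdot> s i" "\<theta> \<cdot> t i = \<theta>' \<cdot> t i" for T \<theta> \<theta>' i
  proof -
    have expand: "\<theta> = (\<theta> \<cdot> s i) \<cdot> p i \<oplus> (\<theta> \<cdot> t i) \<cdot> q i" if "\<theta> \<in> Hom C (P i) T" for \<theta>
    proof -
      have "\<theta> = \<theta> \<cdot> (s i \<cdot> p i \<oplus> t i \<cdot> q i)"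
        unfolding sum using that by simp
      also have "\<dots> = (\<theta> \<cdot> s i) \<cdot> p i \<oplus> (\<theta> \<cdot> t i) \<cdot> q i"
        using that by simp
      finally show ?thesis .
    qed
    have "\<theta> \<in> Hom C (P i) T" "\<theta>' \<in> Hom C (P i) T"
      using \<theta> by (simp_all add: Y_def)
    then show ?thesis
      using expand eq by metis
  qed
  show thesis
  proof (rule that[OF Y])
    show "s i \<in> Hom C W (ob Y i)" for i
      using W by (simp add: Y_def)
    show "seq_hom L t Y"
      unfolding seq_hom_def using L Y bond_t by (simp add: Y_def)
    show "s i = bond Y i \<cdot> s (Suc i) \<oplus> t i \<cdot> x i" for i
    proof -
      have "t i \<cdot> (x i \<oplus> x' i) = Zero C W (P i)"
        unfolding x'(2) using L W by simp
      then have "t i \<cdot> x' i \<oplus> t i \<cdot> x i = Zero C W (P i)"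
        using Add_commute[of "t i \<cdot> x i" "t i \<cdot> x' i"] by simp
      then show ?thesis
        unfolding bond_s using W by simp
    qed
    fix T \<phi> y assume \<phi>: "seq_hom L \<phi> T" and y: "solution T W (\<lambda>i. \<phi> i \<cdot> x i) y"
    note \<phi>D = seq_homD[OF \<phi>]
    have yi: "y i \<in> Hom C W (ob T i)" "y i = \<phi> i \<cdot> x i \<oplus> bond T i \<cdot> y (Suc i)" for i
      using y unfolding solution_def by blast+
    note [simp] = \<phi>D(3)[simplified] yi(1)[simplified]
    define \<theta> where "\<theta> = (\<lambda>i. y i \<cdot> p i \<oplus> \<phi> i \<cdot> q i)"
    have \<theta>s: "\<theta> i \<cdot> s i = y i" and \<theta>t: "\<theta> i \<cdot> t i = \<phi> i" for i
      by (simp_all add: \<theta>_def ps qt qs pt)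
    have "seq_hom Y \<theta> T"
      unfolding seq_hom_def
    proof (intro conjI allI Y \<phi>D(2))
      fix i
      show \<theta>_Hom: "\<theta> i \<in> Hom C (ob Y i) (ob T i)" for i
        using \<phi>D(2) by (simp add: \<theta>_def Y_def)
      show "\<theta> i \<cdot> bond Y i = bond T i \<cdot> \<theta> (Suc i)"
      proof (rule ext[of _ "Suc i" "ob T i"])
        show "\<theta> i \<cdot> bond Y i \<in> Hom C (ob Y (Suc i)) (ob T i)"
          "bond T i \<cdot> \<theta> (Suc i) \<in> Hom C (ob Y (Suc i)) (ob T i)"
          using \<theta>_Hom[of i] \<theta>_Hom[of "Suc i"] Y \<phi>D(2) by simp_all
        have Yob: "ob Y i = P i" for i
          by (simp add: Y_def)
        \<comment> \<open>On the summand \<open>W\<close>, compatibility of \<open>\<theta>\<close>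
          with the bonding maps is the solution equation for \<open>y\<close> with the right-hand
          side moved across.\<close>
        have "(\<theta> i \<cdot> bond Y i) \<cdot> s (Suc i) = \<theta> i \<cdot> (s i \<oplus> t i \<cdot> x' i)"
          using \<theta>_Hom[of i] Y by (simp add: Yob flip: bond_s)
        also have "\<dots> = y i \<oplus> \<phi> i \<cdot> x' i"
          using \<theta>_Hom[of i] by (simp add: Yob \<theta>s Comp_reassoc[OF \<theta>t])
        also have "\<dots> = (\<phi> i \<cdot> x i \<oplus> bond T i \<cdot> y (Suc i)) \<oplus> \<phi> i \<cdot> x' i"
          using yi(2)[of i] by (rule arg_cong)
        also have "\<dots> = bond T i \<cdot> y (Suc i) \<oplus> \<phi> i \<cdot> (x i \<oplus> x' i)"
          using \<phi>D(2) Add_left_commute[of "\<phi> i \<cdot> x i" "bond T i \<cdot> y (Suc i)" "\<phi> i \<cdot> x' i"] by simp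
        also have "\<dots> = bond T i \<cdot> y (Suc i)"
          unfolding x'(2) using \<phi>D(2) L W by simp
        also have "\<dots> = (bond T i \<cdot> \<theta> (Suc i)) \<cdot> s (Suc i)"
          using \<theta>_Hom[of "Suc i"] \<phi>D(2) by (simp add: Yob \<theta>s)
        finally show "(\<theta> i \<cdot> bond Y i) \<cdot> s (Suc i) = (bond T i \<cdot> \<theta> (Suc i)) \<cdot> s (Suc i)" .
        have "(\<theta> i \<cdot> bond Y i) \<cdot> t (Suc i) = \<theta> i \<cdot> (t i \<cdot> bond L i)"
          unfolding bond_t using \<theta>_Hom[of i] Y by (simp add: Yob)
        also have "\<dots> = \<phi> i \<cdot> bond L i"
          using \<theta>_Hom[of i] L by (simp add: Yob Comp_reassoc[OF \<theta>t])
        also have "\<dots> = (bond T i \<cdot> \<theta> (Suc i)) \<cdot> t (Suc i)"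
          unfolding \<phi>D(4) using \<theta>_Hom[of "Suc i"] \<phi>D(2) by (simp add: Yob \<theta>t)
        finally show "(\<theta> i \<cdot> bond Y i) \<cdot> t (Suc i) = (bond T i \<cdot> \<theta> (Suc i)) \<cdot> t (Suc i)" .
      qed
    qed
    then show "\<exists>\<theta>. seq_hom Y \<theta> T \<and> (\<forall>i. \<theta> i \<cdot> s i = y i) \<and> (\<forall>i. \<theta> i \<cdot> t i = \<phi> i)"
      using \<theta>s \<theta>t by blast
  qed (fact ext)
qed

text \<open>Only the universal property of \<open>L\<close> among sequences is used, so solutions
  are encoded as morphisms out of the twisted sum \<open>Y\<close>. Solutions in the
  \<open>D j\<close> give maps from \<open>Y\<close> to \<open>D j\<close>, unique solvability makes
  them a cone, and the induced \<open>h\<close> carries the generic solution \<open>s\<close> to a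
  solution in \<open>L\<close>.\<close>

lemma uniquely_solvable_limit:
  assumes J: "is_category J" and D: "is_functor J Seq D D'" and lim: "is_limit J Seq D D' L p"
    and us: "\<And>j. j \<in> Obj J \<Longrightarrow> uniquely_solvable (D j)"
  shows "uniquely_solvable L"
proof -
  have J_ob: "Dom J a \<in> Obj J \<and> Cod J a \<in> Obj J" if "a \<in> Arr J" for a
    using J that unfolding is_category_def by blast
  have "\<exists>\<phi>. D' a = (D (Dom J a), \<phi>, D (Cod J a)) \<and> seq_hom (D (Dom J a)) \<phi> (D (Cod J a))"
    if "a \<in> Arr J" for a
    using D that unfolding is_functor_def Hom_Seq by blast
  then obtain \<delta> where D': "\<And>a. a \<in> Arr J \<Longrightarrow> D' a = (D (Dom J a), \<delta> a, D (Cod J a))"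
    and \<delta>: "\<And>a. a \<in> Arr J \<Longrightarrow> seq_hom (D (Dom J a)) (\<delta> a) (D (Cod J a))"
    by metis
  show ?thesis
  proof (rule is_limit_SeqD[OF D lim D' J_ob])
    fix \<pi>
    assume L: "is_inverse_sequence C L"
      and \<pi>: "\<And>j. j \<in> Obj J \<Longrightarrow> seq_hom L (\<pi> j) (D j)"
      and cone: "\<And>a i. a \<in> Arr J \<Longrightarrow> \<delta> a i \<cdot> \<pi> (Dom J a) i = \<pi> (Cod J a) i"
      and univ: "\<And>W q. is_inverse_sequence C W \<Longrightarrow> (\<And>j. j \<in> Obj J \<Longrightarrow> seq_hom W (q j) (D j)) \<Longrightarrow>
        (\<And>a i. a \<in> Arr J \<Longrightarrow> \<delta> a i \<cdot> q (Dom J a) i = q (Cod J a) i) \<Longrightarrow>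
        \<exists>h. seq_hom W h L \<and> (\<forall>j \<in> Obj J. \<forall>i. \<pi> j i \<cdot> h i = q j i)"
      and uniq: "\<And>W h h'. seq_hom W h L \<Longrightarrow> seq_hom W h' L \<Longrightarrow>
        (\<And>j i. j \<in> Obj J \<Longrightarrow> \<pi> j i \<cdot> h i = \<pi> j i \<cdot> h' i) \<Longrightarrow> h = h'"
    show ?thesis
      unfolding uniquely_solvable_def
    proof (intro conjI allI impI L)
      fix W x assume "W \<in> Obj C \<and> (\<forall>i. x i \<in> Hom C W (ob L i))"
      then have W: "W \<in> Obj C" and x: "x i \<in> Hom C W (ob L i)" for i
        by blast+
      obtain Y s t where Y: "is_inverse_sequence C Y" and s: "\<And>i. s i \<in> Hom C W (ob Y i)"
        and t: "seq_hom L t Y" and bond_s: "\<And>i. s i = bond Y i \<cdot> s (Suc i) \<oplus> t i \<cdot> x i"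
        and extend: "\<And>T \<phi> y. seq_hom L \<phi> T \<Longrightarrow> solution T W (\<lambda>i. \<phi> i \<cdot> x i) y \<Longrightarrow>
          \<exists>\<theta>. seq_hom Y \<theta> T \<and> (\<forall>i. \<theta> i \<cdot> s i = y i) \<and> (\<forall>i. \<theta> i \<cdot> t i = \<phi> i)"
        and ext: "\<And>T \<theta> \<theta>' i. \<theta> \<in> Hom C (ob Y i) T \<Longrightarrow> \<theta>' \<in> Hom C (ob Y i) T \<Longrightarrow>
          \<theta> \<cdot> s i = \<theta>' \<cdot> s i \<Longrightarrow> \<theta> \<cdot> t i = \<theta>' \<cdot> t i \<Longrightarrow> \<theta> = \<theta>'"
        by (rule twisted_sum[OF L W x]) blast
      note tD = seq_homD[OF t]
      have \<pi>x: "\<pi> j i \<cdot> x i \<in> Hom C W (ob (D j) i)" if "j \<in> Obj J" for i j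
        using x seq_homD(3)[OF \<pi>[OF that]] by (rule Comp_Hom)
      have "\<exists>y. solution (D j) W (\<lambda>i. \<pi> j i \<cdot> x i) y" if "j \<in> Obj J" for j
        using solution_ex[OF us[OF that] W \<pi>x[OF that]] by blast
      then obtain y where y: "\<And>j. j \<in> Obj J \<Longrightarrow> solution (D j) W (\<lambda>i. \<pi> j i \<cdot> x i) (y j)"
        by metis
      have "\<exists>\<theta>. seq_hom Y \<theta> (D j) \<and> (\<forall>i. \<theta> i \<cdot> s i = y j i) \<and> (\<forall>i. \<theta> i \<cdot> t i = \<pi> j i)"
        if "j \<in> Obj J" for j
        using extend[OF \<pi>[OF that] y[OF that]] .
      then obtain \<theta> where \<theta>: "\<And>j. j \<in> Obj J \<Longrightarrow> seq_hom Y (\<theta> j) (D j)"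
        and \<theta>s: "\<And>j i. j \<in> Obj J \<Longrightarrow> \<theta> j i \<cdot> s i = y j i"
        and \<theta>t: "\<And>j i. j \<in> Obj J \<Longrightarrow> \<theta> j i \<cdot> t i = \<pi> j i"
        by metis
      have "\<delta> a i \<cdot> \<theta> (Dom J a) i = \<theta> (Cod J a) i" if a: "a \<in> Arr J" for a i
      proof (rule ext[of _ i "ob (D (Cod J a)) i"])
        let ?d = "Dom J a" and ?c = "Cod J a"
        have ob: "?d \<in> Obj J" "?c \<in> Obj J"
          using J_ob[OF a] by blast+
        have H: "\<delta> a i \<in> Hom C (ob (D ?d) i) (ob (D ?c) i)"
          "\<theta> ?d i \<in> Hom C (ob Y i) (ob (D ?d) i)"
          using seq_homD(3)[OF \<delta>[OF a]] seq_homD(3)[OF \<theta>[OF ob(1)]] by blast+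
        show "\<delta> a i \<cdot> \<theta> ?d i \<in> Hom C (ob Y i) (ob (D ?c) i)"
          using H(2,1) by (rule Comp_Hom)
        show "\<theta> ?c i \<in> Hom C (ob Y i) (ob (D ?c) i)"
          using seq_homD(3)[OF \<theta>[OF ob(2)]] .
        have "\<delta> a i \<cdot> (\<pi> ?d i \<cdot> x i) = \<pi> ?c i \<cdot> x i" for i
          using x[of i] seq_homD(3)[OF \<pi>[OF ob(1)], of i] seq_homD(3)[OF \<delta>[OF a], of i]
          by (intro Comp_reassoc[OF cone[OF a]]) simp_all
        then have "solution (D ?c) W (\<lambda>i. \<pi> ?c i \<cdot> x i) (\<lambda>i. \<delta> a i \<cdot> y ?d i)"
          using solution_seq_hom[OF \<delta>[OF a] \<pi>x[OF ob(1)] y[OF ob(1)]] by (simp only:)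
        then have "(\<lambda>i. \<delta> a i \<cdot> y ?d i) = y ?c"
          using solution_unique[OF us[OF ob(2)] W \<pi>x[OF ob(2)]] y[OF ob(2)] by blast
        then have "\<delta> a i \<cdot> y ?d i = y ?c i"
          by (rule fun_cong)
        then show "(\<delta> a i \<cdot> \<theta> ?d i) \<cdot> s i = \<theta> ?c i \<cdot> s i"
          using H s[of i] by (simp add: \<theta>s ob)
        show "(\<delta> a i \<cdot> \<theta> ?d i) \<cdot> t i = \<theta> ?c i \<cdot> t i"
          using H tD(3)[of i] cone[OF a, of i] by (simp add: \<theta>t ob)
      qed
      then obtain h where h: "seq_hom Y h L" "\<And>j i. j \<in> Obj J \<Longrightarrow> \<pi> j i \<cdot> h i = \<theta> j i"
        using univ[OF Y \<theta>] by blast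
      note hD = seq_homD[OF h(1)]
      \<comment> \<open>\<open>h\<close> is built from the cone alone. That it restricts to the
        identity along \<open>t\<close>, and so carries \<open>t \<cdot> x\<close> to
        \<open>x\<close>, follows from uniqueness for the limit \<open>L\<close>.\<close>
      have "(\<lambda>i. h i \<cdot> t i) = (\<lambda>i. Ident C (ob L i))"
      proof (rule uniq[OF seq_hom_Comp[OF t h(1)] seq_hom_Ident[OF L]])
        fix j i assume j: "j \<in> Obj J"
        have "\<pi> j i \<cdot> (h i \<cdot> t i) = \<theta> j i \<cdot> t i"
          using tD(3)[of i] hD(3)[of i] seq_homD(3)[OF \<pi>[OF j], of i]
          by (intro Comp_reassoc[OF h(2)[OF j]]) simp_all
        then show "\<pi> j i \<cdot> (h i \<cdot> t i) = \<pi> j i \<cdot> Ident C (ob L i)"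
          using \<theta>t[OF j] seq_homD(3)[OF \<pi>[OF j], of i] by simp
      qed
      then have ht: "h i \<cdot> t i = Ident C (ob L i)" for i
        by (rule fun_cong)
      have "solution L W x (\<lambda>i. h i \<cdot> s i)"
        unfolding solution_def
      proof (intro conjI allI)
        fix i
        show "h i \<cdot> s i \<in> Hom C W (ob L i)"
          using s hD(3) by (rule Comp_Hom)
        have "h i \<cdot> s i = h i \<cdot> (bond Y i \<cdot> s (Suc i) \<oplus> t i \<cdot> x i)"
          using bond_s[of i] by (rule arg_cong)
        also have "\<dots> = (h i \<cdot> bond Y i) \<cdot> s (Suc i) \<oplus> x i"
          using hD(3)[of i] Y s[of "Suc i"] tD(3)[of i] x[of i] Comp_reassoc[OF ht[of i], of "x i"] by simp
        also have "\<dots> = x i \<oplus> bond L i \<cdot> (h (Suc i) \<cdot> s (Suc i))"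
          unfolding hD(4) using hD(3)[of "Suc i"] L s[of "Suc i"] x[of i]
          by (simp add: Add_commute[of "x i"])
        finally show "h i \<cdot> s i = x i \<oplus> bond L i \<cdot> (h (Suc i) \<cdot> s (Suc i))" .
      qed
      \<comment> \<open>Two solutions extend the identity of \<open>L\<close> to two maps from
        \<open>Y\<close> to \<open>L\<close>. These agree after every projection, where both encode
        the unique solution in \<open>D j\<close>.\<close>
      moreover have "z = z'" if z: "solution L W x z" "solution L W x z'" for z z'
      proof -
        have "Ident C (ob L i) \<cdot> x i = x i" for i
          using x[of i] by simp
        then have *: "\<exists>\<theta>. seq_hom Y \<theta> L \<and> (\<forall>i. \<theta> i \<cdot> s i = z i) \<and> (\<forall>i. \<theta> i \<cdot> t i = Ident C (ob L i))"
          if "solution L W x z" for z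
          using extend[OF seq_hom_Ident[OF L], of z] that by simp
        obtain \<zeta> where \<zeta>: "seq_hom Y \<zeta> L" "\<And>i. \<zeta> i \<cdot> s i = z i" "\<And>i. \<zeta> i \<cdot> t i = Ident C (ob L i)"
          using *[OF z(1)] by blast
        obtain \<zeta>' where \<zeta>': "seq_hom Y \<zeta>' L" "\<And>i. \<zeta>' i \<cdot> s i = z' i" "\<And>i. \<zeta>' i \<cdot> t i = Ident C (ob L i)"
          using *[OF z(2)] by blast
        have "\<zeta> = \<zeta>'"
        proof (rule uniq[OF \<zeta>(1) \<zeta>'(1)])
          fix j i assume j: "j \<in> Obj J"
          note H = seq_homD(3)[OF \<pi>[OF j], of i] seq_homD(3)[OF \<zeta>(1), of i] seq_homD(3)[OF \<zeta>'(1), of i]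
          have "(\<lambda>i. \<pi> j i \<cdot> z i) = (\<lambda>i. \<pi> j i \<cdot> z' i)"
            using solution_unique[OF us[OF j] W \<pi>x[OF j]] solution_seq_hom[OF \<pi>[OF j] x] z by blast
          then have eq: "\<pi> j i \<cdot> z i = \<pi> j i \<cdot> z' i"
            by (rule fun_cong)
          show "\<pi> j i \<cdot> \<zeta> i = \<pi> j i \<cdot> \<zeta>' i"
          proof (rule ext[of _ i "ob (D j) i"])
            show "\<pi> j i \<cdot> \<zeta> i \<in> Hom C (ob Y i) (ob (D j) i)" "\<pi> j i \<cdot> \<zeta>' i \<in> Hom C (ob Y i) (ob (D j) i)"
              using H by simp_all
            show "(\<pi> j i \<cdot> \<zeta> i) \<cdot> s i = (\<pi> j i \<cdot> \<zeta>' i) \<cdot> s i"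
              using H s[of i] eq \<zeta>(2) \<zeta>'(2) by simp
            show "(\<pi> j i \<cdot> \<zeta> i) \<cdot> t i = (\<pi> j i \<cdot> \<zeta>' i) \<cdot> t i"
              using H tD(3)[of i] \<zeta>(3) \<zeta>'(3) by simp
          qed
        qed
        then show ?thesis
          using \<zeta>(2) \<zeta>'(2) by auto
      qed
      ultimately show "\<exists>!y. solution L W x y"
        by blast
    qed
  qed
qed

end

section \<open>The zero sequence and null-extensions of local sequences\<close>

context preadditive
begin

text \<open>Identity and zero agree in every degree, so all maps into \<open>ob Z i\<close> vanish
  and the zero family is the only candidate.\<close>

lemma uniquely_solvable_zero:
  assumes Z: "zero_object Seq Z"
  shows "uniquely_solvable Z"
proof -
  have inv: "is_inverse_sequence C Z"
    using Z unfolding zero_object_def Obj_Seq by blast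
  have "\<exists>!f. f \<in> Hom Seq Z Z"
    using Z unfolding zero_object_def by blast
  moreover have "Ident Seq Z \<in> Hom Seq Z Z" "Zero Seq Z Z \<in> Hom Seq Z Z"
    using seq_hom_Ident[OF inv] seq_hom_Zero[OF inv inv] by (simp_all add: Hom_Seq Seq_simps)
  ultimately have "Ident Seq Z = Zero Seq Z Z"
    by blast
  then have id: "Ident C (ob Z i) = Zero C (ob Z i) (ob Z i)" for i
    by (simp add: Seq_simps fun_eq_iff)
  have zero: "f = Zero C W (ob Z i)" if f: "f \<in> Hom C W (ob Z i)" for f W i
  proof -
    have "f = Ident C (ob Z i) \<cdot> f"
      using f by simp
    then show ?thesis
      unfolding id using f by simp
  qed
  show ?thesis
    unfolding uniquely_solvable_def
  proof (intro conjI allI impI inv)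
    fix W x assume Wx: "W \<in> Obj C \<and> (\<forall>i. x i \<in> Hom C W (ob Z i))"
    then have W: "W \<in> Obj C"
      by blast
    have x: "x i = Zero C W (ob Z i)" for i
      using Wx zero by blast
    show "\<exists>!y. solution Z W x y"
    proof (rule ex1I)
      show "solution Z W x (\<lambda>i. Zero C W (ob Z i))"
        unfolding solution_def x using W inv by simp
      show "y = (\<lambda>i. Zero C W (ob Z i))" if "solution Z W x y" for y
        using that zero unfolding solution_def by blast
    qed
  qed
qed

text \<open>A cokernel in \<open>Seq\<close> yields only maps that preserve the degree, while
  bonding maps lower it by one. Moving \<open>S\<close> up by one place turns its bonding maps into
  a morphism, \<open>delay_map\<close>. The entry \<open>Z\<close> in degree 0 is padding, entered
  by zero maps.\<close>

definition delay where
  "delay Z S = \<lparr>ob = (\<lambda>i. case i of 0 \<Rightarrow> Z | Suc n \<Rightarrow> ob S n),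
    bond = (\<lambda>i. case i of 0 \<Rightarrow> Zero C (ob S 0) Z | Suc n \<Rightarrow> bond S n)\<rparr>"

definition delay_map where
  "delay_map Z S = (\<lambda>i. case i of 0 \<Rightarrow> Zero C (ob S 0) Z | Suc n \<Rightarrow> bond S n)"

lemma inverse_sequence_delay:
  assumes "Z \<in> Obj C" "is_inverse_sequence C S"
  shows "is_inverse_sequence C (delay Z S)"
  unfolding is_inverse_sequence_def
proof
  fix i show "ob (delay Z S) i \<in> Obj C \<and>
      bond (delay Z S) i \<in> Hom C (ob (delay Z S) (Suc i)) (ob (delay Z S) i)"
    using assms by (cases i) (simp_all add: delay_def)
qed

lemma seq_hom_delay_map:
  assumes "Z \<in> Obj C" "is_inverse_sequence C S"
  shows "seq_hom S (delay_map Z S) (delay Z S)"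
  unfolding seq_hom_def
proof (intro conjI allI assms inverse_sequence_delay)
  fix i
  show "delay_map Z S i \<in> Hom C (ob S i) (ob (delay Z S) i)"
    "delay_map Z S i \<cdot> bond S i = bond (delay Z S) i \<cdot> delay_map Z S (Suc i)"
    using assms by (cases i; simp add: delay_def delay_map_def)+
qed

lemma seq_hom_delay:
  assumes "Z \<in> Obj C" "seq_hom S \<phi> T"
  shows "seq_hom (delay Z S) (\<lambda>i. case i of 0 \<Rightarrow> Zero C Z Z | Suc n \<Rightarrow> \<phi> n) (delay Z T)"
  unfolding seq_hom_def
proof (intro conjI allI assms inverse_sequence_delay)
  note \<phi> = seq_homD[OF assms(2)]
  show "is_inverse_sequence C S" "is_inverse_sequence C T"
    using \<phi> by blast+
  fix i
  show "(case i of 0 \<Rightarrow> Zero C Z Z | Suc n \<Rightarrow> \<phi> n) \<in> Hom C (ob (delay Z S) i) (ob (delay Z T) i)"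
    using assms(1) \<phi> by (cases i) (simp_all add: delay_def)
  show "(case i of 0 \<Rightarrow> Zero C Z Z | Suc n \<Rightarrow> \<phi> n) \<cdot> bond (delay Z S) i =
      bond (delay Z T) i \<cdot> (case Suc i of 0 \<Rightarrow> Zero C Z Z | Suc n \<Rightarrow> \<phi> n)"
    using assms(1) \<phi> by (cases i) (simp_all add: delay_def)
qed

lemma seq_cokernelD:
  assumes c: "is_cokernel Seq (N, \<alpha>, S') (S', \<beta>, S)"
    and \<alpha>: "seq_hom N \<alpha> S'" and \<beta>: "seq_hom S' \<beta> S"
  shows "\<And>h W. seq_hom S' h W \<Longrightarrow> (\<And>i. h i \<cdot> \<alpha> i = Zero C (ob N i) (ob W i)) \<Longrightarrow>
      \<exists>u. seq_hom S u W \<and> (\<forall>i. u i \<cdot> \<beta> i = h i)"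
    and "\<And>u u' W. seq_hom S u W \<Longrightarrow> seq_hom S u' W \<Longrightarrow> (\<And>i. u i \<cdot> \<beta> i = u' i \<cdot> \<beta> i) \<Longrightarrow> u = u'"
proof -
  have univ: "\<exists>!u. u \<in> Hom Seq S W \<and> u \<cdot>\<^bsub>Seq\<^esub> (S', \<beta>, S) = (S', h, W)"
    if h: "seq_hom S' h W" "\<And>i. h i \<cdot> \<alpha> i = Zero C (ob N i) (ob W i)" for h W
  proof -
    have "(S', h, W) \<in> Hom Seq S' W" "(S', h, W) \<cdot>\<^bsub>Seq\<^esub> (N, \<alpha>, S') = Zero Seq N W"
      using h by (simp_all add: Hom_Seq Seq_simps)
    then show ?thesis
      using c unfolding is_cokernel_def Seq_simps(1,2) by blast
  qed
  have \<beta>\<alpha>: "\<beta> i \<cdot> \<alpha> i = Zero C (ob N i) (ob S i)" for i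
    using c unfolding is_cokernel_def by (simp add: Seq_simps fun_eq_iff)
  show "\<exists>u. seq_hom S u W \<and> (\<forall>i. u i \<cdot> \<beta> i = h i)"
    if h: "seq_hom S' h W" "\<And>i. h i \<cdot> \<alpha> i = Zero C (ob N i) (ob W i)" for h W
  proof -
    obtain F where F: "F \<in> Hom Seq S W" "F \<cdot>\<^bsub>Seq\<^esub> (S', \<beta>, S) = (S', h, W)"
      using univ[OF h] by blast
    then obtain u where u: "F = (S, u, W)" "seq_hom S u W"
      unfolding Hom_Seq by blast
    then have "\<forall>i. u i \<cdot> \<beta> i = h i"
      using F(2) by (simp add: Seq_simps fun_eq_iff)
    then show ?thesis
      using u by blast
  qed
  show "u = u'" if u: "seq_hom S u W" "seq_hom S u' W" and eq: "\<And>i. u i \<cdot> \<beta> i = u' i \<cdot> \<beta> i" for u u' W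
  proof -
    have "(u i \<cdot> \<beta> i) \<cdot> \<alpha> i = Zero C (ob N i) (ob W i)" for i
      using seq_homD(3)[OF u(1), of i] seq_homD(3)[OF \<alpha>, of i] seq_homD(3)[OF \<beta>, of i] \<beta>\<alpha>[of i]
      by simp
    then have ex1: "\<exists>!F. F \<in> Hom Seq S W \<and> F \<cdot>\<^bsub>Seq\<^esub> (S', \<beta>, S) = (S', \<lambda>i. u i \<cdot> \<beta> i, W)"
      using univ[OF seq_hom_Comp[OF \<beta> u(1)]] by blast
    have "(S, u, W) \<in> Hom Seq S W \<and> (S, u, W) \<cdot>\<^bsub>Seq\<^esub> (S', \<beta>, S) = (S', \<lambda>i. u i \<cdot> \<beta> i, W)"
      "(S, u', W) \<in> Hom Seq S W \<and> (S, u', W) \<cdot>\<^bsub>Seq\<^esub> (S', \<beta>, S) = (S', \<lambda>i. u i \<cdot> \<beta> i, W)"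
      using u eq by (simp_all add: Hom_Seq Seq_simps)
    then have "(S, u, W) = (S, u', W)"
      using ex1 by blast
    then show ?thesis
      by simp
  qed
qed

text \<open>
  In a null-extension \<open>S'\<close> of \<open>S\<close> the bonding maps of \<open>S'\<close> kill the kernel of \<open>S' \<rightarrow> S\<close>, hence factor
  through \<open>S\<close>.
\<close>

lemma null_extension_factor:
  assumes "null_extension C S' S"
  obtains \<beta> l where "seq_hom S' \<beta> S" "\<And>i. l i \<in> Hom C (ob S (Suc i)) (ob S' i)"
    "\<And>i. l i \<cdot> \<beta> (Suc i) = bond S' i" "\<And>i. \<beta> i \<cdot> l i = bond S i"
proof -
  obtain N a b where N: "null_sequence C N" and a: "a \<in> Hom Seq N S'" and b: "b \<in> Hom Seq S' S"
    and ex: "short_exact Seq a b"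
    using assms unfolding null_extension_def by blast
  obtain \<alpha> \<beta> where \<alpha>: "a = (N, \<alpha>, S')" "seq_hom N \<alpha> S'" and \<beta>: "b = (S', \<beta>, S)" "seq_hom S' \<beta> S"
    using a b unfolding Hom_Seq by blast
  have "is_cokernel Seq (N, \<alpha>, S') (S', \<beta>, S)"
    using ex unfolding short_exact_def \<alpha>(1) \<beta>(1) by blast
  note coker = seq_cokernelD[OF this \<alpha>(2) \<beta>(2)]
  note \<alpha>D = seq_homD[OF \<alpha>(2)] and \<beta>D = seq_homD[OF \<beta>(2)]
  define Z where "Z = ob S 0"
  have Z: "Z \<in> Obj C"
    unfolding Z_def using \<beta>D by simp
  have kill: "delay_map Z S' i \<cdot> \<alpha> i = Zero C (ob N i) (ob (delay Z S') i)" for i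
  proof (cases i)
    case 0
    then show ?thesis
      using Z \<alpha>D(3)[of 0] by (simp add: delay_def delay_map_def)
  next
    case (Suc n)
    have "bond S' n \<cdot> \<alpha> (Suc n) = \<alpha> n \<cdot> Zero C (ob N (Suc n)) (ob N n)"
      using \<alpha>D(4)[of n] N unfolding null_sequence_def by simp
    then show ?thesis
      using Suc \<alpha>D(1) \<alpha>D(3)[of n] by (simp add: delay_def delay_map_def)
  qed
  obtain u where u: "seq_hom S u (delay Z S')" "\<And>i. u i \<cdot> \<beta> i = delay_map Z S' i"
    using coker(1)[OF seq_hom_delay_map[OF Z \<beta>D(1)] kill] by blast
  \<comment> \<open>\<open>?\<beta>'\<close> is \<open>\<beta>\<close> delayed. The equation below
    is tested after composing with \<open>\<beta>\<close>, where it becomes the compatibility of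
    \<open>\<beta>\<close> with the bonding maps.\<close>
  let ?\<beta>' = "\<lambda>i. case i of 0 \<Rightarrow> Zero C Z Z | Suc n \<Rightarrow> \<beta> n"
  have "(\<lambda>i. ?\<beta>' i \<cdot> u i) = delay_map Z S"
  proof (rule coker(2)[OF seq_hom_Comp[OF u(1) seq_hom_delay[OF Z \<beta>(2)]]
        seq_hom_delay_map[OF Z \<beta>D(2)]])
    fix i
    have "(?\<beta>' i \<cdot> u i) \<cdot> \<beta> i = ?\<beta>' i \<cdot> (u i \<cdot> \<beta> i)"
      using seq_homD(3)[OF u(1), of i] \<beta>D(3)[of i] seq_homD(3)[OF seq_hom_delay[OF Z \<beta>(2)], of i]
      by simp
    also have "\<dots> = delay_map Z S i \<cdot> \<beta> i"
      unfolding u(2) using Z \<beta>D(1,2) \<beta>D(3)[of i] \<beta>D(4)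
      by (cases i) (simp_all add: delay_map_def)
    finally show "(?\<beta>' i \<cdot> u i) \<cdot> \<beta> i = delay_map Z S i \<cdot> \<beta> i" .
  qed
  then have \<beta>u: "?\<beta>' i \<cdot> u i = delay_map Z S i" for i
    by (rule fun_cong)
  show thesis
  proof (rule that[OF \<beta>(2)])
    \<comment> \<open>Degree \<open>Suc i\<close> of the delayed sequence is degree \<open>i\<close>
      of \<open>S'\<close>, so \<open>u (Suc i)\<close> is the factor that lowers the
      degree.\<close>
    show "u (Suc i) \<in> Hom C (ob S (Suc i)) (ob S' i)" for i
      using seq_homD(3)[OF u(1), of "Suc i"] by (simp add: delay_def)
    show "u (Suc i) \<cdot> \<beta> (Suc i) = bond S' i" for i
      using u(2)[of "Suc i"] by (simp add: delay_map_def)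
    show "\<beta> i \<cdot> u (Suc i) = bond S i" for i
      using \<beta>u[of "Suc i"] by (simp add: delay_map_def)
  qed
qed

text \<open>\<open>bond S' i\<close> factors through \<open>\<beta> (Suc i)\<close>, so in the
  equation for \<open>y\<close> the next entry matters only through its image under
  \<open>\<beta>\<close>. That image must be the unique solution \<open>z\<close> in
  \<open>S\<close>, which forces \<open>y i = x i \<oplus> l i \<cdot> z (Suc i)\<close>.\<close>

lemma uniquely_solvable_null_extension:
  assumes S: "uniquely_solvable S" and ext: "null_extension C S' S"
  shows "uniquely_solvable S'"
proof -
  obtain \<beta> l where \<beta>: "seq_hom S' \<beta> S" and l: "\<And>i. l i \<in> Hom C (ob S (Suc i)) (ob S' i)"
    and l\<beta>: "\<And>i. l i \<cdot> \<beta> (Suc i) = bond S' i" and \<beta>l: "\<And>i. \<beta> i \<cdot> l i = bond S i"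
    using null_extension_factor[OF ext] by blast
  note \<beta>D = seq_homD[OF \<beta>]
  show ?thesis
    unfolding uniquely_solvable_def
  proof (intro conjI allI impI \<beta>D(1))
    fix W x assume "W \<in> Obj C \<and> (\<forall>i. x i \<in> Hom C W (ob S' i))"
    then have W: "W \<in> Obj C" and x: "x i \<in> Hom C W (ob S' i)" for i
      by blast+
    have \<beta>x: "\<beta> i \<cdot> x i \<in> Hom C W (ob S i)" for i
      using x \<beta>D(3) by (rule Comp_Hom)
    obtain z where z: "solution S W (\<lambda>i. \<beta> i \<cdot> x i) z"
      using solution_ex[OF S W \<beta>x] .
    then have zi: "z i \<in> Hom C W (ob S i)" "z i = \<beta> i \<cdot> x i \<oplus> bond S i \<cdot> z (Suc i)" for i
      unfolding solution_def by blast+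
    define y where "y = (\<lambda>i. x i \<oplus> l i \<cdot> z (Suc i))"
    have y: "y i \<in> Hom C W (ob S' i)" for i
      using x[of i] l[of i] zi(1)[of "Suc i"] by (simp add: y_def)
    have \<beta>y: "\<beta> i \<cdot> y i = z i" for i
    proof -
      have "\<beta> i \<cdot> y i = \<beta> i \<cdot> x i \<oplus> bond S i \<cdot> z (Suc i)"
        using x[of i] l[of i] zi(1)[of "Suc i"] \<beta>D(3)[of i] Comp_reassoc[OF \<beta>l[of i], of "z (Suc i)"]
        by (simp add: y_def)
      then show ?thesis
        using zi(2)[of i] by (rule trans[OF _ sym])
    qed
    have "bond S' i \<cdot> y (Suc i) = l i \<cdot> z (Suc i)" for i
      using l[of i] y[of "Suc i"] \<beta>D(3)[of "Suc i"] Comp_reassoc[OF l\<beta>[of i], of "y (Suc i)"] \<beta>y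
      by simp
    then have "solution S' W x y"
      unfolding solution_def using y by (simp add: y_def)
    moreover have "y' = y" if y': "solution S' W x y'" for y'
    proof
      fix i
      have y'i: "y' i \<in> Hom C W (ob S' i)" "y' i = x i \<oplus> bond S' i \<cdot> y' (Suc i)" for i
        using y' unfolding solution_def by blast+
      have "(\<lambda>i. \<beta> i \<cdot> y' i) = z"
        using solution_unique[OF S W \<beta>x solution_seq_hom[OF \<beta> x y'] z] .
      then have "\<beta> (Suc i) \<cdot> y' (Suc i) = z (Suc i)"
        by (rule fun_cong)
      then have "bond S' i \<cdot> y' (Suc i) = l i \<cdot> z (Suc i)"
        using l[of i] y'i(1)[of "Suc i"] \<beta>D(3)[of "Suc i"]
          Comp_reassoc[OF l\<beta>[of i], of "y' (Suc i)"] by simp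
      then show "y' i = y i"
        using y'i(2)[of i] by (simp add: y_def)
    qed
    ultimately show "\<exists>!y. solution S' W x y"
      by blast
  qed
qed

end

context exact_products
begin

theorem closed_class_local: "closed_class \<kappa> C (local_sequences C)"
  unfolding closed_class_def
proof (intro conjI allI impI)
  show "local_sequences C \<subseteq> Obj Seq"
    unfolding local_sequences_def Obj_Seq[symmetric] by blast
  show "Z \<in> local_sequences C" if "zero_object Seq Z" for Z
    using uniquely_solvable_zero[OF that] local_iff_uniquely_solvable by blast
  show "closed_under_small_limits \<kappa> Seq (local_sequences C)"
    unfolding closed_under_small_limits_def
  proof (intro allI impI)
    fix J :: "('u, 'u) category" and D D' L p
    assume "is_category J \<and> small \<kappa> (Obj J) \<and> small \<kappa> (Arr J) \<and> is_functor J Seq D D' \<and>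
      D ` Obj J \<subseteq> local_sequences C \<and> is_limit J Seq D D' L p"
    then show "L \<in> local_sequences C"
      using uniquely_solvable_limit[of J D D' L p] local_iff_uniquely_solvable by blast
  qed
  show "closed_under_null_extensions C (local_sequences C)"
    unfolding closed_under_null_extensions_def
    using uniquely_solvable_null_extension local_iff_uniquely_solvable by blast
qed

end

section \<open>Embedding local sequences into a closed class\<close>

context preadditive
begin

text \<open>Compatibility with the bonding maps can be checked after composing with
  \<open>a i\<close>, so lifts chosen in each degree separately already form a morphism.\<close>

lemma seq_hom_lift:
  assumes a: "seq_hom S a T" and mono: "\<And>i. is_mono C (a i)" and q: "seq_hom W q T"
    and factor: "\<And>i. \<exists>u. u \<in> Hom C (ob W i) (ob S i) \<and> a i \<cdot> u = q i"
  obtains u where "seq_hom W u S" "\<And>i. a i \<cdot> u i = q i"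
proof -
  obtain u where u: "\<And>i. u i \<in> Hom C (ob W i) (ob S i)" "\<And>i. a i \<cdot> u i = q i"
    using factor by metis
  note aD = seq_homD[OF a] and qD = seq_homD[OF q]
  have "seq_hom W u S"
    unfolding seq_hom_def
  proof (intro conjI allI aD(1) qD(1) u(1))
    fix i
    show "u i \<cdot> bond W i = bond S i \<cdot> u (Suc i)"
    proof (rule mono_cancel[OF mono aD(3)])
      show "u i \<cdot> bond W i \<in> Hom C (ob W (Suc i)) (ob S i)"
        "bond S i \<cdot> u (Suc i) \<in> Hom C (ob W (Suc i)) (ob S i)"
        using u(1)[of i] u(1)[of "Suc i"] aD(1) qD(1) by simp_all
      have "a i \<cdot> (u i \<cdot> bond W i) = q i \<cdot> bond W i"
        using u(1)[of i] aD(3)[of i] qD(1) by (intro Comp_reassoc[OF u(2)]) simp_all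
      also have "\<dots> = bond T i \<cdot> (a (Suc i) \<cdot> u (Suc i))"
        unfolding qD(4) u(2) ..
      also have "\<dots> = (a i \<cdot> bond S i) \<cdot> u (Suc i)"
        unfolding aD(4) using u(1)[of "Suc i"] aD(2) aD(3)[of "Suc i"] by simp
      also have "\<dots> = a i \<cdot> (bond S i \<cdot> u (Suc i))"
        using u(1)[of "Suc i"] aD(1) aD(3)[of i] by simp
      finally show "a i \<cdot> (u i \<cdot> bond W i) = a i \<cdot> (bond S i \<cdot> u (Suc i))" .
    qed
  qed
  then show thesis
    using that u(2) by blast
qed

text \<open>Uniqueness of the factorizations comes from the components being monic and epic, which
  leaves only existence to be supplied.\<close>

lemma short_exact_SeqI:
  assumes \<alpha>: "seq_hom N \<alpha> S'" and \<beta>: "seq_hom S' \<beta> S"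
    and \<beta>\<alpha>: "\<And>i. \<beta> i \<cdot> \<alpha> i = Zero C (ob N i) (ob S i)"
    and mono: "\<And>i. is_mono C (\<alpha> i)" and epi: "\<And>i. is_epi C (\<beta> i)"
    and ker: "\<And>W h. seq_hom W h S' \<Longrightarrow> (\<And>i. \<beta> i \<cdot> h i = Zero C (ob W i) (ob S i)) \<Longrightarrow>
      \<exists>u. seq_hom W u N \<and> (\<forall>i. \<alpha> i \<cdot> u i = h i)"
    and coker: "\<And>W h. seq_hom S' h W \<Longrightarrow> (\<And>i. h i \<cdot> \<alpha> i = Zero C (ob N i) (ob W i)) \<Longrightarrow>
      \<exists>u. seq_hom S u W \<and> (\<forall>i. u i \<cdot> \<beta> i = h i)"
  shows "short_exact Seq (N, \<alpha>, S') (S', \<beta>, S)"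
  unfolding short_exact_def
proof
  show "is_kernel Seq (S', \<beta>, S) (N, \<alpha>, S')"
    unfolding is_kernel_def Seq_simps Arr_Seq
  proof (intro conjI allI ballI impI \<alpha> \<beta> refl)
    show "(N, \<lambda>i. \<beta> i \<cdot> \<alpha> i, S) = (N, \<lambda>i. Zero C (ob N i) (ob S i), S)"
      using \<beta>\<alpha> by simp
    fix W F assume F: "F \<in> Hom Seq W S'"
      "(S', \<beta>, S) \<cdot>\<^bsub>Seq\<^esub> F = (W, \<lambda>i. Zero C (ob W i) (ob S i), S)"
    then obtain h where h: "F = (W, h, S')" "seq_hom W h S'"
      unfolding Hom_Seq by blast
    then have "\<beta> i \<cdot> h i = Zero C (ob W i) (ob S i)" for i
      using F(2) by (simp add: Seq_simps fun_eq_iff)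
    then obtain u where u: "seq_hom W u N" "\<And>i. \<alpha> i \<cdot> u i = h i"
      using ker[OF h(2)] by blast
    show "\<exists>!G. G \<in> Hom Seq W N \<and> (N, \<alpha>, S') \<cdot>\<^bsub>Seq\<^esub> G = F"
    proof (rule ex1I[of _ "(W, u, N)"])
      show "(W, u, N) \<in> Hom Seq W N \<and> (N, \<alpha>, S') \<cdot>\<^bsub>Seq\<^esub> (W, u, N) = F"
        using u h by (simp add: Hom_Seq Seq_simps)
      fix G assume G: "G \<in> Hom Seq W N \<and> (N, \<alpha>, S') \<cdot>\<^bsub>Seq\<^esub> G = F"
      then obtain u' where u': "G = (W, u', N)" "seq_hom W u' N"
        unfolding Hom_Seq by blast
      then have "\<alpha> i \<cdot> u' i = h i" for i
        using G h(1) by (simp add: Seq_simps fun_eq_iff)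
      then have "u' i = u i" for i
        using mono_cancel[OF mono seq_homD(3)[OF \<alpha>] seq_homD(3)[OF u'(2)] seq_homD(3)[OF u(1)]] u(2)
          by simp
      then show "G = (W, u, N)"
        using u' by auto
    qed
  qed
  show "is_cokernel Seq (N, \<alpha>, S') (S', \<beta>, S)"
    unfolding is_cokernel_def Seq_simps Arr_Seq
  proof (intro conjI allI ballI impI \<alpha> \<beta> refl)
    show "(N, \<lambda>i. \<beta> i \<cdot> \<alpha> i, S) = (N, \<lambda>i. Zero C (ob N i) (ob S i), S)"
      using \<beta>\<alpha> by simp
    fix W F assume F: "F \<in> Hom Seq S' W"
      "F \<cdot>\<^bsub>Seq\<^esub> (N, \<alpha>, S') = (N, \<lambda>i. Zero C (ob N i) (ob W i), W)"
    then obtain h where h: "F = (S', h, W)" "seq_hom S' h W"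
      unfolding Hom_Seq by blast
    then have "h i \<cdot> \<alpha> i = Zero C (ob N i) (ob W i)" for i
      using F(2) by (simp add: Seq_simps fun_eq_iff)
    then obtain u where u: "seq_hom S u W" "\<And>i. u i \<cdot> \<beta> i = h i"
      using coker[OF h(2)] by blast
    show "\<exists>!G. G \<in> Hom Seq S W \<and> G \<cdot>\<^bsub>Seq\<^esub> (S', \<beta>, S) = F"
    proof (rule ex1I[of _ "(S, u, W)"])
      show "(S, u, W) \<in> Hom Seq S W \<and> (S, u, W) \<cdot>\<^bsub>Seq\<^esub> (S', \<beta>, S) = F"
        using u h by (simp add: Hom_Seq Seq_simps)
      fix G assume G: "G \<in> Hom Seq S W \<and> G \<cdot>\<^bsub>Seq\<^esub> (S', \<beta>, S) = F"
      then obtain u' where u': "G = (S, u', W)" "seq_hom S u' W"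
        unfolding Hom_Seq by blast
      then have "u' i \<cdot> \<beta> i = h i" for i
        using G h(1) by (simp add: Seq_simps fun_eq_iff)
      then have "u' i = u i" for i
        using epi_cancel[OF epi seq_homD(3)[OF \<beta>] seq_homD(3)[OF u'(2)] seq_homD(3)[OF u(1)]] u(2)
          by simp
      then show "G = (S, u, W)"
        using u' by auto
    qed
  qed
qed

end

context abelian
begin

text \<open>
  A null-extension of \<open>T\<close> amounts to factorizations \<open>T\<^bsub>i+1\<^esub> \<rightarrow> T'\<^sub>i \<rightarrow> T\<^sub>i\<close> of the bonding maps into any
  morphism followed by an epimorphism. Taking \<open>T'\<^sub>i = P\<^sub>i \<oplus> T\<^sub>i\<close>, where \<open>P\<^sub>i\<close> is the pushout of
  \<open>T\<^bsub>i+1\<^esub> \<leftarrow> S\<^bsub>i+1\<^esub> \<rightarrow> S\<^sub>i\<close>, replaces the kernel \<open>N\<close> of \<open>S \<rightarrow> T\<close> by the images of \<open>N\<^bsub>i+1\<^esub> \<rightarrow> N\<^sub>i\<close>.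
\<close>

lemma null_extension_step:
  assumes \<eta>: "seq_hom S \<eta> T"
  obtains T' \<eta>' where "null_extension C T' T" "seq_hom S \<eta>' T'"
    "\<And>i W k. k \<in> Hom C W (ob S i) \<Longrightarrow> \<eta>' i \<cdot> k = Zero C W (ob T' i) \<Longrightarrow>
      \<exists>Z e w. e \<in> Hom C Z W \<and> is_epi C e \<and> w \<in> Hom C Z (ob S (Suc i)) \<and>
        \<eta> (Suc i) \<cdot> w = Zero C Z (ob T (Suc i)) \<and> bond S i \<cdot> w = k \<cdot> e"
proof -
  note \<eta>D = seq_homD[OF \<eta>]
  have bS: "bond S i \<in> Hom C (ob S (Suc i)) (ob S i)" for i
    using \<eta>D(1) by simp
  let ?lift = "\<lambda>i W k. \<exists>Z e w. e \<in> Hom C Z W \<and> is_epi C e \<and> w \<in> Hom C Z (ob S (Suc i)) \<and>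
        \<eta> (Suc i) \<cdot> w = Zero C Z (ob T (Suc i)) \<and> bond S i \<cdot> w = k \<cdot> e"
  have "\<exists>P a b. a \<in> Hom C (ob T (Suc i)) P \<and> b \<in> Hom C (ob S i) P \<and> a \<cdot> \<eta> (Suc i) = b \<cdot> bond S i \<and>
    (\<forall>W k. k \<in> Hom C W (ob S i) \<and> b \<cdot> k = Zero C W P \<longrightarrow> ?lift i W k)" for i
    by (rule pushout[OF bS \<eta>D(3)]) blast
  then obtain P a b where a: "\<And>i. a i \<in> Hom C (ob T (Suc i)) (P i)"
    and b: "\<And>i. b i \<in> Hom C (ob S i) (P i)" and ab: "\<And>i. a i \<cdot> \<eta> (Suc i) = b i \<cdot> bond S i"
    and lift: "\<And>i W k. k \<in> Hom C W (ob S i) \<Longrightarrow> b i \<cdot> k = Zero C W (P i) \<Longrightarrow> ?lift i W k"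
    by metis
  have P: "P i \<in> Obj C" for i
    using a[of i] by simp
  have "\<exists>B p q s t. p \<in> Hom C B (P i) \<and> q \<in> Hom C B (ob T i) \<and> s \<in> Hom C (P i) B \<and> t \<in> Hom C (ob T i) B \<and>
    p \<cdot> s = Ident C (P i) \<and> q \<cdot> t = Ident C (ob T i) \<and>
    q \<cdot> s = Zero C (P i) (ob T i) \<and> p \<cdot> t = Zero C (ob T i) (P i) \<and> s \<cdot> p \<oplus> t \<cdot> q = Ident C B" for i
    by (rule biproduct_ex[OF P inverse_sequenceD(1)[OF \<eta>D(2)]]) blast
  then obtain B p q s t where p: "\<And>i. p i \<in> Hom C (B i) (P i)" and q: "\<And>i. q i \<in> Hom C (B i) (ob T i)"
    and s: "\<And>i. s i \<in> Hom C (P i) (B i)" and t: "\<And>i. t i \<in> Hom C (ob T i) (B i)"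
    and ps: "\<And>i. p i \<cdot> s i = Ident C (P i)" and qt: "\<And>i. q i \<cdot> t i = Ident C (ob T i)"
    and qs: "\<And>i. q i \<cdot> s i = Zero C (P i) (ob T i)" and pt: "\<And>i. p i \<cdot> t i = Zero C (ob T i) (P i)"
    and sum: "\<And>i. s i \<cdot> p i \<oplus> t i \<cdot> q i = Ident C (B i)"
    by metis
  \<comment> \<open>\<open>l i\<close> has components \<open>a i\<close> into the pushout and
    \<open>bond T i\<close> into \<open>T\<close>. Since \<open>bond T' i\<close> first projects by
    \<open>q (Suc i)\<close>, it kills the summand \<open>P\<close>, which therefore carries zero
    bonding maps.\<close>
  define l where "l = (\<lambda>i. s i \<cdot> a i \<oplus> t i \<cdot> bond T i)"
  define T' where "T' = \<lparr>ob = B, bond = \<lambda>i. l i \<cdot> q (Suc i)\<rparr>"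
  \<comment> \<open>\<open>\<eta>\<close> is lifted along \<open>q\<close> with the pushout leg
    \<open>b\<close> as new component, so what \<open>\<eta>' i\<close> kills is killed by
    \<open>b i\<close>, where \<open>lift\<close> applies.\<close>
  define \<eta>' where "\<eta>' = (\<lambda>i. s i \<cdot> b i \<oplus> t i \<cdot> \<eta> i)"
  define N where "N = \<lparr>ob = P, bond = \<lambda>i. Zero C (P (Suc i)) (P i)\<rparr>"
  note [simp] = p[simplified] q[simplified] s[simplified] t[simplified] a[simplified] b[simplified]
    \<eta>D(1,2) \<eta>D(3)[simplified]
  have l: "l i \<in> Hom C (ob T (Suc i)) (B i)" for i
    by (simp add: l_def)
  note [simp] = l[simplified]
  have ql: "q i \<cdot> l i = bond T i" for i
    by (simp add: l_def Comp_reassoc[OF qs] Comp_reassoc[OF qt])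
  have T': "is_inverse_sequence C T'"
    unfolding is_inverse_sequence_def T'_def by simp
  have N: "null_sequence C N"
    unfolding null_sequence_def is_inverse_sequence_def N_def by simp
  then have N_inv: "is_inverse_sequence C N"
    unfolding null_sequence_def by blast
  have s_hom: "seq_hom N s T'"
    unfolding seq_hom_def using N_inv T' by (simp add: N_def T'_def qs)
  have q_hom: "seq_hom T' q T"
    unfolding seq_hom_def using T' by (simp add: T'_def Comp_reassoc[OF ql])
  have "short_exact Seq (N, s, T') (T', q, T)"
  proof (rule short_exact_SeqI[OF s_hom q_hom])
    show "q i \<cdot> s i = Zero C (ob N i) (ob T i)" for i
      by (simp add: N_def qs)
    show "is_mono C (s i)" for i
    proof (rule monoI[OF s])
      fix W g assume g: "g \<in> Hom C W (P i)" "s i \<cdot> g = Zero C W (B i)"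
      then show "g = Zero C W (P i)"
        using Comp_reassoc[OF ps[of i], of g] by simp
    qed
    show "is_epi C (q i)" for i
    proof (rule epiI[OF q])
      fix W g assume g: "g \<in> Hom C (ob T i) W" "g \<cdot> q i = Zero C (B i) W"
      have "g = (g \<cdot> q i) \<cdot> t i"
        using g(1) qt[of i] by simp
      then show "g = Zero C (ob T i) W"
        unfolding g(2) using g(1) by simp
    qed
    show "\<exists>u. seq_hom W u N \<and> (\<forall>i. s i \<cdot> u i = h i)"
      if h: "seq_hom W h T'" and qh: "\<And>i. q i \<cdot> h i = Zero C (ob W i) (ob T i)" for W h
    proof (intro exI conjI allI)
      note hD = seq_homD[OF h]
      have hB: "h i \<in> Hom C (ob W i) (B i)" for i
        using hD(3)[of i] by (simp add: T'_def)
      note [simp] = hB[simplified] hD(1)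
      show "seq_hom W (\<lambda>i. p i \<cdot> h i) N"
        unfolding seq_hom_def
      proof (intro conjI allI hD(1) N_inv)
        fix i
        show "p i \<cdot> h i \<in> Hom C (ob W i) (ob N i)"
          by (simp add: N_def)
        have "(p i \<cdot> h i) \<cdot> bond W i = p i \<cdot> (bond T' i \<cdot> h (Suc i))"
          using hD(4)[of i] by simp
        also have "\<dots> = p i \<cdot> (l i \<cdot> (q (Suc i) \<cdot> h (Suc i)))"
          by (simp add: T'_def)
        also have "\<dots> = bond N i \<cdot> (p (Suc i) \<cdot> h (Suc i))"
          unfolding qh by (simp add: N_def)
        finally show "(p i \<cdot> h i) \<cdot> bond W i = bond N i \<cdot> (p (Suc i) \<cdot> h (Suc i))" .
      qed
      fix i
      have "h i = (s i \<cdot> p i \<oplus> t i \<cdot> q i) \<cdot> h i"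
        unfolding sum by simp
      also have "\<dots> = s i \<cdot> (p i \<cdot> h i)"
        by (simp add: qh)
      finally show "s i \<cdot> (p i \<cdot> h i) = h i"
        by simp
    qed
    show "\<exists>u. seq_hom T u W \<and> (\<forall>i. u i \<cdot> q i = h i)"
      if h: "seq_hom T' h W" and hs: "\<And>i. h i \<cdot> s i = Zero C (ob N i) (ob W i)" for W h
    proof (intro exI conjI allI)
      note hD = seq_homD[OF h]
      have hB: "h i \<in> Hom C (B i) (ob W i)" for i
        using hD(3)[of i] by (simp add: T'_def)
      note [simp] = hB[simplified] hD(2)
      \<comment> \<open>The sections \<open>t i\<close> need not commute with the bonding maps. The
        composites \<open>h i \<cdot> t i\<close> do, because \<open>h\<close> kills
        \<open>s\<close> and is thus recovered from them through \<open>q\<close>.\<close>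
      have htq: "(h i \<cdot> t i) \<cdot> q i = h i" for i
      proof -
        have "h i = h i \<cdot> (s i \<cdot> p i \<oplus> t i \<cdot> q i)"
          unfolding sum by simp
        also have "\<dots> = (h i \<cdot> t i) \<cdot> q i"
          using hs[of i] Comp_reassoc[OF hs[of i], of "p i"] by (simp add: N_def)
        finally show ?thesis
          by simp
      qed
      then show "(h i \<cdot> t i) \<cdot> q i = h i" for i .
      show "seq_hom T (\<lambda>i. h i \<cdot> t i) W"
        unfolding seq_hom_def
      proof (intro conjI allI \<eta>D(2) hD(2))
        fix i
        show "h i \<cdot> t i \<in> Hom C (ob T i) (ob W i)"
          by simp
        have "(h i \<cdot> t i) \<cdot> bond T i = ((h i \<cdot> t i) \<cdot> q i) \<cdot> l i"
          by (simp add: ql)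
        also have "\<dots> = h i \<cdot> l i"
          unfolding htq ..
        also have "\<dots> = (h i \<cdot> bond T' i) \<cdot> t (Suc i)"
          by (simp add: T'_def qt)
        also have "\<dots> = bond W i \<cdot> (h (Suc i) \<cdot> t (Suc i))"
          unfolding hD(4) by simp
        finally show "(h i \<cdot> t i) \<cdot> bond T i = bond W i \<cdot> (h (Suc i) \<cdot> t (Suc i))" .
      qed
    qed
  qed
  moreover have "(N, s, T') \<in> Hom Seq N T'" "(T', q, T) \<in> Hom Seq T' T"
    using s_hom q_hom by (simp_all add: Hom_Seq)
  ultimately have ext: "null_extension C T' T"
    unfolding null_extension_def using N by blast
  have q\<eta>': "q i \<cdot> \<eta>' i = \<eta> i" and p\<eta>': "p i \<cdot> \<eta>' i = b i" for i
    by (simp_all add: \<eta>'_def Comp_reassoc[OF qs] Comp_reassoc[OF qt] Comp_reassoc[OF ps]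
        Comp_reassoc[OF pt])
  have \<eta>'_Hom: "\<eta>' i \<in> Hom C (ob S i) (B i)" for i
    by (simp add: \<eta>'_def)
  have "seq_hom S \<eta>' T'"
    unfolding seq_hom_def
  proof (intro conjI allI \<eta>D(1) T')
    fix i
    show "\<eta>' i \<in> Hom C (ob S i) (ob T' i)"
      using \<eta>'_Hom by (simp add: T'_def)
    have "bond T' i \<cdot> \<eta>' (Suc i) = l i \<cdot> \<eta> (Suc i)"
      using \<eta>'_Hom[of "Suc i"] by (simp add: T'_def q\<eta>')
    also have "\<dots> = s i \<cdot> (b i \<cdot> bond S i) \<oplus> t i \<cdot> (\<eta> i \<cdot> bond S i)"
      by (simp add: l_def ab \<eta>D(4))
    also have "\<dots> = \<eta>' i \<cdot> bond S i"
      by (simp add: \<eta>'_def)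
    finally show "\<eta>' i \<cdot> bond S i = bond T' i \<cdot> \<eta>' (Suc i)"
      by simp
  qed
  moreover have "?lift i W k"
    if k: "k \<in> Hom C W (ob S i)" "\<eta>' i \<cdot> k = Zero C W (ob T' i)" for i W k
  proof (rule lift[OF k(1)])
    have "b i \<cdot> k = p i \<cdot> (\<eta>' i \<cdot> k)"
      using k(1) \<eta>'_Hom[of i] by (intro Comp_reassoc[OF p\<eta>', symmetric]) simp_all
    then show "b i \<cdot> k = Zero C W (P i)"
      unfolding k(2) using k(1) by (simp add: T'_def)
  qed
  ultimately show thesis
    using that[OF ext] by blast
qed

end

context exact_products
begin

section \<open>Products and kernels inside a closed class\<close>

lemma closed_class_inverse_sequence:
  "closed_class \<kappa> C K \<Longrightarrow> T \<in> K \<Longrightarrow> is_inverse_sequence C T"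
  unfolding closed_class_def using Obj_Seq by blast

lemma closed_class_null_extension:
  "closed_class \<kappa> C K \<Longrightarrow> T \<in> K \<Longrightarrow> null_extension C T' T \<Longrightarrow> T' \<in> K"
  unfolding closed_class_def closed_under_null_extensions_def by blast

lemma closed_class_limit:
  fixes J :: "('u, 'u) category"
  assumes "closed_class \<kappa> C K" "is_category J" "small \<kappa> (Obj J)" "small \<kappa> (Arr J)"
    "is_functor J Seq D D'" "\<And>j. j \<in> Obj J \<Longrightarrow> D j \<in> K" "is_limit J Seq D D' L p"
  shows "L \<in> K"
  using assms unfolding closed_class_def closed_under_small_limits_def by blast

text \<open>The product, formed degree by degree, is a limit over a discrete category whose objects
  are coded in \<open>'u\<close> and double as their identity arrows.\<close>

lemma closed_class_product:
  assumes K: "closed_class \<kappa> C K" and \<Lambda>: "small \<kappa> \<Lambda>" and T: "\<And>j. j \<in> \<Lambda> \<Longrightarrow> T j \<in> K"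
  obtains P pr where "P \<in> K" "\<And>j. j \<in> \<Lambda> \<Longrightarrow> seq_hom P (pr j) (T j)"
    "\<And>S \<eta>. is_inverse_sequence C S \<Longrightarrow> (\<And>j. j \<in> \<Lambda> \<Longrightarrow> seq_hom S (\<eta> j) (T j)) \<Longrightarrow>
      \<exists>h. seq_hom S h P \<and> (\<forall>j\<in>\<Lambda>. \<forall>i. pr j i \<cdot> h i = \<eta> j i)"
proof -
  obtain \<phi> :: "_ \<Rightarrow> 'u" where \<phi>: "inj_on \<phi> \<Lambda>" "small \<kappa> (\<phi> ` \<Lambda>)"
    using small_embedding[OF inaccessible \<Lambda>] .
  define I where "I = \<phi> ` \<Lambda>"
  define \<psi> where "\<psi> = inv_into \<Lambda> \<phi>"
  have \<psi>\<phi>: "\<psi> (\<phi> j) = j" if "j \<in> \<Lambda>" for j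
    unfolding \<psi>_def using \<phi>(1) that by simp
  have \<psi>: "\<psi> u \<in> \<Lambda>" if "u \<in> I" for u
    using that \<psi>\<phi> unfolding I_def by auto
  have small_I: "small \<kappa> I"
    using \<phi>(2) unfolding I_def .
  have T_inv: "is_inverse_sequence C (T (\<psi> u))" if "u \<in> I" for u
    using closed_class_inverse_sequence[OF K T[OF \<psi>[OF that]]] .
  note TD = inverse_sequenceD[OF T_inv]
  have "\<exists>P p. is_product C I (\<lambda>u. ob (T (\<psi> u)) i) P p" for i
    by (rule product_small_ex[OF small_I, of "\<lambda>u. ob (T (\<psi> u)) i"]) (use TD in auto)
  then obtain B p where B: "\<And>i. is_product C I (\<lambda>u. ob (T (\<psi> u)) i) (B i) (p i)"
    by metis
  have B_ob: "B i \<in> Obj C" for i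
    using B unfolding is_product_def by blast
  have p: "p i u \<in> Hom C (B i) (ob (T (\<psi> u)) i)" if "u \<in> I" for i u
    using product_Hom[OF B that] .
  have "\<exists>f. f \<in> Hom C (B (Suc i)) (B i) \<and>
      (\<forall>u\<in>I. p i u \<cdot> f = bond (T (\<psi> u)) i \<cdot> p (Suc i) u)" for i
  proof -
    have *: "bond (T (\<psi> u)) i \<cdot> p (Suc i) u \<in> Hom C (B (Suc i)) (ob (T (\<psi> u)) i)" if "u \<in> I" for u
      using p[OF that, of "Suc i"] TD[OF that] by simp
    show ?thesis
      by (rule product_ex[OF B[of i] B_ob[of "Suc i"] *]) blast+
  qed
  then obtain f where f: "\<And>i. f i \<in> Hom C (B (Suc i)) (B i)"
    "\<And>i u. u \<in> I \<Longrightarrow> p i u \<cdot> f i = bond (T (\<psi> u)) i \<cdot> p (Suc i) u"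
    by metis
  define P where "P = \<lparr>ob = B, bond = f\<rparr>"
  have P: "is_inverse_sequence C P"
    unfolding is_inverse_sequence_def P_def using f(1) B_ob by simp
  have p_hom: "seq_hom P (\<lambda>i. p i u) (T (\<psi> u))" if "u \<in> I" for u
    unfolding seq_hom_def
  proof (intro conjI allI P T_inv that)
    show "p i u \<in> Hom C (ob P i) (ob (T (\<psi> u)) i)" for i
      using p[OF that, of i] by (simp add: P_def)
    show "p i u \<cdot> bond P i = bond (T (\<psi> u)) i \<cdot> p (Suc i) u" for i
      using f(2)[OF that, of i] by (simp add: P_def)
  qed
  have univ: "\<exists>h. seq_hom W h P \<and> (\<forall>u \<in> I. \<forall>i. p i u \<cdot> h i = q u i)"
    if W: "is_inverse_sequence C W" and q: "\<And>u. u \<in> I \<Longrightarrow> seq_hom W (q u) (T (\<psi> u))" for W q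
  proof -
    have "\<exists>h. h \<in> Hom C (ob W i) (B i) \<and> (\<forall>u\<in>I. p i u \<cdot> h = q u i)" for i
      by (rule product_ex[OF B[of i] inverse_sequenceD(1)[OF W] seq_homD(3)[OF q]]) blast+
    then obtain h where h: "\<And>i. h i \<in> Hom C (ob W i) (B i)" "\<And>i u. u \<in> I \<Longrightarrow> p i u \<cdot> h i = q u i"
      by metis
    have "seq_hom W h P"
      unfolding seq_hom_def
    proof (intro conjI allI P W)
      fix i
      show "h i \<in> Hom C (ob W i) (ob P i)"
        using h(1)[of i] by (simp add: P_def)
      have "h i \<cdot> bond W i = f i \<cdot> h (Suc i)"
      proof (rule product_eq[OF B])
        show "h i \<cdot> bond W i \<in> Hom C (ob W (Suc i)) (B i)"
          "f i \<cdot> h (Suc i) \<in> Hom C (ob W (Suc i)) (B i)"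
          using h(1)[of i] h(1)[of "Suc i"] f(1)[of i] W by simp_all
        fix u assume u: "u \<in> I"
        have "p i u \<cdot> (h i \<cdot> bond W i) = q u i \<cdot> bond W i"
          using p[OF u, of i] h(1)[of i] W by (intro Comp_reassoc[OF h(2)[OF u]]) simp_all
        also have "\<dots> = bond (T (\<psi> u)) i \<cdot> (p (Suc i) u \<cdot> h (Suc i))"
          unfolding seq_homD(4)[OF q[OF u]] h(2)[OF u] ..
        also have "\<dots> = (p i u \<cdot> f i) \<cdot> h (Suc i)"
          unfolding f(2)[OF u] using p[OF u, of "Suc i"] h(1)[of "Suc i"] TD[OF u] by simp
        also have "\<dots> = p i u \<cdot> (f i \<cdot> h (Suc i))"
          using p[OF u, of i] h(1)[of "Suc i"] f(1)[of i] by simp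
        finally show "p i u \<cdot> (h i \<cdot> bond W i) = p i u \<cdot> (f i \<cdot> h (Suc i))" .
      qed
      then show "h i \<cdot> bond W i = bond P i \<cdot> h (Suc i)"
        by (simp add: P_def)
    qed
    then show ?thesis
      using h(2) by blast
  qed
  define J :: "('u, 'u) category" where
    "J = \<lparr>Obj = I, Arr = I, Dom = id, Cod = id, Ident = id, Comp = (\<lambda>v u. u)\<rparr>"
  have J_simps: "Obj J = I" "Arr J = I" "Dom J u = u" "Cod J u = u" "Ident J u = u"
    "v \<cdot>\<^bsub>J\<^esub> u = u" for u v
    by (simp_all add: J_def)
  have "P \<in> K"
  proof (rule closed_class_limit[OF K])
    show "is_category J"
      unfolding is_category_def Hom_def J_simps by auto
    show "small \<kappa> (Obj J)" "small \<kappa> (Arr J)"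
      using small_I by (simp_all add: J_simps)
    show "T (\<psi> u) \<in> K" if "u \<in> Obj J" for u
      using T \<psi> that by (simp add: J_simps)
    show diagram: "is_functor J Seq (\<lambda>u. T (\<psi> u))
        (\<lambda>u. (T (\<psi> u), \<lambda>i. Ident C (ob (T (\<psi> u)) i), T (\<psi> u)))"
      unfolding is_functor_def J_simps Obj_Seq Hom_Seq
      using T_inv seq_hom_Ident TD by (auto simp: Seq_simps)
    show "is_limit J Seq (\<lambda>u. T (\<psi> u)) (\<lambda>u. (T (\<psi> u), \<lambda>i. Ident C (ob (T (\<psi> u)) i), T (\<psi> u))) P
        (\<lambda>u. (P, \<lambda>i. p i u, T (\<psi> u)))"
    proof (rule is_limit_SeqI[OF diagram, where \<delta> = "\<lambda>u i. Ident C (ob (T (\<psi> u)) i)"],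
        unfold J_simps)
      show "Ident C (ob (T (\<psi> u)) i) \<cdot> p i u = p i u" if "u \<in> I" for u i
        using p[OF that, of i] by simp
      show "h = h'" if h: "seq_hom W h P" "seq_hom W h' P"
        and eq: "\<And>u i. u \<in> I \<Longrightarrow> p i u \<cdot> h i = p i u \<cdot> h' i" for W h h'
      proof
        fix i
        show "h i = h' i"
          using product_eq[OF B, of "h i" "ob W i" i "h' i"] eq
            seq_homD(3)[OF h(1), of i] seq_homD(3)[OF h(2), of i] by (simp add: P_def)
      qed
    qed (use P p_hom univ in auto)
  qed
  then show thesis
  proof (rule that[of _ "\<lambda>j i. p i (\<phi> j)"])
    fix j assume "j \<in> \<Lambda>"
    then show "seq_hom P (\<lambda>i. p i (\<phi> j)) (T j)"
      using p_hom[of "\<phi> j"] \<psi>\<phi> unfolding I_def by simp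
  next
    fix S \<eta> assume S: "is_inverse_sequence C S" and \<eta>: "\<And>j. j \<in> \<Lambda> \<Longrightarrow> seq_hom S (\<eta> j) (T j)"
    obtain h where "seq_hom S h P" "\<forall>u \<in> I. \<forall>i. p i u \<cdot> h i = \<eta> (\<psi> u) i"
      using univ[OF S, of "\<lambda>u. \<eta> (\<psi> u)"] \<eta> \<psi> by blast
    then show "\<exists>h. seq_hom S h P \<and> (\<forall>j\<in>\<Lambda>. \<forall>i. p i (\<phi> j) \<cdot> h i = \<eta> j i)"
      using \<psi>\<phi> unfolding I_def by auto
  qed
qed

text \<open>A kernel is the limit of the parallel pair consisting of \<open>g\<close> and zero. The
  factorizations given by \<open>exact\<close> in each degree assemble to a morphism because
  \<open>a\<close> is monic.\<close>

lemma closed_class_kernel: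
  assumes K: "closed_class \<kappa> C K" and T: "T \<in> K" and U: "U \<in> K"
    and g: "seq_hom T g U" and a: "seq_hom S a T"
    and ga: "\<And>i. g i \<cdot> a i = Zero C (ob S i) (ob U i)"
    and mono: "\<And>i. is_mono C (a i)"
    and exact: "\<And>i W h. h \<in> Hom C W (ob T i) \<Longrightarrow> g i \<cdot> h = Zero C W (ob U i) \<Longrightarrow>
      \<exists>u. u \<in> Hom C W (ob S i) \<and> a i \<cdot> u = h"
  shows "S \<in> K"
proof -
  note aD = seq_homD[OF a] and gD = seq_homD[OF g]
  obtain e :: "nat \<Rightarrow> 'u" where e: "inj e"
    using infinite_universe[OF inaccessible] infinite_countable_subset by blast
  then have [simp]: "e m = e n \<longleftrightarrow> m = n" for m n
    by (simp add: inj_eq)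
  \<comment> \<open>Two objects and two parallel arrows: \<open>e 0\<close> and \<open>e 4\<close>
    are the objects and also their identities, \<open>e 2\<close> carries \<open>g\<close> and
    \<open>e 3\<close> the zero map. In a composable pair one factor is an identity, so composition
    returns the other.\<close>
  define J :: "('u, 'u) category" where
    "J = \<lparr>Obj = {e 0, e 4}, Arr = {e 0, e 4, e 2, e 3},
      Dom = (\<lambda>x. if x = e 4 then e 4 else e 0), Cod = (\<lambda>x. if x = e 0 then e 0 else e 4),
      Ident = id, Comp = (\<lambda>y x. if x = e 0 \<or> x = e 4 then y else x)\<rparr>"
  have J_simps: "Obj J = {e 0, e 4}" "Arr J = {e 0, e 4, e 2, e 3}"
    "Dom J x = (if x = e 4 then e 4 else e 0)" "Cod J x = (if x = e 0 then e 0 else e 4)"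
    "Ident J x = x" "y \<cdot>\<^bsub>J\<^esub> x = (if x = e 0 \<or> x = e 4 then y else x)" for x y
    by (simp_all add: J_def)
  define D where "D = (\<lambda>x. if x = e 0 then T else U)"
  define \<delta> where "\<delta> = (\<lambda>x. if x = e 0 then (\<lambda>i. Ident C (ob T i))
    else if x = e 4 then (\<lambda>i. Ident C (ob U i))
    else if x = e 2 then g else (\<lambda>i. Zero C (ob T i) (ob U i)))"
  define \<pi> where "\<pi> = (\<lambda>x. if x = e 0 then a else (\<lambda>i. Zero C (ob S i) (ob U i)))"
  have D: "D (e 0) = T" "D (e 4) = U"
    by (simp_all add: D_def)
  have \<delta>: "\<delta> (e 0) = (\<lambda>i. Ident C (ob T i))" "\<delta> (e 4) = (\<lambda>i. Ident C (ob U i))" "\<delta> (e 2) = g"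
    "\<delta> (e 3) = (\<lambda>i. Zero C (ob T i) (ob U i))"
    by (simp_all add: \<delta>_def)
  have \<pi>: "\<pi> (e 0) = a" "\<pi> (e 4) = (\<lambda>i. Zero C (ob S i) (ob U i))"
    by (simp_all add: \<pi>_def)
  note [simp] = aD(1,2) gD(2) aD(3)[simplified] gD(3)[simplified]
  show ?thesis
  proof (rule closed_class_limit[OF K])
    show "is_category J"
      unfolding is_category_def Hom_def J_simps by (auto split: if_splits)
    show "small \<kappa> (Obj J)" "small \<kappa> (Arr J)"
      by (auto simp: J_simps intro: small_finite[OF inaccessible])
    show "D j \<in> K" if "j \<in> Obj J" for j
      using that T U by (auto simp: J_simps D)
    show diagram: "is_functor J Seq D (\<lambda>x. (D (Dom J x), \<delta> x, D (Cod J x)))"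
      unfolding is_functor_def J_simps Obj_Seq Hom_Seq
      using seq_hom_Ident seq_hom_Zero g by (auto simp: Seq_simps D \<delta>)
    show "is_limit J Seq D (\<lambda>x. (D (Dom J x), \<delta> x, D (Cod J x))) S (\<lambda>x. (S, \<pi> x, D x))"
    proof (rule is_limit_SeqI[OF diagram refl])
      show "Dom J x \<in> Obj J \<and> Cod J x \<in> Obj J" if "x \<in> Arr J" for x
        by (simp add: J_simps)
      show "is_inverse_sequence C S"
        by (fact aD)
      show "seq_hom S (\<pi> j) (D j)" if "j \<in> Obj J" for j
        using that a seq_hom_Zero by (auto simp: J_simps D \<pi>)
      show "\<delta> x i \<cdot> \<pi> (Dom J x) i = \<pi> (Cod J x) i" if "x \<in> Arr J" for x i
        using that ga by (auto simp: J_simps \<delta> \<pi>)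
      show "\<exists>h. seq_hom W h S \<and> (\<forall>j \<in> Obj J. \<forall>i. \<pi> j i \<cdot> h i = q j i)"
        if W: "is_inverse_sequence C W" and q: "\<And>j. j \<in> Obj J \<Longrightarrow> seq_hom W (q j) (D j)"
          and cone: "\<And>x i. x \<in> Arr J \<Longrightarrow> \<delta> x i \<cdot> q (Dom J x) i = q (Cod J x) i" for W q
      proof -
        have q0: "seq_hom W (q (e 0)) T"
          using q[of "e 0"] by (simp add: J_simps D)
        note q0D = seq_homD(3)[OF q0]
        \<comment> \<open>The arrow \<open>e 3\<close> forces the leg of a cone at \<open>U\<close>
          to vanish; the arrow \<open>e 2\<close> then says that \<open>g\<close> kills the leg at
          \<open>T\<close>.\<close>
        have "Zero C (ob T i) (ob U i) \<cdot> q (e 0) i = q (e 4) i" for i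
          using cone[of "e 3" i] by (simp add: J_simps \<delta>)
        then have q1: "q (e 4) i = Zero C (ob W i) (ob U i)" for i
          using q0D[of i] by (metis Comp_Zero(2) hom_iff inverse_sequenceD(1) gD(2))
        have "g i \<cdot> q (e 0) i = Zero C (ob W i) (ob U i)" for i
          using cone[of "e 2" i] q1 by (simp add: J_simps \<delta>)
        then have "\<exists>u. u \<in> Hom C (ob W i) (ob S i) \<and> a i \<cdot> u = q (e 0) i" for i
          using exact[OF q0D] by blast
        then obtain h where h: "seq_hom W h S" "\<And>i. a i \<cdot> h i = q (e 0) i"
          using seq_hom_lift[OF a mono q0] by blast
        have "\<forall>i. Zero C (ob S i) (ob U i) \<cdot> h i = q (e 4) i"
          using seq_homD(3)[OF h(1)] q1 by simp
        then show ?thesis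
          using h by (auto simp: J_simps \<pi>)
      qed
      show "h = h'" if h: "seq_hom W h S" "seq_hom W h' S"
        and eq: "\<And>j i. j \<in> Obj J \<Longrightarrow> \<pi> j i \<cdot> h i = \<pi> j i \<cdot> h' i" for W h h'
      proof
        fix i
        have "a i \<cdot> h i = a i \<cdot> h' i"
          using eq[of "e 0" i] by (simp add: J_simps \<pi>)
        then show "h i = h' i"
          using mono_cancel[OF mono aD(3)] seq_homD(3)[OF h(1)] seq_homD(3)[OF h(2)] by blast
      qed
    qed
  qed
qed

section \<open>Embeddings and quotients of local sequences\<close>

text \<open>
  Among all morphisms from \<open>S\<close> to members of \<open>K\<close> there is one with least kernel \<open>M\<close>: it suffices to
  detect the small set of morphisms from a generator to \<open>S\<close>. Comparing with the next null-extension,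
  minimality makes the bonding maps of \<open>M\<close> epic, so \<open>M\<close> vanishes because \<open>lim S = 0\<close>.
\<close>

theorem local_embedding:
  assumes K: "closed_class \<kappa> C K" and S: "uniquely_solvable S"
  obtains T \<eta> where "T \<in> K" "seq_hom S \<eta> T" "\<And>i. is_mono C (\<eta> i)"
proof -
  have S_inv: "is_inverse_sequence C S"
    using S unfolding uniquely_solvable_def by blast
  note [simp] = S_inv
  obtain G where G: "generator C G"
    using generator_ex by blast
  have Gob: "G \<in> Obj C"
    using G unfolding generator_def by blast
  \<comment> \<open>A pair \<open>(i, x)\<close> enters \<open>\<Lambda>\<close> when some morphism
    into a member of \<open>K\<close> is nonzero on \<open>x\<close>. One such morphism per pair,
    combined in a product, detects everything that any morphism into \<open>K\<close>
    detects.\<close>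
  let ?detects = "\<lambda>i x T \<eta>. T \<in> K \<and> seq_hom S \<eta> T \<and> \<eta> i \<cdot> x \<noteq> Zero C G (ob T i)"
  define \<Lambda> where "\<Lambda> = {(i, x). x \<in> Hom C G (ob S i) \<and> (\<exists>T \<eta>. ?detects i x T \<eta>)}"
  have "small \<kappa> (SIGMA i:UNIV. Hom C G (ob S i))"
    using locally_small Gob unfolding locally_small_def
    by (intro small_Sigma[OF inaccessible] small_nat[OF inaccessible]) simp
  moreover have "\<Lambda> \<subseteq> (SIGMA i:UNIV. Hom C G (ob S i))"
    unfolding \<Lambda>_def by blast
  ultimately have small: "small \<kappa> \<Lambda>"
    by (rule small_subset[OF inaccessible])
  have "\<exists>T \<eta>. ?detects i x T \<eta>" if "(i, x) \<in> \<Lambda>" for i x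
    using that unfolding \<Lambda>_def by blast
  then have "\<exists>T \<eta>. ?detects (fst j) (snd j) T \<eta>" if "j \<in> \<Lambda>" for j
    using that by (metis prod.collapse)
  then obtain T \<eta> where T: "\<And>j. j \<in> \<Lambda> \<Longrightarrow> ?detects (fst j) (snd j) (T j) (\<eta> j)"
    by metis
  obtain P pr where P: "P \<in> K" and pr: "\<And>j. j \<in> \<Lambda> \<Longrightarrow> seq_hom P (pr j) (T j)"
    and univ: "\<And>S \<eta>. is_inverse_sequence C S \<Longrightarrow> (\<And>j. j \<in> \<Lambda> \<Longrightarrow> seq_hom S (\<eta> j) (T j)) \<Longrightarrow>
      \<exists>h. seq_hom S h P \<and> (\<forall>j\<in>\<Lambda>. \<forall>i. pr j i \<cdot> h i = \<eta> j i)"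
    by (rule closed_class_product[OF K small, of T]) (use T in blast)+
  obtain h where h: "seq_hom S h P" "\<And>j i. j \<in> \<Lambda> \<Longrightarrow> pr j i \<cdot> h i = \<eta> j i"
    using univ[OF S_inv, of \<eta>] T by blast
  note hD = seq_homD[OF h(1)]
  have detect: "\<eta>' i \<cdot> x = Zero C G (ob T' i)"
    if T': "T' \<in> K" "seq_hom S \<eta>' T'" and x: "x \<in> Hom C G (ob S i)"
      and hx: "h i \<cdot> x = Zero C G (ob P i)" for T' \<eta>' i x
  proof (rule ccontr)
    assume "\<eta>' i \<cdot> x \<noteq> Zero C G (ob T' i)"
    then have j: "(i, x) \<in> \<Lambda>"
      unfolding \<Lambda>_def using T' x by blast
    note prD = seq_homD[OF pr[OF j]]
    have "\<eta> (i, x) i \<cdot> x = pr (i, x) i \<cdot> (h i \<cdot> x)"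
      using prD(3)[of i] hD(3)[of i] x by (intro Comp_reassoc[OF h(2)[OF j], symmetric]) simp_all
    also have "\<dots> = Zero C G (ob (T (i, x)) i)"
      unfolding hx using prD(3)[of i] Gob by simp
    finally show False
      using T[OF j] by simp
  qed
  obtain T' \<eta>' where ext: "null_extension C T' P" and \<eta>': "seq_hom S \<eta>' T'"
    and lift: "\<And>i W k. k \<in> Hom C W (ob S i) \<Longrightarrow> \<eta>' i \<cdot> k = Zero C W (ob T' i) \<Longrightarrow>
      \<exists>Z e w. e \<in> Hom C Z W \<and> is_epi C e \<and> w \<in> Hom C Z (ob S (Suc i)) \<and>
        h (Suc i) \<cdot> w = Zero C Z (ob P (Suc i)) \<and> bond S i \<cdot> w = k \<cdot> e"
    by (rule null_extension_step[OF h(1)]) blast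
  have T'K: "T' \<in> K"
    using closed_class_null_extension[OF K P ext] .
  have "\<exists>M k. is_kernel C (h i) k \<and> k \<in> Hom C M (ob S i)" for i
    by (rule kernel_ex[OF hD(3)]) blast
  then obtain M k where ker: "\<And>i. is_kernel C (h i) (k i)" and k: "\<And>i. k i \<in> Hom C (M i) (ob S i)"
    by metis
  note kD = kernel_universal[OF ker hD(3) k]
  have "\<exists>m. m \<in> Hom C (M (Suc i)) (M i) \<and> k i \<cdot> m = bond S i \<cdot> k (Suc i)" for i
  proof (rule kD(2))
    show "bond S i \<cdot> k (Suc i) \<in> Hom C (M (Suc i)) (ob S i)"
      using k[of "Suc i"] by simp
    have "h i \<cdot> (bond S i \<cdot> k (Suc i)) = (bond P i \<cdot> h (Suc i)) \<cdot> k (Suc i)"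
      using k[of "Suc i"] hD(3)[of i] by (intro Comp_reassoc[OF hD(4)]) simp_all
    also have "\<dots> = bond P i \<cdot> (h (Suc i) \<cdot> k (Suc i))"
      using k[of "Suc i"] hD(3)[of "Suc i"] hD(2) by simp
    also have "\<dots> = Zero C (M (Suc i)) (ob P i)"
      unfolding kD(1) using k[of "Suc i"] hD(2) by simp
    finally show "h i \<cdot> (bond S i \<cdot> k (Suc i)) = Zero C (M (Suc i)) (ob P i)" .
  qed
  then obtain m where m: "\<And>i. m i \<in> Hom C (M (Suc i)) (M i)"
    and km: "\<And>i. k i \<cdot> m i = bond S i \<cdot> k (Suc i)"
    by metis
  note [simp] = k[simplified] m[simplified]
  \<comment> \<open>\<open>T'\<close> is again in \<open>K\<close>, so by minimality of
    \<open>h\<close> the map \<open>\<eta>' i\<close> kills \<open>k i\<close>. The lifting clause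
    then provides a cover \<open>e\<close> of \<open>M i\<close> that comes from the kernel in
    degree \<open>Suc i\<close>, so the epimorphism \<open>e\<close> factors through
    \<open>m i\<close>.\<close>
  have m_epi: "is_epi C (m i)" for i
  proof -
    have "\<eta>' i \<cdot> k i = Zero C (M i) (ob T' i)"
    proof (rule generator_zero[OF G])
      show \<eta>k: "\<eta>' i \<cdot> k i \<in> Hom C (M i) (ob T' i)"
        using seq_homD(3)[OF \<eta>', of i] by simp
      fix x assume x: "x \<in> Hom C G (M i)"
      have "h i \<cdot> (k i \<cdot> x) = Zero C (M i) (ob P i) \<cdot> x"
        using x hD(3)[of i] by (intro Comp_reassoc[OF kD(1)]) simp_all
      then have "h i \<cdot> (k i \<cdot> x) = Zero C G (ob P i)"
        using x hD(2) by simp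
      then have "\<eta>' i \<cdot> (k i \<cdot> x) = Zero C G (ob T' i)"
        using detect[OF T'K \<eta>', of "k i \<cdot> x" i] x by simp
      then show "(\<eta>' i \<cdot> k i) \<cdot> x = Zero C G (ob T' i)"
        using x seq_homD(3)[OF \<eta>', of i] by simp
    qed
    then obtain Z e w where e: "e \<in> Hom C Z (M i)" "is_epi C e" and w: "w \<in> Hom C Z (ob S (Suc i))"
      "h (Suc i) \<cdot> w = Zero C Z (ob P (Suc i))" "bond S i \<cdot> w = k i \<cdot> e"
      using lift[OF k] by blast
    obtain w' where w': "w' \<in> Hom C Z (M (Suc i))" "k (Suc i) \<cdot> w' = w"
      using kD(2)[OF w(1,2)] by blast
    have "k i \<cdot> (m i \<cdot> w') = (bond S i \<cdot> k (Suc i)) \<cdot> w'"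
      using w'(1) by (intro Comp_reassoc[OF km]) simp_all
    also have "\<dots> = k i \<cdot> e"
      using w' w(3) by simp
    finally have "m i \<cdot> w' = e"
      using mono_cancel[OF kD(3) k, of "m i \<cdot> w'" Z i e] e(1) w'(1) by simp
    then show "is_epi C (m i)"
      using epi_factor[OF _ w'(1) m] e(2) by simp
  qed
  have M_zero: "Ident C (M i) = Zero C (M i) (M i)" for i
  proof (rule epi_tower_zero[of m M, OF m m_epi])
    fix W y i
    assume W: "W \<in> Obj C" and y: "\<And>i. y i \<in> Hom C W (M i)" "\<And>i. y i = m i \<cdot> y (Suc i)"
    have "k i \<cdot> y i = Zero C W (ob S i)"
    proof (rule homogeneous_zero[OF S W])
      show "k i \<cdot> y i \<in> Hom C W (ob S i)" for i
        using y(1) k by (rule Comp_Hom)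
      show "k i \<cdot> y i = bond S i \<cdot> (k (Suc i) \<cdot> y (Suc i))" for i
      proof -
        have "k i \<cdot> y i = k i \<cdot> (m i \<cdot> y (Suc i))"
          using y(2)[of i] by (rule arg_cong)
        also have "\<dots> = (bond S i \<cdot> k (Suc i)) \<cdot> y (Suc i)"
          using y(1)[of "Suc i"] by (intro Comp_reassoc[OF km]) simp_all
        also have "\<dots> = bond S i \<cdot> (k (Suc i) \<cdot> y (Suc i))"
          using y(1)[of "Suc i"] by simp
        finally show ?thesis .
      qed
    qed
    then show "y i = Zero C W (M i)"
      using mono_zero[OF kD(3) k y(1)] by blast
  qed
  have "is_mono C (h i)" for i
  proof (rule monoI[OF hD(3)])
    fix W g assume g: "g \<in> Hom C W (ob S i)" "h i \<cdot> g = Zero C W (ob P i)"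
    then obtain u where u: "u \<in> Hom C W (M i)" "k i \<cdot> u = g"
      using kD(2) by blast
    have "u = Ident C (M i) \<cdot> u"
      using u by simp
    also have "\<dots> = Zero C W (M i)"
      unfolding M_zero using u by simp
    finally show "g = Zero C W (ob S i)"
      using u by auto
  qed
  then show thesis
    using that[OF P h(1)] by blast
qed

text \<open>Right-hand sides in \<open>Q\<close> must be lifted to \<open>T\<close> in all degrees
  over one cover of \<open>W\<close>, which a liftable epimorphism \<open>z\<close> permits. The
  image in \<open>Q\<close> of the solution over \<open>Z\<close> descends along \<open>z\<close>,
  because on whatever \<open>z\<close> kills the lifted right-hand side comes from
  \<open>S\<close>.\<close>

lemma uniquely_solvable_quotient:
  assumes a: "seq_hom S a T" and b: "seq_hom T b Q" and epi: "\<And>i. is_epi C (b i)"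
    and ba: "\<And>i. b i \<cdot> a i = Zero C (ob S i) (ob Q i)"
    and exact: "\<And>i W h. h \<in> Hom C W (ob T i) \<Longrightarrow> b i \<cdot> h = Zero C W (ob Q i) \<Longrightarrow>
      \<exists>u. u \<in> Hom C W (ob S i) \<and> a i \<cdot> u = h"
    and S: "uniquely_solvable S" and T: "uniquely_solvable T"
  shows "uniquely_solvable Q"
proof -
  note aD = seq_homD[OF a] and bD = seq_homD[OF b]
  note [simp] = aD(1,2) bD(2) aD(3)[simplified] bD(3)[simplified]
  \<comment> \<open>A right-hand side killed by \<open>b\<close> comes from \<open>S\<close> and is
    solved there; by uniqueness in \<open>T\<close> the given solution is the image of that
    one.\<close>
  have kernel_solution: "b i \<cdot> y i = Zero C W (ob Q i)"
    if W: "W \<in> Obj C" and x: "\<And>i. x i \<in> Hom C W (ob T i)"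
      and bx: "\<And>i. b i \<cdot> x i = Zero C W (ob Q i)" and y: "solution T W x y" for W x y i
  proof -
    obtain v where v: "\<And>i. v i \<in> Hom C W (ob S i)" "\<And>i. a i \<cdot> v i = x i"
      using exact[OF x bx] by metis
    obtain \<sigma> where \<sigma>: "solution S W v \<sigma>"
      using solution_ex[OF S W v(1)] .
    then have \<sigma>i: "\<sigma> i \<in> Hom C W (ob S i)" for i
      unfolding solution_def by blast
    have "solution T W x (\<lambda>i. a i \<cdot> \<sigma> i)"
      using solution_seq_hom[OF a v(1) \<sigma>] unfolding v(2) .
    then have "y = (\<lambda>i. a i \<cdot> \<sigma> i)"
      using solution_unique[OF T W x y] by blast
    then have "b i \<cdot> y i = b i \<cdot> (a i \<cdot> \<sigma> i)"
      by simp
    also have "\<dots> = Zero C W (ob Q i)"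
      using \<sigma>i[of i] Comp_reassoc[OF ba[of i], of "\<sigma> i"] by simp
    finally show ?thesis .
  qed
  show ?thesis
    unfolding uniquely_solvable_def
  proof (intro conjI allI impI bD(2))
    fix W x assume "W \<in> Obj C \<and> (\<forall>i. x i \<in> Hom C W (ob Q i))"
    then have W: "W \<in> Obj C" and x: "x i \<in> Hom C W (ob Q i)" for i
      by blast+
    obtain Z z where z: "z \<in> Hom C Z W" "is_epi C z" "liftable z"
      using liftable_epi_ex[OF W] .
    have Z: "Z \<in> Obj C"
      using z by simp
    note [simp] = z(1)[simplified] x[simplified]
    have lift: "\<exists>u. u \<in> Hom C Z (ob T i) \<and> b i \<cdot> u = c \<cdot> z" if c: "c \<in> Hom C W (ob Q i)" for c i
    proof -
      have "liftable (c \<cdot> z)" "c \<cdot> z \<in> Hom C Z (ob Q i)"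
        using liftable_Comp[OF z(3,1) c] c z(1) by simp_all
      then show ?thesis
        using liftableD[OF _ _ bD(3) epi] by metis
    qed
    obtain x' where x': "\<And>i. x' i \<in> Hom C Z (ob T i)" "\<And>i. b i \<cdot> x' i = x i \<cdot> z"
      using lift[OF x] by metis
    obtain y' where y': "solution T Z x' y'"
      using solution_ex[OF T Z x'(1)] .
    then have y'i: "y' i \<in> Hom C Z (ob T i)" for i
      unfolding solution_def by blast
    note [simp] = x'(1)[simplified] y'i[simplified]
    have "\<exists>u. u \<in> Hom C W (ob Q i) \<and> u \<cdot> z = b i \<cdot> y' i" for i
    proof (rule epi_cokernel[OF z(2,1)])
      show "b i \<cdot> y' i \<in> Hom C Z (ob Q i)"
        using Z by simp
      fix V v assume v: "v \<in> Hom C V Z" "z \<cdot> v = Zero C V W"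
      have "b j \<cdot> (x' j \<cdot> v) = Zero C V (ob Q j)" for j
      proof -
        have "b j \<cdot> (x' j \<cdot> v) = x j \<cdot> (z \<cdot> v)"
          using v(1) Comp_reassoc[OF x'(2)[of j], of v] by simp
        then show ?thesis
          unfolding v(2) using v(1) by simp
      qed
      moreover have "x' j \<cdot> v \<in> Hom C V (ob T j)" for j
        using v(1) x'(1) by (rule Comp_Hom)
      moreover have "V \<in> Obj C"
        using v by simp
      ultimately have "b i \<cdot> (y' i \<cdot> v) = Zero C V (ob Q i)"
        using kernel_solution[OF _ _ _ solution_Comp[OF aD(2) x'(1) y' v(1)]] by blast
      then show "(b i \<cdot> y' i) \<cdot> v = Zero C V (ob Q i)"
        using v(1) by simp
    qed blast
    then obtain y where y: "\<And>i. y i \<in> Hom C W (ob Q i)" "\<And>i. y i \<cdot> z = b i \<cdot> y' i"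
      by metis
    have "solution Q W x y"
      unfolding solution_def
    proof (intro conjI allI y(1))
      fix i
      have "solution Q Z (\<lambda>i. x i \<cdot> z) (\<lambda>i. y i \<cdot> z)"
        using solution_seq_hom[OF b x'(1) y'] unfolding x'(2) y(2) .
      then have "y i \<cdot> z = x i \<cdot> z \<oplus> bond Q i \<cdot> (y (Suc i) \<cdot> z)"
        unfolding solution_def by blast
      also have "\<dots> = (x i \<oplus> bond Q i \<cdot> y (Suc i)) \<cdot> z"
        using y(1)[of "Suc i"] by simp
      finally show "y i = x i \<oplus> bond Q i \<cdot> y (Suc i)"
        using epi_cancel[OF z(2,1) y(1), of "x i \<oplus> bond Q i \<cdot> y (Suc i)" i] y(1)[of "Suc i"] W
        by simp
    qed
    moreover have "c = c'" if c: "solution Q W x c" "solution Q W x c'" for c c'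
    proof
      fix i
      have ci: "c i \<in> Hom C W (ob Q i)" "c i = x i \<oplus> bond Q i \<cdot> c (Suc i)"
        "c' i \<in> Hom C W (ob Q i)" "c' i = x i \<oplus> bond Q i \<cdot> c' (Suc i)" for i
        using c unfolding solution_def by blast+
      have "\<exists>d. d \<in> Hom C W (ob Q i) \<and> c i = c' i \<oplus> d" for i
        using difference[OF ci(1,3)] by blast
      then obtain d where d: "\<And>i. d i \<in> Hom C W (ob Q i)" "\<And>i. c i = c' i \<oplus> d i"
        by metis
      have d_hom: "d i = bond Q i \<cdot> d (Suc i)" for i
      proof (rule Add_cancel[of "c' i" W "ob Q i"])
        show "c' i \<in> Hom C W (ob Q i)" "d i \<in> Hom C W (ob Q i)"
          by (fact ci d)+
        show "bond Q i \<cdot> d (Suc i) \<in> Hom C W (ob Q i)"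
          using d(1)[of "Suc i"] by simp
        have "c' i \<oplus> d i = x i \<oplus> bond Q i \<cdot> (c' (Suc i) \<oplus> d (Suc i))"
          using ci(2)[of i] unfolding d(2)[symmetric] .
        also have "\<dots> = (x i \<oplus> bond Q i \<cdot> c' (Suc i)) \<oplus> bond Q i \<cdot> d (Suc i)"
          using ci(3)[of "Suc i"] d(1)[of "Suc i"] by simp
        also have "\<dots> = c' i \<oplus> bond Q i \<cdot> d (Suc i)"
          using ci(4)[of i] by (rule arg_cong[OF sym])
        finally show "c' i \<oplus> d i = c' i \<oplus> bond Q i \<cdot> d (Suc i)" .
      qed
      \<comment> \<open>The lifts \<open>t\<close> of \<open>d \<cdot> z\<close> are chosen
        separately in each degree and need not be compatible. Their defect \<open>r\<close> is
        killed by \<open>b\<close>, and \<open>t\<close> solves the system with right-hand side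
        \<open>r\<close>, so \<open>kernel_solution\<close> gives the vanishing of
        \<open>d \<cdot> z\<close>.\<close>
      obtain t where t: "\<And>i. t i \<in> Hom C Z (ob T i)" "\<And>i. b i \<cdot> t i = d i \<cdot> z"
        using lift[OF d(1)] by metis
      have bt: "bond T i \<cdot> t (Suc i) \<in> Hom C Z (ob T i)" for i
        using t(1)[of "Suc i"] by simp
      have "\<exists>r. r \<in> Hom C Z (ob T i) \<and> t i = bond T i \<cdot> t (Suc i) \<oplus> r" for i
        using difference[OF t(1) bt] by blast
      then obtain r where r: "\<And>i. r i \<in> Hom C Z (ob T i)" "\<And>i. t i = bond T i \<cdot> t (Suc i) \<oplus> r i"
        by metis
      have br: "b i \<cdot> r i = Zero C Z (ob Q i)" for i
      proof (rule Add_cancel[of "d i \<cdot> z" Z "ob Q i"])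
        show dz: "d i \<cdot> z \<in> Hom C Z (ob Q i)" "b i \<cdot> r i \<in> Hom C Z (ob Q i)"
          using Comp_Hom[OF z(1) d(1)] Comp_Hom[OF r(1) bD(3)] by blast+
        show "Zero C Z (ob Q i) \<in> Hom C Z (ob Q i)"
          using Z by simp
        have "b i \<cdot> (bond T i \<cdot> t (Suc i)) = (bond Q i \<cdot> b (Suc i)) \<cdot> t (Suc i)"
          using t(1)[of "Suc i"] by (intro Comp_reassoc[OF bD(4)]) simp_all
        also have "\<dots> = bond Q i \<cdot> (b (Suc i) \<cdot> t (Suc i))"
          using t(1)[of "Suc i"] by simp
        also have "\<dots> = (bond Q i \<cdot> d (Suc i)) \<cdot> z"
          unfolding t(2) using d(1)[of "Suc i"] by simp
        finally have bbt: "b i \<cdot> (bond T i \<cdot> t (Suc i)) = d i \<cdot> z"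
          unfolding d_hom[symmetric] .
        have "d i \<cdot> z = b i \<cdot> (bond T i \<cdot> t (Suc i) \<oplus> r i)"
          unfolding r(2)[symmetric] t(2) ..
        also have "\<dots> = b i \<cdot> (bond T i \<cdot> t (Suc i)) \<oplus> b i \<cdot> r i"
          using r(1)[of i] t(1)[of "Suc i"] by simp
        finally show "d i \<cdot> z \<oplus> b i \<cdot> r i = d i \<cdot> z \<oplus> Zero C Z (ob Q i)"
          unfolding bbt using dz(1) by simp
      qed
      have "solution T Z r t"
        unfolding solution_def
      proof (intro conjI allI t(1))
        fix i
        show "t i = r i \<oplus> bond T i \<cdot> t (Suc i)"
          using r(2)[of i] Add_commute[of "bond T i \<cdot> t (Suc i)" "r i"] bt[of i] r(1)[of i]
          by (simp only: hom_iff)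
      qed
      then have "d i \<cdot> z = Zero C Z (ob Q i)"
        using kernel_solution[OF Z r(1) br] t(2) by metis
      then have "d i = Zero C W (ob Q i)"
        using epi_zero[OF z(2,1) d(1)] by blast
      then show "c i = c' i"
        using d(2)[of i] ci(3)[of i] by simp
    qed
    ultimately show "\<exists>!y. solution Q W x y"
      by blast
  qed
qed

lemma closed_class_Int:
  assumes "closed_class \<kappa> C K" "closed_class \<kappa> C K'"
  shows "closed_class \<kappa> C (K \<inter> K')"
  unfolding closed_class_def
proof (intro conjI allI impI)
  show "K \<inter> K' \<subseteq> Obj Seq"
    using assms unfolding closed_class_def by blast
  show "Z \<in> K \<inter> K'" if "zero_object Seq Z" for Z
    using assms that unfolding closed_class_def by blast
  show "closed_under_null_extensions C (K \<inter> K')"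
    using closed_class_null_extension[OF assms(1)] closed_class_null_extension[OF assms(2)]
    unfolding closed_under_null_extensions_def by blast
  show "closed_under_small_limits \<kappa> Seq (K \<inter> K')"
    unfolding closed_under_small_limits_def
  proof (intro allI impI)
    fix J :: "('u, 'u) category" and D D' L p
    assume *: "is_category J \<and> small \<kappa> (Obj J) \<and> small \<kappa> (Arr J) \<and> is_functor J Seq D D' \<and>
      D ` Obj J \<subseteq> K \<inter> K' \<and> is_limit J Seq D D' L p"
    have "L \<in> K"
      by (rule closed_class_limit[OF assms(1), of J D D' L p]) (use * in blast)+
    moreover have "L \<in> K'"
      by (rule closed_class_limit[OF assms(2), of J D D' L p]) (use * in blast)+
    ultimately show "L \<in> K \<inter> K'"
      by blast
  qed
qed

theorem local_subset_closed_class: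
  assumes K: "closed_class \<kappa> C K"
  shows "local_sequences C \<subseteq> K"
proof
  fix S assume "S \<in> local_sequences C"
  then have S: "uniquely_solvable S"
    by (simp add: local_iff_uniquely_solvable)
  \<comment> \<open>Embedding into the intersection makes \<open>T\<close> local, as
    \<open>uniquely_solvable_quotient\<close> requires. The quotient \<open>Q\<close> is then
    embedded into a member of \<open>K\<close> itself.\<close>
  obtain T a where T: "T \<in> K \<inter> local_sequences C" and a: "seq_hom S a T"
    and mono: "\<And>i. is_mono C (a i)"
    by (rule local_embedding[OF closed_class_Int[OF K closed_class_local] S]) blast
  note aD = seq_homD[OF a]
  note [simp] = aD(1,2) aD(3)[simplified]
  have "\<exists>q c. is_cokernel C (a i) c \<and> c \<in> Hom C (ob T i) q" for i
    by (rule cokernel_ex[OF aD(3)]) blast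
  then obtain q b where coker: "\<And>i. is_cokernel C (a i) (b i)"
    and b: "\<And>i. b i \<in> Hom C (ob T i) (q i)"
    by metis
  note bD = cokernel_universal[OF coker aD(3) b]
  note [simp] = b[simplified]
  have "\<exists>f. f \<in> Hom C (q (Suc i)) (q i) \<and> f \<cdot> b (Suc i) = b i \<cdot> bond T i" for i
  proof (rule bD(2))
    show "b i \<cdot> bond T i \<in> Hom C (ob T (Suc i)) (q i)"
      by simp
    have "(b i \<cdot> bond T i) \<cdot> a (Suc i) = b i \<cdot> (a i \<cdot> bond S i)"
      by (simp add: aD(4))
    also have "\<dots> = Zero C (ob S (Suc i)) (q i)"
      using Comp_reassoc[OF bD(1)[of i], of "bond S i"] by simp
    finally show "(b i \<cdot> bond T i) \<cdot> a (Suc i) = Zero C (ob S (Suc i)) (q i)" .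
  qed
  then obtain f where f: "\<And>i. f i \<in> Hom C (q (Suc i)) (q i)"
    "\<And>i. f i \<cdot> b (Suc i) = b i \<cdot> bond T i"
    by metis
  define Q where "Q = \<lparr>ob = q, bond = f\<rparr>"
  have Q: "is_inverse_sequence C Q"
    unfolding is_inverse_sequence_def Q_def using f(1) by simp
  have b_hom: "seq_hom T b Q"
    unfolding seq_hom_def using Q b f(2) by (simp add: Q_def)
  \<comment> \<open>A monomorphism is the kernel of its cokernel: a map killing \<open>a i\<close>
    factors through \<open>b i\<close>, so it kills \<open>h\<close>.\<close>
  have exact: "\<exists>u. u \<in> Hom C W (ob S i) \<and> a i \<cdot> u = h"
    if h: "h \<in> Hom C W (ob T i)" "b i \<cdot> h = Zero C W (ob Q i)" for i W h
  proof (rule mono_kernel[OF mono aD(3) h(1)])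
    fix V v assume v: "v \<in> Hom C (ob T i) V" "v \<cdot> a i = Zero C (ob S i) V"
    then obtain v' where v': "v' \<in> Hom C (q i) V" "v' \<cdot> b i = v"
      using bD(2) by blast
    have "v \<cdot> h = v' \<cdot> (b i \<cdot> h)"
      using v' h(1) by (simp flip: v'(2))
    then show "v \<cdot> h = Zero C W V"
      unfolding h(2) using v'(1) h(1) by (simp add: Q_def)
  qed blast
  have "uniquely_solvable Q"
  proof (rule uniquely_solvable_quotient[OF a b_hom bD(3)])
    show "b i \<cdot> a i = Zero C (ob S i) (ob Q i)" for i
      using bD(1) by (simp add: Q_def)
  qed (use exact S T local_iff_uniquely_solvable in auto)
  then obtain U \<theta> where U: "U \<in> K" and \<theta>: "seq_hom Q \<theta> U" and \<theta>_mono: "\<And>i. is_mono C (\<theta> i)"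
    by (rule local_embedding[OF K]) blast
  note \<theta>D = seq_homD[OF \<theta>]
  show "S \<in> K"
  proof (rule closed_class_kernel[OF K _ U seq_hom_Comp[OF b_hom \<theta>] a])
    show "T \<in> K"
      using T by blast
    fix i
    have \<theta>q: "\<theta> i \<in> Hom C (q i) (ob U i)"
      using \<theta>D(3)[of i] by (simp add: Q_def)
    show "(\<theta> i \<cdot> b i) \<cdot> a i = Zero C (ob S i) (ob U i)"
      using \<theta>q bD(1) by simp
    show "is_mono C (a i)"
      by (fact mono)
    fix W h assume h: "h \<in> Hom C W (ob T i)" "(\<theta> i \<cdot> b i) \<cdot> h = Zero C W (ob U i)"
    have "b i \<cdot> h = Zero C W (ob Q i)"
      using mono_zero[OF \<theta>_mono \<theta>D(3), of "b i \<cdot> h" W i] h \<theta>q by (simp add: Q_def)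
    then show "\<exists>u. u \<in> Hom C W (ob S i) \<and> a i \<cdot> u = h"
      using exact[OF h(1)] by blast
  qed
qed

end

theorem theorem4p1:
  fixes \<kappa> :: "'u rel" and C :: "('o, 'm) preadditive_category"
  assumes "inaccessible \<kappa>"
    and "is_abelian C" and "locally_small \<kappa> C"
    and "\<exists>G. generator C G"
    and "has_small_coproducts \<kappa> C"
    and "has_small_products \<kappa> C" and "exact_small_products \<kappa> C"
  shows "closed_class \<kappa> C (local_sequences C) \<and>
    (\<forall>K. closed_class \<kappa> C K \<longrightarrow> local_sequences C \<subseteq> K)"
proof -
  interpret exact_products C \<kappa>
  proof
    show "is_preadditive C"
      using assms(2) unfolding is_abelian_def by blast
  qed (fact assms)+
  show ?thesis
    using closed_class_local local_subset_closed_class by blast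
qed

end
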